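(* Let $a_1,a_2,c_1,c_2\in\mathbb{R}$ satisfy $a_1<a_2$, $c_1<c_2$, $a_1+c_1<0$, $a_2+c_2>0$, and let $p^1(x)=a_1x_1^2+c_1x_2^2$, $p^2(x)=a_2x_1^2+c_2x_2^2$ on $\mathbb{R}^2$. Let $u_0$ be a homogeneous of degree two global solution to the double obstacle problem with obstacles $p^1\le p^2$. If $u_0$ is neither a polynomial nor a halfspace solution, then it is a double-cone solution. Moreover: Case 1) If $a_2+c_1=c_2+a_1=0$, then there are infinitely many double-cone solutions, and for each of them each of the two cones $\mathcal{S}_1$ and $\mathcal{S}_2$ forming the noncoincidence set has opening angle $\vartheta=\pi/2$. Case 2) If $(a_1+c_2)(c_1+a_2)<0$, then there exist four double-cone solutions. Furthermore, denoting by $\vartheta_i$ the opening angle of $\mathcal{S}_i$, $i=1,2$, $$\vartheta_1=\vartheta_2=\vartheta\quad\text{and}\quad \cos^2\vartheta=\frac{(a_1+c_2)(a_2+c_1)}{(a_1+c_1)(a_2+c_2)}\in(0,1).$$ Case 3) If $(a_1+c_2)(c_1+a_2)\ge 0$, and $a_1+c_2\ne 0$ or $a_2+c_1\neq 0$, then there are no double-cone solutions.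
   Context: Let $\lambda_i=\Delta p^i$ (so $\lambda_1=2(a_1+c_1)<0<\lambda_2=2(a_2+c_2)$). A global solution to the (normalised) double obstacle problem with obstacles $p^1\le p^2$ is a function $u\in C^{1,1}_{loc}(\mathbb{R}^2)$ with $p^1\le u\le p^2$ and $\Delta u=\lambda_1\chi_{\{u=p^1\}}+\lambda_2\chi_{\{u=p^2\}}$ a.e. in $\mathbb{R}^2$. It is homogeneous of degree two if $u(rx)=r^2u(x)$ for all $x$ and $r>0$. Halfspace solution: $u$ is a halfspace solution corresponding to $p^1$ if $u\le p^2$ in $\mathbb{R}^2$ and $u-p^1=-\frac{\lambda_1}{2}(x\cdot e)_+^2$ for a unit vector $e$; it is a halfspace solution corresponding to $p^2$ if $u\ge p^1$ in $\mathbb{R}^2$ and $p^2-u=\frac{\lambda_2}{2}(x\cdot e)_+^2$ for a unit vector $e$. Double-cone solution: a global solution $u$ such that both $\{u=p^1\}$ and $\{u=p^2\}$ are halfcones with a common vertex (here the origin); a halfcone in $\mathbb{R}^2$ is a closed sector $\{(r\cos\theta,r\sin\theta): r\ge0,\ \theta\in[a,b]\}$ with opening angle $b-a\in(0,\pi)$. For a double-cone solution the noncoincidence set $\{p^1<u<p^2\}$ consists of two disjoint open sectors with vertex at the origin, denoted $\mathcal{S}_1$ and $\mathcal{S}_2$. *)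

theory Defs
  imports "HOL-Analysis.Analysis"
begin

definition C11_loc :: "(real^2 \<Rightarrow> real) \<Rightarrow> bool" where
  "C11_loc u \<longleftrightarrow> (\<exists>g. (\<forall>x. GDERIV u x :> g x) \<and>
     (\<forall>K. compact K \<longrightarrow> (\<exists>L. L-lipschitz_on K g)))"

(* The Laplacian at a point as the trace of the derivative of the gradient.  A function of class
   C^{1,1}_loc has a gradient that is differentiable almost everywhere (Rademacher), so demanding
   this relation almost everywhere is the usual notion of a strong solution. *)
definition has_laplacian :: "(real^2 \<Rightarrow> real) \<Rightarrow> real \<Rightarrow> real^2 \<Rightarrow> bool" where
  "has_laplacian u L x \<longleftrightarrow> (\<exists>g H. (\<forall>\<^sub>F y in nhds x. GDERIV u y :> g y) \<and>
     (g has_derivative H) (at x) \<and> (\<Sum>b\<in>Basis. H b \<bullet> b) = L)"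

definition quadratic_obstacle :: "real \<Rightarrow> real \<Rightarrow> real^2 \<Rightarrow> real" where
  "quadratic_obstacle a c x = a * (x $ 1)\<^sup>2 + c * (x $ 2)\<^sup>2"

lemma quadratic_obstacle_has_laplacian:
  "has_laplacian (quadratic_obstacle a c) (2 * (a + c)) x"
proof -
  define g :: "real^2 \<Rightarrow> real^2" where "g = (\<lambda>y. vector [2 * a * y $ 1, 2 * c * y $ 2])"
  have G: "GDERIV (quadratic_obstacle a c) y :> g y" for y
  proof -
    have "(quadratic_obstacle a c has_derivative
        (\<lambda>h. a * (2 * (y $ 1 * h $ 1)) + c * (2 * (y $ 2 * h $ 2)))) (at y)"
      unfolding quadratic_obstacle_def[abs_def]
      by (auto intro!: derivative_eq_intros bounded_linear.has_derivative[OF bounded_linear_vec_nth]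
          simp: algebra_simps)
    also have "(\<lambda>h. a * (2 * (y $ 1 * h $ 1)) + c * (2 * (y $ 2 * h $ 2))) = (\<lambda>h. h \<bullet> g y)"
      by (auto simp: g_def inner_vec_def sum_2 algebra_simps)
    finally show ?thesis
      by (simp add: gderiv_def)
  qed
  have lin: "linear g"
    by (rule linearI) (auto simp: g_def vec_eq_iff forall_2 algebra_simps)
  have D: "(g has_derivative g) (at x)"
    using lin by (simp add: linear_conv_bounded_linear bounded_linear_imp_has_derivative)
  have B: "(Basis :: (real^2) set) = {axis 1 1, axis 2 1}"
    by (auto simp: Basis_vec_def UNIV_2)
  have "axis 1 1 \<noteq> (axis 2 1 :: real^2)"
    by (simp add: axis_eq_axis)
  then have "(\<Sum>b\<in>Basis. g b \<bullet> b) = g (axis 1 1) \<bullet> axis 1 1 + g (axis 2 1) \<bullet> axis 2 1"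
    unfolding B by (subst sum.insert) auto
  also have "\<dots> = 2 * (a + c)"
    by (simp add: g_def axis_def inner_vec_def sum_2)
  finally have "(\<Sum>b\<in>Basis. g b \<bullet> b) = 2 * (a + c)" .
  with D show ?thesis
    unfolding has_laplacian_def by (intro exI[of _ g]) (simp add: G)
qed

definition global_solution ::
  "real \<Rightarrow> real \<Rightarrow> (real^2 \<Rightarrow> real) \<Rightarrow> (real^2 \<Rightarrow> real) \<Rightarrow> (real^2 \<Rightarrow> real) \<Rightarrow> bool" where
  "global_solution l1 l2 p1 p2 u \<longleftrightarrow> C11_loc u \<and> (\<forall>x. p1 x \<le> u x \<and> u x \<le> p2 x) \<and>
     (AE x in lebesgue. has_laplacian u
        (l1 * indicat_real {y. u y = p1 y} x + l2 * indicat_real {y. u y = p2 y} x) x)"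

definition homogeneous_deg2 :: "(real^2 \<Rightarrow> real) \<Rightarrow> bool" where
  "homogeneous_deg2 u \<longleftrightarrow> (\<forall>x. \<forall>r>0. u (r *\<^sub>R x) = r\<^sup>2 * u x)"

definition halfspace_solution1 ::
  "real \<Rightarrow> (real^2 \<Rightarrow> real) \<Rightarrow> (real^2 \<Rightarrow> real) \<Rightarrow> (real^2 \<Rightarrow> real) \<Rightarrow> bool" where
  "halfspace_solution1 l1 p1 p2 u \<longleftrightarrow> (\<forall>x. u x \<le> p2 x) \<and>
     (\<exists>e. norm e = 1 \<and> (\<forall>x. u x - p1 x = - (l1 / 2) * (max 0 (x \<bullet> e))\<^sup>2))"

definition halfspace_solution2 ::
  "real \<Rightarrow> (real^2 \<Rightarrow> real) \<Rightarrow> (real^2 \<Rightarrow> real) \<Rightarrow> (real^2 \<Rightarrow> real) \<Rightarrow> bool" where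
  "halfspace_solution2 l2 p1 p2 u \<longleftrightarrow> (\<forall>x. p1 x \<le> u x) \<and>
     (\<exists>e. norm e = 1 \<and> (\<forall>x. p2 x - u x = (l2 / 2) * (max 0 (x \<bullet> e))\<^sup>2))"

definition polar_point :: "real \<Rightarrow> real \<Rightarrow> real^2" where
  "polar_point r t = vector [r * cos t, r * sin t]"

definition halfcone :: "(real^2) set \<Rightarrow> bool" where
  "halfcone C \<longleftrightarrow> (\<exists>a b. 0 < b - a \<and> b - a < pi \<and>
     C = {polar_point r t | r t. 0 \<le> r \<and> a \<le> t \<and> t \<le> b})"

(* The bound 2 * pi makes the opening angle a function of the set S. *)
definition open_sector :: "(real^2) set \<Rightarrow> real \<Rightarrow> bool" where
  "open_sector S \<theta> \<longleftrightarrow> 0 < \<theta> \<and> \<theta> < 2 * pi \<and>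
     (\<exists>a. S = {polar_point r t | r t. 0 < r \<and> a < t \<and> t < a + \<theta>})"

definition double_cone_solution ::
  "real \<Rightarrow> real \<Rightarrow> (real^2 \<Rightarrow> real) \<Rightarrow> (real^2 \<Rightarrow> real) \<Rightarrow> (real^2 \<Rightarrow> real) \<Rightarrow> bool" where
  "double_cone_solution l1 l2 p1 p2 u \<longleftrightarrow> global_solution l1 l2 p1 p2 u \<and>
     halfcone {x. u x = p1 x} \<and> halfcone {x. u x = p2 x}"

(* The two disjoint sectors are the connected components of the noncoincidence set, so they and
   their opening angles are determined by u up to the order. *)
definition noncoincidence_angles ::
  "(real^2 \<Rightarrow> real) \<Rightarrow> (real^2 \<Rightarrow> real) \<Rightarrow> (real^2 \<Rightarrow> real) \<Rightarrow> real \<Rightarrow> real \<Rightarrow> bool" where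
  "noncoincidence_angles p1 p2 u \<theta>1 \<theta>2 \<longleftrightarrow>
     (\<exists>S1 S2. open_sector S1 \<theta>1 \<and> open_sector S2 \<theta>2 \<and> S1 \<inter> S2 = {} \<and>
        {x. p1 x < u x \<and> u x < p2 x} = S1 \<union> S2)"

end

theory Submission
  imports Defs "HOL-Complex_Analysis.Complex_Analysis"
begin

text \<open>
  On the noncoincidence set the complex gradient \<open>u\<^sub>x - \<i> u\<^sub>y\<close> is holomorphic, and on an edge of
  a sector of that set, where \<open>u\<close> touches an obstacle, it has the boundary values of the gradient of
  that obstacle.  By unique continuation \<open>u\<close> is a quadratic form on the sector: with
  \<open>m1 = - (a1 + c1)\<close> and \<open>m2 = a2 + c2\<close> it equals \<open>p1 + m1 (r sin (t - a))^2\<close> if the edge \<open>t = a\<close>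
  lies in \<open>{u = p1}\<close>, and \<open>p2 - m2 (r sin (t - b))^2\<close> if the edge \<open>t = b\<close> lies in \<open>{u = p2}\<close>.
  Hence an arc of the unit circle with both edges of the same kind has length \<open>\<pi>\<close>, while an arc
  with edges \<open>a\<close>, \<open>b\<close> of different kind is shorter and satisfies the triangle relation
  \<open>m1 exp (2ia) + m2 exp (2ib) = - d\<close> with \<open>d = (a2 - c2) - (a1 - c1)\<close>.  Comparing two such
  relations leaves only polynomials, halfspace solutions and double cones, and the double cones
  correspond to the triangles with sides \<open>m1\<close>, \<open>m2\<close>, \<open>\<bar>d\<bar>\<close>: for \<open>d \<noteq> 0\<close> they are symmetric about
  a coordinate axis, which gives four of them if the triangle is nondegenerate and none otherwise,
  and for \<open>d = 0\<close>, \<open>m1 = m2\<close> the triangle can be rotated freely.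
\<close>

section \<open>Regularity of functions with almost everywhere vanishing Laplacian\<close>

text \<open>Three difficulties shape the argument. The equation is known only almost everywhere, in
  terms of second derivatives of a \<open>C^{1,1}\<close> function, so holomorphy is obtained from a
  primitive built out of line integrals of the Lipschitz gradient. A coincidence set on the circle
  is at first an arbitrary closed set, possibly with infinitely many components; free arcs are
  therefore found by extremal choices of zeros, and the matching relations force the remaining
  structure. Finally, a double cone is defined by its coincidence sets and is not given as
  homogeneous; the analysis on the circle therefore assumes only that contact is constant along
  rays, which serves the classification and the count at once. The \<open>sin\<close> terms have a
  simple origin: \<open>p1\<close> has Laplacian \<open>- 2 * m1\<close>, so adding
  \<open>m1\<close> times the squared distance to the line through the edge makes it harmonic while
  keeping value and gradient on that line; for \<open>p2\<close> the sign is reversed. Existence is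
  the converse: pieces whose values and gradients agree along the edges are glued.\<close>

lemma integral_difference_quotient:
  fixes F f :: "real \<Rightarrow> real"
  assumes ab: "a \<le> b" and h: "0 < h"
    and F: "\<And>x. (F has_real_derivative f x) (at x)"
    and L: "L-lipschitz_on {a..b+h} f"
  shows "\<bar>integral {a..b} (\<lambda>x. (f (x + h) - f x) / h) - (f b - f a)\<bar> \<le> 2 * L * h"
proof -
  define G where "G x = (F (x + h) - F x) / h" for x
  have "(G has_real_derivative (f (x + h) - f x) / h) (at x)" for x
    unfolding G_def using h by (auto intro!: derivative_eq_intros DERIV_chain2[OF F] F)
  then have "((\<lambda>x. (f (x + h) - f x) / h) has_integral (G b - G a)) {a..b}"
    by (intro fundamental_theorem_of_calculus ab)
      (auto simp: has_real_derivative_iff_has_vector_derivative[symmetric] intro: DERIV_subset)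
  then have I: "integral {a..b} (\<lambda>x. (f (x + h) - f x) / h) = G b - G a"
    by (rule integral_unique)
  \<comment> \<open>\<open>G\<close> is an antiderivative of the quotient, and by the mean value
    theorem \<open>G x\<close> is a value of \<open>f\<close> within distance \<open>h\<close> of
    \<open>x\<close>.\<close>
  have "\<bar>G x - f x\<bar> \<le> L * h" if "x \<in> {a, b}" for x
  proof -
    obtain z where z: "z > x" "z < x + h" "F (x + h) - F x = (x + h - x) * f z"
      using MVT2[of x "x + h" F f] F h by auto
    then have "G x = f z"
      using h by (simp add: G_def)
    moreover have "dist (f z) (f x) \<le> L * dist z x"
      using z that ab h by (intro lipschitz_onD[OF L]) auto
    moreover have "L * dist z x \<le> L * h"
      using z lipschitz_on_nonneg[OF L] by (intro mult_left_mono) (auto simp: dist_real_def)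
    ultimately show ?thesis
      by (simp add: dist_real_def)
  qed
  from this[of a] this[of b] show ?thesis
    unfolding I by auto
qed

text \<open>Fubini turns the double integral into an integral over horizontal lines, on each of
  which the one-dimensional estimate applies. The Lipschitz bound is taken on a box enlarged by 1
  because the quotients look ahead by \<open>h \<le> 1\<close>; the pointwise bound serves as the
  majorant for dominated convergence.\<close>

lemma integral_column_difference_quotient:
  fixes U Ux :: "real \<Rightarrow> real \<Rightarrow> real"
  assumes le: "x0 \<le> x1" "y0 \<le> y1" and h: "0 < h" "h \<le> 1"
    and Ux: "\<And>x y. ((\<lambda>x. U x y) has_real_derivative Ux x y) (at x)"
    and Lx: "L-lipschitz_on (cbox (x0, y0) (x1 + 1, y1 + 1)) (\<lambda>(x, y). Ux x y)"
  defines "P \<equiv> \<lambda>(x, y). (Ux (x + h) y - Ux x y) / h"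
  shows "continuous_on (cbox (x0, y0) (x1, y1)) P"
    and "\<And>z. z \<in> cbox (x0, y0) (x1, y1) \<Longrightarrow> \<bar>P z\<bar> \<le> L"
    and "\<bar>integral (cbox (x0, y0) (x1, y1)) P - integral {y0..y1} (\<lambda>y. Ux x1 y - Ux x0 y)\<bar> \<le> 2 * L * h * (y1 - y0)"
proof -
  define R where "R = cbox (x0, y0) (x1, y1)"
  have L0: "L \<ge> 0"
    using lipschitz_on_nonneg[OF Lx] .
  have cUx: "continuous_on (cbox (x0, y0) (x1 + 1, y1 + 1)) (\<lambda>(x, y). Ux x y)"
    using Lx by (rule lipschitz_on_continuous_on)
  have cP: "continuous_on R P"
  proof -
    have "continuous_on R (\<lambda>z. (\<lambda>(x, y). Ux x y) (fst z + h, snd z))"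
      using h by (intro continuous_on_compose2[OF cUx] continuous_intros)
        (auto simp: R_def intro: add_mono add_increasing2)
    moreover have "continuous_on R (\<lambda>(x, y). Ux x y)"
      by (rule continuous_on_subset[OF cUx]) (auto simp: R_def)
    ultimately show ?thesis
      using h(1) unfolding P_def split_beta by (auto intro!: continuous_intros)
  qed
  then show "continuous_on (cbox (x0, y0) (x1, y1)) P" by (simp add: R_def)
  show "\<bar>P z\<bar> \<le> L" if "z \<in> cbox (x0, y0) (x1, y1)" for z
  proof -
    obtain x y where z: "z = (x, y)" by (cases z)
    have "dist (Ux (x + h) y) (Ux x y) \<le> L * dist (x + h, y) (x, y)"
      using lipschitz_onD[OF Lx, of "(x + h, y)" "(x, y)"] that h by (auto simp: z)
    then have "\<bar>Ux (x + h) y - Ux x y\<bar> \<le> L * h"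
      using h by (simp add: dist_Pair_Pair dist_real_def)
    then show ?thesis
      using h(1) by (simp add: P_def z divide_le_eq abs_divide)
  qed
  have "integral R (P) = integral (cbox x0 x1) (\<lambda>x. integral (cbox y0 y1) (\<lambda>y. P (x, y)))"
    unfolding R_def by (rule integral_prod_continuous) (use cP in \<open>simp add: R_def\<close>)
  also have "\<dots> = integral (cbox y0 y1) (\<lambda>y. integral (cbox x0 x1) (\<lambda>x. P (x, y)))"
    by (rule integral_swap_continuous) (use cP in \<open>simp add: R_def\<close>)
  finally have 1: "integral R (P) = integral {y0..y1} (\<lambda>y. integral {x0..x1} (\<lambda>x. P (x, y)))"
    by simp
  have "continuous_on ({y0..y1} \<times> cbox x0 x1) (\<lambda>z. P (snd z, fst z))"
    by (rule continuous_on_compose2[OF cP])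
      (auto intro!: continuous_intros simp: R_def cbox_Pair_eq)
  then have 2: "(\<lambda>y. integral (cbox x0 x1) (\<lambda>x. P (x, y))) integrable_on {y0..y1}"
    by (intro integrable_continuous_interval integral_continuous_on_param) (simp add: split_beta)
  have cc: "continuous_on {y0..y1} (\<lambda>y. Ux c y)" if "c \<in> {x0, x1}" for c
  proof -
    have "continuous_on {y0..y1} (\<lambda>y. (\<lambda>(x, y). Ux x y) (c, y))"
      by (rule continuous_on_compose2[OF cUx], intro continuous_intros)
        (use that le in auto)
    then show ?thesis by simp
  qed
  have 3: "(\<lambda>y. Ux x1 y - Ux x0 y) integrable_on {y0..y1}"
    by (intro integrable_continuous_interval continuous_on_diff cc) auto
  have "integral R (P) - integral {y0..y1} (\<lambda>y. Ux x1 y - Ux x0 y)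
      = integral {y0..y1} (\<lambda>y. integral {x0..x1} (\<lambda>x. P (x, y)) - (Ux x1 y - Ux x0 y))"
    unfolding 1 by (rule integral_diff[symmetric]) (use 2 3 in simp_all)
  also have "norm \<dots> \<le> integral {y0..y1} (\<lambda>y. 2 * L * h)"
  proof (rule integral_norm_bound_integral)
    show "(\<lambda>y. integral {x0..x1} (\<lambda>x. P (x, y)) - (Ux x1 y - Ux x0 y)) integrable_on {y0..y1}"
      by (rule integrable_diff) (use 2 3 in simp_all)
    fix y assume y: "y \<in> {y0..y1}"
    have "L-lipschitz_on {x0..x1 + h} (\<lambda>x. Ux x y)"
    proof (rule lipschitz_onI[OF _ L0])
      fix s t assume "s \<in> {x0..x1 + h}" "t \<in> {x0..x1 + h}"
      then show "dist (Ux s y) (Ux t y) \<le> L * dist s t"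
        using lipschitz_onD[OF Lx, of "(s, y)" "(t, y)"] y h by (auto simp: dist_Pair_Pair)
    qed
    from integral_difference_quotient[OF le(1) h(1) Ux this]
    show "norm (integral {x0..x1} (\<lambda>x. P (x, y)) - (Ux x1 y - Ux x0 y)) \<le> 2 * L * h"
      by (simp add: P_def)
  qed auto
  finally show "\<bar>integral (cbox (x0, y0) (x1, y1)) P - integral {y0..y1} (\<lambda>y. Ux x1 y - Ux x0 y)\<bar> \<le> 2 * L * h * (y1 - y0)"
    using le by (simp add: ac_simps R_def)
qed

text \<open>Green's identity for a Lipschitz field: the double integral of the difference quotients tends to
  the flux by Fubini and to zero by dominated convergence, so only the derivative almost everywhere
  enters.\<close>

lemma rectangle_flux_zero:
  fixes U Ux Uy :: "real \<Rightarrow> real \<Rightarrow> real"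
  assumes le: "x0 \<le> x1" "y0 \<le> y1"
    and Ux: "\<And>x y. ((\<lambda>x. U x y) has_real_derivative Ux x y) (at x)"
    and Uy: "\<And>x y. ((\<lambda>y. U x y) has_real_derivative Uy x y) (at y)"
    and Lx: "L-lipschitz_on (cbox (x0, y0) (x1 + 1, y1 + 1)) (\<lambda>(x, y). Ux x y)"
    and Ly: "L-lipschitz_on (cbox (x0, y0) (x1 + 1, y1 + 1)) (\<lambda>(x, y). Uy x y)"
    and N: "negligible N"
    and lim: "\<And>x y. (x, y) \<in> cbox (x0, y0) (x1, y1) - N \<Longrightarrow>
       (\<lambda>n. (Ux (x + inverse (Suc n)) y - Ux x y) / inverse (Suc n)
          + (Uy x (y + inverse (Suc n)) - Uy x y) / inverse (Suc n)) \<longlonglongrightarrow> 0"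
  shows "integral {y0..y1} (\<lambda>y. Ux x1 y - Ux x0 y) + integral {x0..x1} (\<lambda>x. Uy x y1 - Uy x y0) = 0"
proof -
  define h where "h n = inverse (real (Suc n))" for n
  have h: "0 < h n" "h n \<le> 1" for n
    by (auto simp: h_def field_simps)
  have h0: "h \<longlonglongrightarrow> 0"
    unfolding h_def by (rule LIMSEQ_inverse_real_of_nat)
  define R where "R = cbox (x0, y0) (x1, y1)"
  define P where "P n = (\<lambda>(x, y). (Ux (x + h n) y - Ux x y) / h n)" for n
  define Q where "Q n = (\<lambda>(x, y). (Uy x (y + h n) - Uy x y) / h n)" for n
  define Q' where "Q' n = (\<lambda>(y, x). (Uy x (y + h n) - Uy x y) / h n)" for n
  define I where "I = integral {y0..y1} (\<lambda>y. Ux x1 y - Ux x0 y)"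
  define J where "J = integral {x0..x1} (\<lambda>x. Uy x y1 - Uy x y0)"
  have L0: "L \<ge> 0"
    using lipschitz_on_nonneg[OF Lx] .
  \<comment> \<open>With the coordinates interchanged, the estimate for columns also covers the
    quotients in the second variable.\<close>
  have Ly': "L-lipschitz_on (cbox (y0, x0) (y1 + 1, x1 + 1)) (\<lambda>(y, x). Uy x y)"
  proof (rule lipschitz_onI[OF _ L0])
    fix z w assume "z \<in> cbox (y0, x0) (y1 + 1, x1 + 1)" "w \<in> cbox (y0, x0) (y1 + 1, x1 + 1)"
    then show "dist ((\<lambda>(y, x). Uy x y) z) ((\<lambda>(y, x). Uy x y) w) \<le> L * dist z w"
      using lipschitz_onD[OF Ly, of "prod.swap z" "prod.swap w"]
      by (auto simp: dist_prod_def add.commute split: prod.splits)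
  qed
  note column = integral_column_difference_quotient[OF le h Ux Lx, folded P_def R_def I_def]
  note row = integral_column_difference_quotient[OF le(2,1) h Uy Ly', folded Q'_def J_def]
  have cP: "continuous_on R (P n)" for n by (rule column(1))
  have cQ: "continuous_on R (Q n)" for n
  proof -
    have "continuous_on R (\<lambda>z. Q' n (snd z, fst z))"
      by (rule continuous_on_compose2[OF row(1)]) (auto simp: R_def intro!: continuous_intros)
    then show ?thesis by (simp add: Q_def Q'_def split_beta)
  qed
  have bP: "\<bar>P n z\<bar> \<le> L" if "z \<in> R" for n z by (rule column(2)[OF that])
  have bQ: "\<bar>Q n z\<bar> \<le> L" if "z \<in> R" for n z
    using row(2)[of "prod.swap z" n] that by (auto simp: Q_def Q'_def R_def split: prod.splits)
  have intQ: "integral R (Q n) = integral (cbox (y0, x0) (y1, x1)) (Q' n)" for n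
  proof -
    have "integral R (Q n) = integral (cbox x0 x1) (\<lambda>x. integral (cbox y0 y1) (\<lambda>y. Q n (x, y)))"
      unfolding R_def by (rule integral_prod_continuous) (use cQ in \<open>simp add: R_def\<close>)
    also have "\<dots> = integral (cbox y0 y1) (\<lambda>y. integral (cbox x0 x1) (\<lambda>x. Q n (x, y)))"
      by (rule integral_swap_continuous) (use cQ in \<open>simp add: R_def\<close>)
    also have "\<dots> = integral (cbox (y0, x0) (y1, x1)) (Q' n)"
      by (subst integral_prod_continuous[OF row(1)]) (simp add: Q_def Q'_def)
    finally show ?thesis .
  qed
  have lim0: "(\<lambda>n. integral R (\<lambda>z. P n z + Q n z)) \<longlonglongrightarrow> 0"
  proof -
    \<comment> \<open>Resetting the integrand to 0 on the null set \<open>N\<close> makes it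
      converge at every point of \<open>R\<close> without changing any integral.\<close>
    define w where "w n z = (if z \<in> N then 0 else P n z + Q n z)" for n z
    have sp: "(\<lambda>z. P n z + Q n z) integrable_on R" for n
      unfolding R_def by (intro integrable_continuous continuous_intros) (use cP cQ in \<open>auto simp: R_def\<close>)
    have wi: "w n integrable_on R" for n
      by (rule integrable_spike[OF sp N]) (auto simp: w_def)
    have weq: "integral R (w n) = integral R (\<lambda>z. P n z + Q n z)" for n
      by (rule integral_spike[OF N]) (auto simp: w_def)
    have "(\<lambda>n. integral R (w n)) \<longlonglongrightarrow> integral R (\<lambda>_. 0)"
    proof (rule dominated_convergence(2)[where h = "\<lambda>_. 2 * L"])
      show "w n integrable_on R" for n by (rule wi)
      show "(\<lambda>_. 2 * L) integrable_on R" unfolding R_def by (rule integrable_const)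
      show "norm (w n z) \<le> 2 * L" if "z \<in> R" for n z
        using bP[OF that, of n] bQ[OF that, of n] L0 by (auto simp: w_def)
      show "(\<lambda>n. w n z) \<longlonglongrightarrow> 0" if "z \<in> R" for z
      proof (cases "z \<in> N")
        case False
        obtain x y where z: "z = (x, y)" by (cases z)
        show ?thesis
          using lim[of x y] that False by (simp add: w_def P_def Q_def z R_def h_def)
      qed (simp add: w_def)
    qed
    then show ?thesis by (simp add: weq)
  qed
  have "(\<lambda>n. integral R (P n)) \<longlonglongrightarrow> I"
  proof (rule LIM_zero_cancel, rule Lim_null_comparison)
    show "\<forall>\<^sub>F n in sequentially. norm (integral R (P n) - I) \<le> 2 * L * h n * (y1 - y0)"
      using column(3) by simp
    show "(\<lambda>n. 2 * L * h n * (y1 - y0)) \<longlonglongrightarrow> 0"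
      using h0 by (auto intro!: tendsto_eq_intros)
  qed
  moreover have "(\<lambda>n. integral R (Q n)) \<longlonglongrightarrow> J"
  proof (rule LIM_zero_cancel, rule Lim_null_comparison)
    show "\<forall>\<^sub>F n in sequentially. norm (integral R (Q n) - J) \<le> 2 * L * h n * (x1 - x0)"
      using row(3) by (simp add: intQ)
    show "(\<lambda>n. 2 * L * h n * (x1 - x0)) \<longlonglongrightarrow> 0"
      using h0 by (auto intro!: tendsto_eq_intros)
  qed
  ultimately have "(\<lambda>n. integral R (P n) + integral R (Q n)) \<longlonglongrightarrow> I + J"
    by (rule tendsto_add)
  moreover have "integral R (P n) + integral R (Q n) = integral R (\<lambda>z. P n z + Q n z)" for n
    unfolding R_def by (rule integral_add[symmetric]; intro integrable_continuous)
      (use cP cQ in \<open>auto simp: R_def\<close>)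
  ultimately show ?thesis
    using lim0 LIMSEQ_unique unfolding I_def J_def by auto
qed

section \<open>The plane as the complex numbers and the complex gradient\<close>

definition cv :: "complex \<Rightarrow> real^2" where "cv z = vector [Re z, Im z]"

lemma cv_nth [simp]: "cv z $ 1 = Re z" "cv z $ 2 = Im z"
  by (simp_all add: cv_def)

lemma cv_eq_iff: "x = cv z \<longleftrightarrow> x $ 1 = Re z \<and> x $ 2 = Im z"
  by (auto simp: vec_eq_iff forall_2)

lemma bounded_linear_cv: "bounded_linear cv"
  by (rule linear_conv_bounded_linear[THEN iffD1], rule linearI) (auto simp: vec_eq_iff forall_2)

lemma norm_real2: "norm (x :: real^2) = sqrt ((x $ 1)\<^sup>2 + (x $ 2)\<^sup>2)"
  by (simp add: norm_vec_def L2_set_def sum_2)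

lemma inner_real2: "(x :: real^2) \<bullet> y = x $ 1 * y $ 1 + x $ 2 * y $ 2"
  by (simp add: inner_vec_def sum_2)

lemma continuous_on_cv [continuous_intros]:
  "continuous_on S f \<Longrightarrow> continuous_on S (\<lambda>x. cv (f x))"
  by (rule bounded_linear.continuous_on[OF bounded_linear_cv])

lemma trace_real2: "(\<Sum>b\<in>Basis. (H :: real^2 \<Rightarrow> real^2) b \<bullet> b) = H (axis 1 1) $ 1 + H (axis 2 1) $ 2"
proof -
  have B: "(Basis :: (real^2) set) = {axis 1 1, axis 2 1}"
    by (auto simp: Basis_vec_def UNIV_2)
  have "axis 1 1 \<noteq> (axis 2 1 :: real^2)"
    by (simp add: axis_eq_axis)
  then show ?thesis
    unfolding B by (subst sum.insert) (auto simp: inner_axis)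
qed

text \<open>The conjugate of the gradient; where \<open>u\<close> is the real part of a holomorphic
  function, this is the derivative of that function.\<close>

definition cgrad :: "(real^2 \<Rightarrow> real^2) \<Rightarrow> complex \<Rightarrow> complex" where
  "cgrad g z = Complex (g (cv z) $ 1) (- g (cv z) $ 2)"

lemma GDERIV_unique:
  assumes "GDERIV u x :> g" "GDERIV u x :> g'"
  shows "g = g'"
proof -
  have "(\<lambda>h. h \<bullet> g) = (\<lambda>h. h \<bullet> g')"
    using assms unfolding gderiv_def by (rule has_derivative_unique)
  then show ?thesis
    by (metis inner_commute vector_eq_rdot)
qed

lemma GDERIV_continuous_on:
  assumes "\<And>x. GDERIV u x :> g x"
  shows "continuous_on UNIV u"
  using assms by (auto simp: continuous_on_eq_continuous_at gderiv_def intro: has_derivative_continuous)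

lemma GDERIV_has_derivative_cv:
  assumes "GDERIV u (cv z) :> g"
  shows "((\<lambda>z. u (cv z)) has_derivative (\<lambda>h. cv h \<bullet> g)) (at z)"
  using assms unfolding gderiv_def
  by (rule has_derivative_compose[OF bounded_linear_imp_has_derivative[OF bounded_linear_cv]])

lemma lipschitz_on_compacts_continuous_on:
  fixes g :: "'a::euclidean_space \<Rightarrow> 'b::metric_space"
  assumes "\<And>K. compact K \<Longrightarrow> \<exists>L. L-lipschitz_on K g"
  shows "continuous_on UNIV g"
proof -
  have "isCont g x" for x
  proof -
    obtain L where "L-lipschitz_on (cball x 1) g" using assms[of "cball x 1"] by auto
    then have "continuous_on (cball x 1) g" by (rule lipschitz_on_continuous_on)
    then show ?thesis by (rule continuous_on_interior) simp
  qed
  then show ?thesis by (simp add: continuous_on_eq_continuous_at)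
qed

lemma continuous_on_compose_cv:
  assumes "continuous_on UNIV g"
  shows "continuous_on UNIV (\<lambda>z. g (cv z))"
  by (rule continuous_on_compose2[OF assms]) (auto intro: continuous_intros)

lemma continuous_on_cgrad:
  assumes "continuous_on UNIV g"
  shows "continuous_on UNIV (cgrad g)"
  unfolding cgrad_def[abs_def] Complex_eq using continuous_on_compose_cv[OF assms] by (intro continuous_intros)

text \<open>The vanishing flux makes the line integral \<open>V\<close> of \<open>- u\<^sub>y dx + u\<^sub>x dy\<close> path independent on
  rectangles, so \<open>u + \<i> V\<close> is holomorphic with derivative \<open>cgrad g\<close>.\<close>

lemma harmonic_gradient_holomorphic:
  fixes u :: "real^2 \<Rightarrow> real"
  assumes G: "\<And>x. GDERIV u x :> g x"
    and Lip: "\<And>K. compact K \<Longrightarrow> \<exists>L. L-lipschitz_on K g"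
    and "open W"
    and lap: "AE x in lebesgue. x \<in> W \<longrightarrow> has_laplacian u 0 x"
  shows "cgrad g holomorphic_on (cv -` W)"
proof -
  obtain N0 where N0: "negligible N0" "\<And>x. x \<in> W \<Longrightarrow> x \<notin> N0 \<Longrightarrow> has_laplacian u 0 x"
    using lap[unfolded eventually_ae_filter_negligible] by blast
  \<comment> \<open>The exceptional set is carried to pairs of reals, where the flux identity is
    stated; an isometry preserves null sets.\<close>
  define N where "N = (\<lambda>x :: real^2. (x $ 1, x $ 2)) ` N0"
  have negN: "negligible N"
    unfolding N_def
  proof (rule negligible_locally_Lipschitz_image[OF _ N0(1)])
    fix x :: "real^2"
    have "norm ((y $ 1, y $ 2) - (x $ 1, x $ 2)) \<le> 1 * norm (y - x)" for y
      by (simp add: norm_real2 norm_Pair)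
    then show "\<exists>T B. open T \<and> x \<in> T \<and>
        (\<forall>y\<in>N0 \<inter> T. norm ((y $ 1, y $ 2) - (x $ 1, x $ 2)) \<le> B * norm (y - x))"
      by (intro exI[of _ UNIV] exI[of _ 1]) auto
  qed simp
  define U where "U x y = u (cv (Complex x y))" for x y
  define Ux where "Ux x y = g (cv (Complex x y)) $ 1" for x y
  define Uy where "Uy x y = g (cv (Complex x y)) $ 2" for x y
  have dU: "((\<lambda>z. u (cv z)) has_derivative (\<lambda>h. Re h * Ux (Re z) (Im z) + Im h * Uy (Re z) (Im z))) (at z)" for z
  proof -
    have "((\<lambda>z. u (cv z)) has_derivative (\<lambda>h. cv h \<bullet> g (cv z))) (at z)"
      by (rule GDERIV_has_derivative_cv[OF G])
    then show ?thesis
      by (simp add: inner_real2 Ux_def Uy_def)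
  qed
  have dUx: "((\<lambda>x. U x y) has_real_derivative Ux x y) (at x)" for x y
  proof -
    have "((\<lambda>x. Complex x y) has_derivative (\<lambda>h. of_real h)) (at x)"
      unfolding Complex_eq by (auto intro!: derivative_eq_intros)
    from has_derivative_compose[OF this dU] show ?thesis
      by (simp add: U_def has_field_derivative_def mult_commute_abs)
  qed
  have dUy: "((\<lambda>y. U x y) has_real_derivative Uy x y) (at y)" for x y
  proof -
    have "((\<lambda>y. Complex x y) has_derivative (\<lambda>h. \<i> * of_real h)) (at y)"
      unfolding Complex_eq by (auto intro!: derivative_eq_intros)
    from has_derivative_compose[OF this dU] show ?thesis
      by (simp add: U_def has_field_derivative_def mult_commute_abs)
  qed
  have isom: "dist (cv (Complex x y)) (cv (Complex x' y')) = dist (x, y) (x', y')" for x y x' y'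
    by (simp add: dist_norm norm_real2 norm_Pair)
  have LipU: "\<exists>L. L-lipschitz_on (cbox (a, b) (c, d)) (\<lambda>(x, y). Ux x y) \<and>
      L-lipschitz_on (cbox (a, b) (c, d)) (\<lambda>(x, y). Uy x y)" for a b c d
  proof -
    have "continuous_on (cbox (a, b) (c, d)) (\<lambda>p. cv (Complex (fst p) (snd p)))"
      unfolding Complex_eq by (intro continuous_intros)
    then have "compact ((\<lambda>p. cv (Complex (fst p) (snd p))) ` cbox (a, b) (c, d))"
      by (rule compact_continuous_image) simp
    then obtain L where L: "L-lipschitz_on ((\<lambda>p. cv (Complex (fst p) (snd p))) ` cbox (a, b) (c, d)) g"
      using Lip by blast
    have *: "dist (g (cv (Complex x y))) (g (cv (Complex x' y'))) \<le> L * dist (x, y) (x', y')"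
      if "(x, y) \<in> cbox (a, b) (c, d)" "(x', y') \<in> cbox (a, b) (c, d)" for x y x' y'
      using lipschitz_onD[OF L, of "cv (Complex x y)" "cv (Complex x' y')"] that
      unfolding isom by (force intro!: imageI)
    show ?thesis
      by (intro exI[of _ L] conjI lipschitz_onI lipschitz_on_nonneg[OF L])
        (auto simp del: mem_Times_iff simp: Ux_def Uy_def split: prod.splits
          intro: order_trans[OF dist_vec_nth_le *])
  qed
  have contU: "continuous_on UNIV (\<lambda>(x, y). Ux x y)" "continuous_on UNIV (\<lambda>(x, y). Uy x y)"
  proof -
    have "continuous_on UNIV (\<lambda>p. g (cv (Complex (fst p) (snd p))))"
      unfolding Complex_eq
      by (rule continuous_on_compose2[OF lipschitz_on_compacts_continuous_on[OF Lip]]) (auto intro!: continuous_intros)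
    then show "continuous_on UNIV (\<lambda>(x, y). Ux x y)" "continuous_on UNIV (\<lambda>(x, y). Uy x y)"
      unfolding Ux_def Uy_def split_beta by (auto intro: continuous_intros)
  qed
  have contx: "continuous_on S (\<lambda>x. Ux x y)" "continuous_on S (\<lambda>x. Uy x y)"
    and conty: "continuous_on S (\<lambda>y. Ux x y)" "continuous_on S (\<lambda>y. Uy x y)" for S x y
  proof -
    have "continuous_on S (\<lambda>x. (\<lambda>(x, y). Ux x y) (x, y))" "continuous_on S (\<lambda>x. (\<lambda>(x, y). Uy x y) (x, y))"
      "continuous_on S (\<lambda>y. (\<lambda>(x, y). Ux x y) (x, y))" "continuous_on S (\<lambda>y. (\<lambda>(x, y). Uy x y) (x, y))"
      by (rule continuous_on_compose2[OF contU(1)] continuous_on_compose2[OF contU(2)],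
          intro continuous_intros, simp)+
    then show "continuous_on S (\<lambda>x. Ux x y)" "continuous_on S (\<lambda>x. Uy x y)"
      "continuous_on S (\<lambda>y. Ux x y)" "continuous_on S (\<lambda>y. Uy x y)"
      by simp_all
  qed
  have lim: "(\<lambda>n. (Ux (x + inverse (Suc n)) y - Ux x y) / inverse (Suc n)
          + (Uy x (y + inverse (Suc n)) - Uy x y) / inverse (Suc n)) \<longlonglongrightarrow> 0"
    if inW: "cv (Complex x y) \<in> W" and notN: "(x, y) \<notin> N" for x y
  proof -
    define p where "p = cv (Complex x y)"
    have "p \<notin> N0"
      using notN by (auto simp: N_def p_def image_iff)
    then obtain g' H where ev: "\<forall>\<^sub>F y in nhds p. GDERIV u y :> g' y"
      and H': "(g' has_derivative H) (at p)" and tr: "(\<Sum>b\<in>Basis. H b \<bullet> b) = 0"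
      using N0(2)[of p] inW unfolding has_laplacian_def p_def by blast
    \<comment> \<open>The gradient field inside \<open>has_laplacian\<close> is specified only near
      \<open>p\<close>; uniqueness of gradients identifies it there with \<open>g\<close>, so
      \<open>g\<close> itself has derivative \<open>H\<close> at \<open>p\<close>.\<close>
    have ev': "\<forall>\<^sub>F y in nhds p. g' y = g y"
      using ev by eventually_elim (use G GDERIV_unique in blast)
    have H: "(g has_derivative H) (at p)"
      using H' by (rule has_derivative_transform_eventually)
        (use ev' eventually_nhds_x_imp_x[OF ev'] in \<open>auto simp: eventually_at_filter elim: eventually_mono\<close>)
    have seq: "filterlim (\<lambda>n. inverse (real (Suc n))) (at 0) sequentially"
      using LIMSEQ_inverse_real_of_nat by (simp add: filterlim_at del: of_nat_Suc)
    have dir: "(\<lambda>n. (g (p + inverse (real (Suc n)) *\<^sub>R e) $ i - g p $ i) / inverse (real (Suc n)))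
       \<longlonglongrightarrow> H e $ i" for e i
    proof -
      have "((\<lambda>t. p + t *\<^sub>R e) has_derivative (\<lambda>t. t *\<^sub>R e)) (at 0)"
        by (auto intro!: derivative_eq_intros)
      from has_derivative_compose[OF this] H
      have "((\<lambda>t. g (p + t *\<^sub>R e)) has_derivative (\<lambda>t. H (t *\<^sub>R e))) (at 0)"
        by simp
      then have "((\<lambda>t. g (p + t *\<^sub>R e) $ i) has_derivative (\<lambda>t. H (t *\<^sub>R e) $ i)) (at 0)"
        by (rule bounded_linear.has_derivative[OF bounded_linear_vec_nth])
      moreover have "H (t *\<^sub>R e) $ i = H e $ i * t" for t
        using has_derivative_bounded_linear[OF H]
        by (simp add: bounded_linear.linear linear_cmul)
      ultimately have "((\<lambda>t. g (p + t *\<^sub>R e) $ i) has_real_derivative H e $ i) (at 0)"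
        by (simp add: has_field_derivative_def)
      then have "((\<lambda>t. (g (p + t *\<^sub>R e) $ i - g p $ i) / t) \<longlongrightarrow> H e $ i) (at 0)"
        by (simp add: DERIV_def)
      from filterlim_compose[OF this seq] show ?thesis by simp
    qed
    have 1: "p + t *\<^sub>R axis 1 1 = cv (Complex (x + t) y)" "p + t *\<^sub>R axis 2 1 = cv (Complex x (y + t))" for t
      by (auto simp: p_def cv_eq_iff axis_def)
    show ?thesis
      using tendsto_add[OF dir[where e = "axis 1 1" and i = 1] dir[where e = "axis 2 1" and i = 2]] tr
      unfolding trace_real2 1 by (simp add: Ux_def Uy_def p_def)
  qed
  define f where "f = cgrad g"
  have "f field_differentiable at z0" if z0: "z0 \<in> cv -` W" for z0
  proof -
    obtain e where e: "e > 0" "\<And>x. dist x (cv z0) < e \<Longrightarrow> x \<in> W"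
      using \<open>open W\<close> z0 unfolding open_dist by auto
    define \<delta> where "\<delta> = e / 4"
    have \<delta>: "\<delta> > 0" using e by (simp add: \<delta>_def)
    define x0 where "x0 = Re z0 - \<delta>" define x1 where "x1 = Re z0 + \<delta>"
    define y0 where "y0 = Im z0 - \<delta>" define y1 where "y1 = Im z0 + \<delta>"
    have inO: "cv (Complex x y) \<in> W" if "x0 \<le> x" "x < x1" "y0 \<le> y" "y < y1" for x y
    proof (rule e(2))
      have "dist (cv (Complex x y)) (cv z0) = cmod (Complex x y - z0)"
        by (simp add: dist_norm norm_real2 cmod_def)
      also have "\<dots> \<le> \<bar>x - Re z0\<bar> + \<bar>y - Im z0\<bar>"
        using cmod_le[of "Complex x y - z0"] by simp
      also have "\<dots> \<le> 2 * \<delta>"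
        using that by (auto simp: x0_def x1_def y0_def y1_def)
      finally show "dist (cv (Complex x y)) (cv z0) < e"
        using e(1) by (simp add: \<delta>_def)
    qed
    define V where "V x y = integral {y0..y} (\<lambda>t. Ux x t) - integral {x0..x} (\<lambda>s. Uy s y0)" for x y
    \<comment> \<open>The vanishing flux allows \<open>V\<close> to be integrated along the other
      two sides of the rectangle. The defining formula shows the derivative in \<open>y\<close>,
      this one the derivative in \<open>x\<close>.\<close>
    have V2: "V x y = integral {y0..y} (\<lambda>t. Ux x0 t) - integral {x0..x} (\<lambda>s. Uy s y)"
      if xy: "x0 < x" "x < x1" "y0 < y" "y < y1" for x y
    proof -
      obtain L where L: "L-lipschitz_on (cbox (x0, y0) (x + 1, y + 1)) (\<lambda>(x, y). Ux x y)"
        "L-lipschitz_on (cbox (x0, y0) (x + 1, y + 1)) (\<lambda>(x, y). Uy x y)"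
        using LipU by blast
      have "integral {y0..y} (\<lambda>t. Ux x t - Ux x0 t) + integral {x0..x} (\<lambda>s. Uy s y - Uy s y0) = 0"
        by (rule rectangle_flux_zero[OF _ _ dUx dUy L negN lim])
          (use xy in \<open>auto intro!: inO\<close>)
      moreover have "integral {y0..y} (\<lambda>t. Ux x t - Ux x0 t) = integral {y0..y} (Ux x) - integral {y0..y} (Ux x0)"
        by (intro integral_diff integrable_continuous_interval conty)
      moreover have "integral {x0..x} (\<lambda>s. Uy s y - Uy s y0) = integral {x0..x} (\<lambda>s. Uy s y) - integral {x0..x} (\<lambda>s. Uy s y0)"
        by (intro integral_diff integrable_continuous_interval contx)
      ultimately show ?thesis
        by (simp add: V_def)
    qed
    define B where "B = {x0<..<x1} \<times> {y0<..<y1}"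
    have dV: "((\<lambda>(x, y). V x y) has_derivative (\<lambda>(h, k). - Uy x y * h + Ux x y * k)) (at (x, y))"
      if xy: "(x, y) \<in> B" for x y
    proof -
      \<comment> \<open>The theorem on partial derivatives asks for this one as a continuous family
        of bounded linear maps.\<close>
      define fy :: "real \<Rightarrow> real \<Rightarrow> real \<Rightarrow>\<^sub>L real" where "fy x y = Ux x y *\<^sub>R id_blinfun" for x y
      have "((\<lambda>(x, y). V x y) has_derivative (\<lambda>(h, k). (\<lambda>h. - Uy x y * h) h + fy x y k)) (at (x, y) within B)"
        unfolding B_def
      proof (rule has_derivative_partialsI)
        have "((\<lambda>x. integral {x0..x} (\<lambda>s. Uy s y)) has_real_derivative Uy x y) (at x within {x0..x1})"
          using xy by (intro integral_has_real_derivative contx) (auto simp: B_def)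
        then have "((\<lambda>x. integral {y0..y} (\<lambda>t. Ux x0 t) - integral {x0..x} (\<lambda>s. Uy s y))
            has_real_derivative - Uy x y) (at x within {x0<..<x1})"
          by (auto intro!: derivative_eq_intros elim: DERIV_subset)
        then have "((\<lambda>x. V x y) has_real_derivative - Uy x y) (at x within {x0<..<x1})"
          unfolding has_field_derivative_def
            by (rule has_derivative_transform[rotated 2]) (use xy in \<open>auto simp: B_def V2\<close>)
        then show "((\<lambda>x. V x y) has_derivative (\<lambda>h. - Uy x y * h)) (at x within {x0<..<x1})"
          unfolding has_field_derivative_def .
      next
        fix x y assume "x \<in> {x0<..<x1}" "y \<in> {y0<..<y1}"
        then have "((\<lambda>y. integral {y0..y} (\<lambda>t. Ux x t)) has_real_derivative Ux x y) (at y within {y0..y1})"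
          by (intro integral_has_real_derivative conty) auto
        then have "((\<lambda>y. V x y) has_real_derivative Ux x y) (at y within {y0<..<y1})"
          unfolding V_def by (auto intro!: derivative_eq_intros elim: DERIV_subset)
        then show "((\<lambda>y. V x y) has_derivative blinfun_apply (fy x y)) (at y within {y0<..<y1})"
          by (simp add: has_field_derivative_def fy_def scaleR_blinfun.rep_eq)
      next
        have "continuous_on UNIV (\<lambda>p. (\<lambda>(x, y). Ux x y) p *\<^sub>R (id_blinfun :: real \<Rightarrow>\<^sub>L real))"
          by (rule continuous_on_scaleR[OF contU(1) continuous_on_const])
        then have "continuous (at (x, y)) (\<lambda>(x, y). fy x y)"
          unfolding fy_def case_prod_unfold by (simp add: continuous_on_eq_continuous_at)
        then show "continuous (at (x, y) within {x0<..<x1} \<times> {y0<..<y1}) (\<lambda>(x, y). fy x y)"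
          by (rule continuous_at_imp_continuous_at_within)
      qed (use xy in \<open>auto simp: B_def\<close>)
      moreover have "at (x, y) within B = at (x, y)"
        using xy by (intro at_within_open) (auto simp: B_def open_Times)
      ultimately show ?thesis
        by (simp add: fy_def scaleR_blinfun.rep_eq)
    qed
    define F where "F z = of_real (u (cv z)) + \<i> * of_real (V (Re z) (Im z))" for z
    define B' where "B' = {z. x0 < Re z} \<inter> {z. Re z < x1} \<inter> {z. y0 < Im z} \<inter> {z. Im z < y1}"
    have oB': "open B'"
      unfolding B'_def by (intro open_Int open_halfspace_Re_gt open_halfspace_Re_lt
          open_halfspace_Im_gt open_halfspace_Im_lt)
    have dF: "(F has_field_derivative f z) (at z)" if z: "z \<in> B'" for z
    proof -
      have zB: "(Re z, Im z) \<in> B" using z by (auto simp: B'_def B_def)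
      have "((\<lambda>z. (Re z, Im z)) has_derivative (\<lambda>h. (Re h, Im h))) (at z)"
        by (auto intro!: derivative_eq_intros)
      from has_derivative_compose[OF this dV[OF zB]]
      have *: "((\<lambda>z. V (Re z) (Im z)) has_derivative
          (\<lambda>h. - Uy (Re z) (Im z) * Re h + Ux (Re z) (Im z) * Im h)) (at z)"
        by simp
      have "(F has_derivative (\<lambda>h. of_real (Re h * Ux (Re z) (Im z) + Im h * Uy (Re z) (Im z))
         + \<i> * of_real (- Uy (Re z) (Im z) * Re h + Ux (Re z) (Im z) * Im h))) (at z)"
        unfolding F_def by (intro derivative_intros * dU)
      moreover have "of_real (Re h * Ux (Re z) (Im z) + Im h * Uy (Re z) (Im z))
         + \<i> * of_real (- Uy (Re z) (Im z) * Re h + Ux (Re z) (Im z) * Im h) = f z * h" for h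
        by (auto simp: f_def cgrad_def complex_eq_iff Ux_def Uy_def algebra_simps)
      ultimately show ?thesis
        by (simp add: has_field_derivative_def)
    qed
    have "F holomorphic_on B'"
      using dF oB' by (auto simp: holomorphic_on_open)
    \<comment> \<open>The derivative of a holomorphic function is holomorphic, so the merely
      Lipschitz \<open>f\<close> gains its regularity from its primitive.\<close>
    then have "deriv F holomorphic_on B'"
      using oB' by (rule holomorphic_deriv)
    then have "f holomorphic_on B'"
      by (rule holomorphic_transform) (use dF in \<open>auto intro: DERIV_imp_deriv\<close>)
    then show ?thesis
      by (rule holomorphic_on_imp_differentiable_at[OF _ oB'])
        (use \<delta> in \<open>auto simp: B'_def x0_def x1_def y0_def y1_def\<close>)
  qed
  then show ?thesis
    unfolding f_def[symmetric] holomorphic_on_def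
    by (auto intro: field_differentiable_at_within)
qed

section \<open>Coincidence sets on the unit circle\<close>

text \<open>The triangle relation \<open>m1 exp (2ia) + m2 exp (2ib) = - d\<close>, that is,
  \<open>m1 (sin (t - a))^2 + m2 (sin (t - b))^2 = (m1 + m2 + d cos (2t)) / 2\<close> for all \<open>t\<close>.\<close>

definition matching :: "real \<Rightarrow> real \<Rightarrow> real \<Rightarrow> real \<Rightarrow> real \<Rightarrow> bool" where
  "matching m1 m2 d a b \<longleftrightarrow> m1 * cos (2 * a) + m2 * cos (2 * b) = - d \<and> m1 * sin (2 * a) + m2 * sin (2 * b) = 0"

lemma sin_zero_open_interval: "sin x = 0 \<Longrightarrow> - pi < x \<Longrightarrow> x < pi \<Longrightarrow> x = (0::real)"
  by (metis sin_eq_0_pi)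

text \<open>Subtracting the two relations yields
  \<open>m1 sin (a' - a) exp (i (a + a')) = - m2 sin (b' - b) exp (i (b + b'))\<close>.\<close>

lemma match_pair_cases:
  assumes m: "m1 > 0" "m2 > 0" and ma: "matching m1 m2 d a b" "matching m1 m2 d a' b'"
    and le: "a < b" "b \<le> b'" "b' < a'" "b - a < pi" "a' - b' < pi" "a' - a \<le> 2 * pi"
  obtains (half1) "a' = a + pi" "b' = b"
    | (cone) "pi < a' - a" "a' - a < 2 * pi" "a + a' = b + b'" "b < b'" "b' - b < pi"
    | (half2) "a' = a + 2 * pi" "b' = b + pi"
proof -
  define X where "X = m1 * sin (a' - a)"
  define Y where "Y = m2 * sin (b' - b)"
  define p where "p = a + a'"
  define q where "q = b + b'"
  have e1: "m1 * (cos (2 * a) - cos (2 * a')) = - (m2 * (cos (2 * b) - cos (2 * b')))"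
    "m1 * (sin (2 * a') - sin (2 * a)) = - (m2 * (sin (2 * b') - sin (2 * b)))"
    using ma by (simp_all add: matching_def algebra_simps)
  have e2: "cos (2 * x) - cos (2 * y) = 2 * (sin (x + y) * sin (y - x))"
    "sin (2 * y) - sin (2 * x) = 2 * (cos (x + y) * sin (y - x))" for x y :: real
  proof -
    have e: "(x + y) - (y - x) = 2 * x" "(x + y) + (y - x) = 2 * y"
      by auto
    have "cos (s - t) - cos (s + t) = 2 * (sin s * sin t)" "sin (s + t) - sin (s - t) = 2 * (cos s * sin t)"
      for s t :: real
      by (simp_all add: cos_add cos_diff sin_add sin_diff)
    from this[of "x + y" "y - x", unfolded e]
    show "cos (2 * x) - cos (2 * y) = 2 * (sin (x + y) * sin (y - x))"
      "sin (2 * y) - sin (2 * x) = 2 * (cos (x + y) * sin (y - x))" .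
  qed
  have XY: "X * sin p = - Y * sin q" "X * cos p = - Y * cos q"
    using e1[unfolded e2] by (simp_all add: X_def Y_def p_def q_def algebra_simps)
  have "X * sin (q - p) = sin q * (X * cos p) - cos q * (X * sin p)"
    by (simp add: sin_diff algebra_simps)
  then have 1: "X * sin (q - p) = 0"
    unfolding XY by simp
  \<comment> \<open>\<open>q - p\<close> is the difference of the arc lengths \<open>b - a\<close>
    and \<open>a' - b'\<close>, both strictly between 0 and \<open>pi\<close>, so a vanishing sine
    forces it to be 0.\<close>
  have pq: "p = q" if "X \<noteq> 0"
  proof -
    have "q - p = 0"
      by (rule sin_zero_open_interval) (use 1 that le in \<open>auto simp: p_def q_def\<close>)
    then show ?thesis by simp
  qed
  have XmY: "X = - Y" if "X \<noteq> 0"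
  proof -
    have "(X + Y) * sin p = 0" "(X + Y) * cos p = 0"
      using XY pq[OF that] by (simp_all add: algebra_simps)
    then show ?thesis
      using sin_cos_squared_add[of p] by (cases "sin p = 0") (auto simp: add_eq_0_iff2)
  qed
  have Y0: "Y = 0" if "X = 0"
    using XY that sin_cos_squared_add[of q] by (cases "sin q = 0") auto
  have sgY: "sin (b' - b) = Y / m2"
    using m by (auto simp: X_def Y_def)
  \<comment> \<open>The sign of \<open>X\<close> is read off from the length \<open>a' - a\<close>.
    A length below \<open>pi\<close> would give \<open>X > 0\<close> and \<open>Y \<ge> 0\<close>,
    against \<open>X = - Y\<close>; at \<open>pi\<close> and \<open>2 * pi\<close> both vanish, and
    in between \<open>Y > 0\<close>.\<close>
  consider "a' - a < pi" | "a' - a = pi" | "pi < a' - a" "a' - a < 2 * pi" | "a' - a = 2 * pi"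
    using le by linarith
  then show thesis
  proof cases
    case 1
    then have "sin (a' - a) > 0" using le by (intro sin_gt_zero) auto
    then have X: "X > 0" using m by (simp add: X_def)
    have "sin (b' - b) \<ge> 0" using le 1 by (intro sin_ge_zero) auto
    then have "Y \<ge> 0" using m by (simp add: Y_def)
    with X XmY show thesis by simp
  next
    case 2
    then have "X = 0" by (simp add: X_def)
    then have "sin (b' - b) = 0" using Y0 sgY by simp
    then have "b' - b = 0"
      by (rule sin_zero_open_interval) (use le 2 pi_gt_zero in linarith)+
    with 2 show thesis by (intro half1) auto
  next
    case 3
    have "sin (a' - a) < 0" using 3 by (intro sin_lt_zero) auto
    then have X: "X < 0" using m by (simp add: X_def mult_pos_neg)
    then have Y: "Y > 0" using XmY by simp
    then have s: "sin (b' - b) > 0" using m sgY by simp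
    then have "b \<noteq> b'" by auto
    moreover have "b' - b < pi"
    proof (rule ccontr)
      assume "\<not> b' - b < pi"
      then have "sin (b' - b - pi) \<ge> 0" using le 3 by (intro sin_ge_zero) auto
      then show False using s by (simp add: sin_diff)
    qed
    ultimately show thesis
      using 3 X pq le by (intro cone) (auto simp: p_def q_def)
  next
    case 4
    then have "X = 0" by (simp add: X_def)
    then have "sin (b' - b) = 0" using Y0 sgY by simp
    then have "sin (b' - b - pi) = 0" by (simp add: sin_diff)
    then have "b' - b - pi = 0"
      by (rule sin_zero_open_interval) (use le 4 in linarith)+
    with 4 show thesis by (intro half2) auto
  qed
qed

section \<open>Extremal zeros and periodicity\<close>

lemma last_zero:
  fixes D :: "real \<Rightarrow> real"
  assumes D: "continuous_on UNIV D" and x: "D x = 0" "x \<le> y"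
  obtains a where "x \<le> a" "a \<le> y" "D a = 0" "\<And>t. a < t \<Longrightarrow> t \<le> y \<Longrightarrow> D t \<noteq> 0"
proof -
  define S where "S = {x..y} \<inter> {t. D t = 0}"
  have "compact S"
    unfolding S_def by (intro compact_Int_closed compact_Icc closed_Collect_eq D continuous_on_const)
  moreover have "x \<in> S" using x by (simp add: S_def)
  ultimately obtain a where a: "a \<in> S" "\<And>t. t \<in> S \<Longrightarrow> t \<le> a"
    using compact_attains_sup[of S] by blast
  show thesis
  proof (rule that[of a])
    fix t assume t: "a < t" "t \<le> y"
    show "D t \<noteq> 0"
    proof
      assume "D t = 0"
      then have "t \<in> S" using a(1) t by (simp add: S_def)
      then show False using a(2) t by force
    qed
  qed (use a(1) in \<open>auto simp: S_def\<close>)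
qed

lemma first_zero:
  fixes D :: "real \<Rightarrow> real"
  assumes D: "continuous_on UNIV D" and x: "D y = 0" "x \<le> y"
  obtains a where "x \<le> a" "a \<le> y" "D a = 0" "\<And>t. x \<le> t \<Longrightarrow> t < a \<Longrightarrow> D t \<noteq> 0"
proof -
  have "continuous_on UNIV (\<lambda>t. D (- t))"
    by (rule continuous_on_compose2[OF D]) (auto intro: continuous_intros)
  from last_zero[OF this, of "- y" "- x"] x
  obtain a where a: "- y \<le> a" "a \<le> - x" "D (- a) = 0" "\<And>t. a < t \<Longrightarrow> t \<le> - x \<Longrightarrow> D (- t) \<noteq> 0"
    by auto
  show thesis
  proof (rule that[of "- a"])
    fix t assume "x \<le> t" "t < - a"
    then show "D t \<noteq> 0" using a(4)[of "- t"] by simp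
  qed (use a in auto)
qed

abbreviation turns :: "int \<Rightarrow> real" where "turns k \<equiv> 2 * pi * of_int k"

lemma periodic_int:
  fixes D :: "real \<Rightarrow> real"
  assumes "\<And>t. D (t + 2 * pi) = D t"
  shows "D (t + turns k) = D t"
proof (induction k rule: int_induct[where k = 0])
  case (step1 i)
  then show ?case using assms[of "t + turns i"] by (simp add: algebra_simps)
next
  case (step2 i)
  then show ?case using assms[of "t + turns (i - 1)"] by (simp add: algebra_simps)
qed simp

lemma reduce_angle: "\<exists>k :: int. x \<le> t + turns k \<and> t + turns k < x + 2 * pi"
proof -
  define k where "k = \<lceil>(x - t) / (2 * pi)\<rceil>"
  have "(x - t) / (2 * pi) \<le> of_int k" "of_int k < (x - t) / (2 * pi) + 1"
    unfolding k_def by linarith+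
  then have "x - t \<le> turns k" "turns k < x - t + 2 * pi"
    by (simp_all add: field_simps)
  then show ?thesis by (intro exI[of _ k]) auto
qed

lemma sin_shift_pi_sq: "(sin (x + pi))\<^sup>2 = (sin x)\<^sup>2" "(sin (x - pi))\<^sup>2 = (sin (x::real))\<^sup>2"
  by (simp_all add: sin_diff)

text \<open>\<open>D1\<close> and \<open>D2\<close> are \<open>u - p1\<close> and \<open>p2 - u\<close> as functions of the angle on the unit circle.\<close>

locale circle =
  fixes D1 D2 :: "real \<Rightarrow> real" and m1 m2 d :: real
  assumes m1: "m1 > 0" and m2: "m2 > 0" and d: "\<bar>d\<bar> < m1 + m2"
    and cont1: "continuous_on UNIV D1" and cont2: "continuous_on UNIV D2"
    and per1: "D1 (t + 2 * pi) = D1 t" and per2: "D2 (t + 2 * pi) = D2 t"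
    and nonneg1: "D1 t \<ge> 0" and nonneg2: "D2 t \<ge> 0"
    and gap: "D1 t + D2 t = (m1 + m2 + d * cos (2 * t)) / 2"
    and arcL1: "\<lbrakk>\<alpha> < t; t < \<beta>; \<beta> \<le> \<alpha> + 2 * pi; \<forall>s\<in>{\<alpha><..<\<beta>}. D1 s > 0 \<and> D2 s > 0; D1 \<alpha> = 0\<rbrakk>
        \<Longrightarrow> D1 t = m1 * (sin (t - \<alpha>))\<^sup>2"
    and arcR1: "\<lbrakk>\<alpha> < t; t < \<beta>; \<beta> \<le> \<alpha> + 2 * pi; \<forall>s\<in>{\<alpha><..<\<beta>}. D1 s > 0 \<and> D2 s > 0; D1 \<beta> = 0\<rbrakk>
        \<Longrightarrow> D1 t = m1 * (sin (t - \<beta>))\<^sup>2"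
    and arcL2: "\<lbrakk>\<alpha> < t; t < \<beta>; \<beta> \<le> \<alpha> + 2 * pi; \<forall>s\<in>{\<alpha><..<\<beta>}. D1 s > 0 \<and> D2 s > 0; D2 \<alpha> = 0\<rbrakk>
        \<Longrightarrow> D2 t = m2 * (sin (t - \<alpha>))\<^sup>2"
    and arcR2: "\<lbrakk>\<alpha> < t; t < \<beta>; \<beta> \<le> \<alpha> + 2 * pi; \<forall>s\<in>{\<alpha><..<\<beta>}. D1 s > 0 \<and> D2 s > 0; D2 \<beta> = 0\<rbrakk>
        \<Longrightarrow> D2 t = m2 * (sin (t - \<beta>))\<^sup>2"
begin

text \<open>Replacing \<open>u\<close> by \<open>- u\<close> exchanges the roles of the obstacles
  and leaves \<open>d\<close> unchanged, so every statement about \<open>D1\<close> has a twin about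
  \<open>D2\<close>.\<close>

lemma swapped: "circle D2 D1 m2 m1 d"
proof (unfold_locales, goal_cases)
  case (11 \<alpha> t \<beta>)
  show ?case by (rule arcL2[OF 11(1-3) _ 11(5)]) (use 11(4) in blast)
next
  case (12 \<alpha> t \<beta>)
  show ?case by (rule arcR2[OF 12(1-3) _ 12(5)]) (use 12(4) in blast)
next
  case (13 \<alpha> t \<beta>)
  show ?case by (rule arcL1[OF 13(1-3) _ 13(5)]) (use 13(4) in blast)
next
  case (14 \<alpha> t \<beta>)
  show ?case by (rule arcR1[OF 14(1-3) _ 14(5)]) (use 14(4) in blast)
next
  case (10 t)
  show ?case using gap[of t] by (simp add: add.commute)
qed (use m1 m2 d cont1 cont2 in \<open>simp_all add: per1 per2 nonneg1 nonneg2\<close>)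

section \<open>Free arcs between contact points\<close>

lemma gap_pos: "D1 t + D2 t > 0"
proof -
  have "\<bar>d * cos (2 * t)\<bar> \<le> \<bar>d\<bar> * 1"
    unfolding abs_mult by (intro mult_left_mono) auto
  then show ?thesis unfolding gap using d by auto
qed

lemma pos1: "D1 t \<noteq> 0 \<Longrightarrow> D1 t > 0" and pos2: "D2 t \<noteq> 0 \<Longrightarrow> D2 t > 0"
  using nonneg1[of t] nonneg2[of t] by auto

lemma arc_closed:
  assumes "\<alpha> < \<beta>" "\<beta> \<le> \<alpha> + 2 * pi" "\<forall>s\<in>{\<alpha><..<\<beta>}. D1 s > 0 \<and> D2 s > 0" "t \<in> {\<alpha>..\<beta>}"
  shows "D1 \<alpha> = 0 \<Longrightarrow> D1 t = m1 * (sin (t - \<alpha>))\<^sup>2" "D1 \<beta> = 0 \<Longrightarrow> D1 t = m1 * (sin (t - \<beta>))\<^sup>2"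
    "D2 \<alpha> = 0 \<Longrightarrow> D2 t = m2 * (sin (t - \<alpha>))\<^sup>2" "D2 \<beta> = 0 \<Longrightarrow> D2 t = m2 * (sin (t - \<beta>))\<^sup>2"
proof -
  have ext: "f t = g t" if "\<And>t. \<alpha> < t \<Longrightarrow> t < \<beta> \<Longrightarrow> f t = g t" "continuous_on UNIV f" "continuous_on UNIV g"
    for f g :: "real \<Rightarrow> real"
  proof -
    have 1: "continuous_on (closure {\<alpha><..<\<beta>}) (\<lambda>t. f t - g t)"
      by (intro continuous_on_diff continuous_on_subset[OF that(2)] continuous_on_subset[OF that(3)] subset_UNIV)
    have 2: "t \<in> closure {\<alpha><..<\<beta>}" using assms(1,4) by simp
    have "f t - g t = 0"
      by (rule continuous_constant_on_closure[OF 1 _ 2]) (simp add: that(1))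
    then show ?thesis by simp
  qed
  have c: "continuous_on UNIV (\<lambda>t. m * (sin (t - \<gamma>))\<^sup>2)" for m \<gamma> :: real
    by (intro continuous_intros)
  show "D1 \<alpha> = 0 \<Longrightarrow> D1 t = m1 * (sin (t - \<alpha>))\<^sup>2"
    by (rule ext[OF _ cont1 c], rule arcL1[OF _ _ assms(2,3)])
  show "D1 \<beta> = 0 \<Longrightarrow> D1 t = m1 * (sin (t - \<beta>))\<^sup>2"
    by (rule ext[OF _ cont1 c], rule arcR1[OF _ _ assms(2,3)])
  show "D2 \<alpha> = 0 \<Longrightarrow> D2 t = m2 * (sin (t - \<alpha>))\<^sup>2"
    by (rule ext[OF _ cont2 c], rule arcL2[OF _ _ assms(2,3)])
  show "D2 \<beta> = 0 \<Longrightarrow> D2 t = m2 * (sin (t - \<beta>))\<^sup>2"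
    by (rule ext[OF _ cont2 c], rule arcR2[OF _ _ assms(2,3)])
qed

text \<open>Inserting both formulas into \<open>gap\<close> leaves a linear combination of
  \<open>cos (2 * t)\<close> and \<open>sin (2 * t)\<close> that vanishes on an interval, so its
  coefficients \<open>C\<close> and \<open>S\<close> are 0.\<close>

lemma arc_match_aux:
  assumes lt: "a < b" "b \<le> a + 2 * pi" and D1: "\<And>t. t \<in> {a..b} \<Longrightarrow> D1 t = m1 * (sin (t - p))\<^sup>2"
    and D2: "\<And>t. t \<in> {a..b} \<Longrightarrow> D2 t = m2 * (sin (t - q))\<^sup>2"
  shows "matching m1 m2 d p q"
proof -
  define C where "C = m1 * cos (2 * p) + m2 * cos (2 * q) + d"
  define S where "S = m1 * sin (2 * p) + m2 * sin (2 * q)"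
  have CS: "C * cos (2 * t) + S * sin (2 * t) = 0" if "t \<in> {a..b}" for t
  proof -
    have e: "2 * (sin (t - x))\<^sup>2 = 1 - (cos (2 * t) * cos (2 * x) + sin (2 * t) * sin (2 * x))" for x
      using cos_double_sin[of "t - x"] by (simp add: cos_diff algebra_simps)
    have f: "m1 * (2 * (sin (t - p))\<^sup>2) + m2 * (2 * (sin (t - q))\<^sup>2) = m1 + m2 + d * cos (2 * t)"
      using gap[of t] D1[OF that] D2[OF that] by (simp add: field_simps)
    show ?thesis
      using f[unfolded e] by (simp add: C_def S_def algebra_simps)
  qed
  \<comment> \<open>Two evaluation points suffice; their distance is positive and at most 1, hence
    below \<open>pi / 2\<close>, so the determinant \<open>sin (2 * (s - a))\<close> is
    nonzero.\<close>
  define s where "s = min b (a + 1)"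
  have s: "a < s" "s \<le> b" "s \<le> a + 1" using lt by (auto simp: s_def)
  have "2 * (s - a) \<le> 2" "2 < pi" using s pi_gt3 by auto
  then have "2 * (s - a) < pi" by (rule le_less_trans)
  then have ne: "sin (2 * (s - a)) \<noteq> 0" using s sin_gt_zero[of "2 * (s - a)"] by auto
  have *: "C * cos (2 * a) + S * sin (2 * a) = 0" "C * cos (2 * s) + S * sin (2 * s) = 0"
    using CS[of a] CS[of s] s lt by auto
  have "C * sin (2 * (s - a)) = sin (2 * s) * (C * cos (2 * a) + S * sin (2 * a)) - sin (2 * a) * (C * cos (2 * s) + S * sin (2 * s))"
    by (simp add: sin_diff algebra_simps)
  moreover have "S * sin (2 * (s - a)) = cos (2 * a) * (C * cos (2 * s) + S * sin (2 * s)) - cos (2 * s) * (C * cos (2 * a) + S * sin (2 * a))"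
    by (simp add: sin_diff algebra_simps)
  ultimately have "C = 0" "S = 0" using ne unfolding * by auto
  then show ?thesis by (simp add: matching_def C_def S_def)
qed

text \<open>If the arc had length \<open>pi\<close> or more, \<open>m1 * (sin (t - a))^2\<close>
  would vanish at \<open>a + pi\<close>: either inside the arc, or at \<open>b\<close>, where
  \<open>D2\<close> is 0 as well although the obstacles differ there.\<close>

lemma arc12:
  assumes lt: "a < b" "b \<le> a + 2 * pi" and pos: "\<forall>s\<in>{a<..<b}. D1 s > 0 \<and> D2 s > 0"
    and z: "D1 a = 0" "D2 b = 0"
  shows "b - a < pi" "matching m1 m2 d a b"
    "\<And>t. t \<in> {a..b} \<Longrightarrow> D1 t = m1 * (sin (t - a))\<^sup>2" "\<And>t. t \<in> {a..b} \<Longrightarrow> D2 t = m2 * (sin (t - b))\<^sup>2"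
proof -
  show D1: "\<And>t. t \<in> {a..b} \<Longrightarrow> D1 t = m1 * (sin (t - a))\<^sup>2"
    by (rule arc_closed(1)[OF lt pos]) (use z in auto)
  show D2: "\<And>t. t \<in> {a..b} \<Longrightarrow> D2 t = m2 * (sin (t - b))\<^sup>2"
    by (rule arc_closed(4)[OF lt pos]) (use z in auto)
  show "matching m1 m2 d a b" by (rule arc_match_aux[OF lt D1 D2])
  show "b - a < pi"
  proof (rule ccontr)
    assume "\<not> ?thesis"
    then have "D1 (a + pi) = 0" "a + pi \<in> {a<..b}"
      using D1[of "a + pi"] by auto
    then show False using pos[rule_format, of "a + pi"] gap_pos[of b] z by (cases "a + pi = b") auto
  qed
qed

lemma arc21:
  assumes lt: "b < a" "a \<le> b + 2 * pi" and pos: "\<forall>s\<in>{b<..<a}. D1 s > 0 \<and> D2 s > 0"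
    and z: "D1 a = 0" "D2 b = 0"
  shows "a - b < pi" "matching m1 m2 d a b"
    "\<And>t. t \<in> {b..a} \<Longrightarrow> D1 t = m1 * (sin (t - a))\<^sup>2" "\<And>t. t \<in> {b..a} \<Longrightarrow> D2 t = m2 * (sin (t - b))\<^sup>2"
proof -
  show D1: "\<And>t. t \<in> {b..a} \<Longrightarrow> D1 t = m1 * (sin (t - a))\<^sup>2"
    by (rule arc_closed(2)[OF lt pos]) (use z in auto)
  show D2: "\<And>t. t \<in> {b..a} \<Longrightarrow> D2 t = m2 * (sin (t - b))\<^sup>2"
    by (rule arc_closed(3)[OF lt pos]) (use z in auto)
  show "matching m1 m2 d a b" by (rule arc_match_aux[OF lt D1 D2])
  show "a - b < pi"
  proof (rule ccontr)
    assume "\<not> ?thesis"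
    then have "D2 (b + pi) = 0" "b + pi \<in> {b<..a}"
      using D2[of "b + pi"] by auto
    then show False using pos[rule_format, of "b + pi"] gap_pos[of a] z by (cases "b + pi = a") auto
  qed
qed

text \<open>The function \<open>m1 * (sin (t - a))^2\<close> first returns to zero at
  \<open>a + pi\<close>, so the arc can end neither later nor earlier.\<close>

lemma arc11:
  assumes lt: "a < b" "b \<le> a + 2 * pi" and pos: "\<forall>s\<in>{a<..<b}. D1 s > 0 \<and> D2 s > 0"
    and z: "D1 a = 0" "D1 b = 0"
  shows "b = a + pi" "\<And>t. t \<in> {a..b} \<Longrightarrow> D1 t = m1 * (sin (t - a))\<^sup>2"
proof -
  show D1: "\<And>t. t \<in> {a..b} \<Longrightarrow> D1 t = m1 * (sin (t - a))\<^sup>2"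
    by (rule arc_closed(1)[OF lt pos]) (use z in auto)
  have "b \<le> a + pi"
  proof (rule ccontr)
    assume "\<not> ?thesis"
    then have "D1 (a + pi) = 0" "a + pi \<in> {a<..<b}"
      using D1[of "a + pi"] by auto
    then show False using pos[rule_format, of "a + pi"] by auto
  qed
  moreover have "sin (b - a) = 0" using D1[of b] z lt m1 by auto
  ultimately show "b = a + pi"
    using sin_zero_open_interval[of "b - a"] lt pi_gt_zero by linarith
qed

text \<open>The last zero of \<open>D1\<close> is taken first, and then the first zero of
  \<open>D2\<close> after it. The resulting arc is free of contact however complicated the
  coincidence sets are.\<close>

lemma transition12:
  assumes xy: "D1 x = 0" "D2 y = 0" "x \<le> y" "y \<le> x + 2 * pi"
  obtains a b where "x \<le> a" "a < b" "b \<le> y" "D1 a = 0" "D2 b = 0" "\<forall>s\<in>{a<..<b}. D1 s > 0 \<and> D2 s > 0"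
    "\<And>t. a < t \<Longrightarrow> t \<le> y \<Longrightarrow> D1 t > 0"
proof -
  obtain a where a: "x \<le> a" "a \<le> y" "D1 a = 0" "\<And>t. a < t \<Longrightarrow> t \<le> y \<Longrightarrow> D1 t \<noteq> 0"
    using last_zero[OF cont1 xy(1,3)] by metis
  obtain b where b: "a \<le> b" "b \<le> y" "D2 b = 0" "\<And>t. a \<le> t \<Longrightarrow> t < b \<Longrightarrow> D2 t \<noteq> 0"
    using first_zero[OF cont2 xy(2) a(2)] by metis
  have "a \<noteq> b" using a b gap_pos[of a] by auto
  then show thesis using a b pos1 pos2 by (intro that[of a b]) auto
qed

lemma transition21:
  assumes xy: "D1 y = 0" "D2 x = 0" "x \<le> y" "y \<le> x + 2 * pi"
  obtains a b where "x \<le> b" "b < a" "a \<le> y" "D1 a = 0" "D2 b = 0" "\<forall>s\<in>{b<..<a}. D1 s > 0 \<and> D2 s > 0"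
    "\<And>t. x \<le> t \<Longrightarrow> t < a \<Longrightarrow> D1 t > 0"
proof -
  obtain a where a: "x \<le> a" "a \<le> y" "D1 a = 0" "\<And>t. x \<le> t \<Longrightarrow> t < a \<Longrightarrow> D1 t \<noteq> 0"
    using first_zero[OF cont1 xy(1,3)] by metis
  obtain b where b: "x \<le> b" "b \<le> a" "D2 b = 0" "\<And>t. b < t \<Longrightarrow> t \<le> a \<Longrightarrow> D2 t \<noteq> 0"
    using last_zero[OF cont2 xy(2) a(1)] by metis
  have "a \<noteq> b" using a b gap_pos[of a] by auto
  then show thesis using a b pos1 pos2 by (intro that[of b a]) auto
qed

text \<open>Seen from the contact point \<open>y\<close> with \<open>p2\<close>, \<open>a\<close>
  and \<open>a'\<close> are the nearest zeros of \<open>D1\<close> on either side, and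
  \<open>b\<close> and \<open>b'\<close> are the zeros of \<open>D2\<close> nearest to these. Both
  outer arcs carry a matching relation, and \<open>match_pair_cases\<close> compares them;
  \<open>D2\<close> is left open strictly between \<open>b\<close> and \<open>b'\<close>.\<close>

lemma excursion:
  assumes xz: "D1 x = 0" "D1 z = 0" "x \<le> z" "z \<le> x + 2 * pi" "y \<in> {x..z}" "D2 y = 0"
  obtains a b b' a' where "x \<le> a" "a < b" "b \<le> y" "y \<le> b'" "b' < a'" "a' \<le> z"
    "D1 a = 0" "D2 b = 0" "D2 b' = 0" "D1 a' = 0"
    "\<forall>s\<in>{a<..<b}. D1 s > 0 \<and> D2 s > 0" "\<forall>s\<in>{b'<..<a'}. D1 s > 0 \<and> D2 s > 0"
    "\<forall>s\<in>{a<..<a'}. D1 s > 0"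
    "(a' = a + pi \<and> b' = b) \<or> (pi < a' - a \<and> a' - a < 2 * pi \<and> a + a' = b + b' \<and> b < b' \<and> b' - b < pi)
      \<or> (a' = a + 2 * pi \<and> b' = b + pi)"
proof -
  obtain a b where ab: "x \<le> a" "a < b" "b \<le> y" "D1 a = 0" "D2 b = 0"
    "\<forall>s\<in>{a<..<b}. D1 s > 0 \<and> D2 s > 0" "\<And>t. a < t \<Longrightarrow> t \<le> y \<Longrightarrow> D1 t > 0"
  proof (rule transition12[of x y])
    show "y \<le> x + 2 * pi" using xz by auto
  qed (use xz in auto)
  obtain b' a' where ab': "y \<le> b'" "b' < a'" "a' \<le> z" "D1 a' = 0" "D2 b' = 0"
    "\<forall>s\<in>{b'<..<a'}. D1 s > 0 \<and> D2 s > 0" "\<And>t. y \<le> t \<Longrightarrow> t < a' \<Longrightarrow> D1 t > 0"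
  proof (rule transition21[of z y])
    show "z \<le> y + 2 * pi" using xz by auto
  qed (use xz in auto)
  have l: "b \<le> a + 2 * pi" "a' \<le> b' + 2 * pi" "a' - a \<le> 2 * pi" "b \<le> b'"
    using ab ab' xz by auto
  note 1 = arc12[OF ab(2) l(1) ab(6) ab(4,5)]
  note 2 = arc21[OF ab'(2) l(2) ab'(6) ab'(4,5)]
  have 3: "(a' = a + pi \<and> b' = b) \<or> (pi < a' - a \<and> a' - a < 2 * pi \<and> a + a' = b + b' \<and> b < b' \<and> b' - b < pi)
      \<or> (a' = a + 2 * pi \<and> b' = b + pi)"
    by (rule match_pair_cases[OF m1 m2 1(2) 2(2) ab(2) l(4) ab'(2) 1(1) 2(1) l(3)]) auto
  have "D1 s > 0" if "s \<in> {a<..<a'}" for s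
    using ab(7)[of s] ab'(7)[of s] that by (cases "s \<le> y") auto
  with 3 ab ab' show thesis
    by (intro that[of a b b' a']) auto
qed

text \<open>A window of length \<open>pi\<close> admits only the alternative
  \<open>a' = a + pi\<close>, \<open>b' = b\<close>. The two arcs then meet in a single contact
  point, and one formula is valid across it because the squared sine has period
  \<open>pi\<close>.\<close>

lemma half_circle_excursion:
  assumes xz: "D1 x = 0" "D1 (x + pi) = 0" "y \<in> {x..x + pi}" "D2 y = 0"
  obtains b where "x < b" "b < x + pi" "D2 b = 0" "\<And>t. t \<in> {x..x + pi} \<Longrightarrow> D1 t = m1 * (sin (t - x))\<^sup>2"
proof -
  obtain a b b' a' where *: "x \<le> a" "a < b" "b \<le> y" "y \<le> b'" "b' < a'" "a' \<le> x + pi"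
    "D1 a = 0" "D2 b = 0" "D2 b' = 0" "D1 a' = 0"
    "\<forall>s\<in>{a<..<b}. D1 s > 0 \<and> D2 s > 0" "\<forall>s\<in>{b'<..<a'}. D1 s > 0 \<and> D2 s > 0"
    and c: "(a' = a + pi \<and> b' = b) \<or> (pi < a' - a \<and> a' - a < 2 * pi \<and> a + a' = b + b' \<and> b < b' \<and> b' - b < pi)
      \<or> (a' = a + 2 * pi \<and> b' = b + pi)"
  proof (rule excursion[OF xz(1,2) _ _ xz(3,4)])
    show "x \<le> x + pi" "x + pi \<le> x + 2 * pi" using pi_gt_zero by auto
  qed (rule that)
  have e: "a = x" "b' = b" "a' = x + pi" using c * pi_gt_zero by auto
  show thesis
  proof (rule that[of b])
    show "D1 t = m1 * (sin (t - x))\<^sup>2" if "t \<in> {x..x + pi}" for t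
    proof (cases "t \<le> b")
      case True
      then show ?thesis
        using arc12(3)[OF *(2) _ *(11) *(7,8), of t] that e * pi_gt_zero by auto
    next
      case False
      then have "D1 t = m1 * (sin (t - x - pi))\<^sup>2"
        using arc21(3)[OF *(5) _ *(12) *(10,9), of t] that e * pi_gt_zero by (auto simp: algebra_simps)
      then show ?thesis by (simp only: sin_shift_pi_sq)
    qed
  qed (use * e in auto)
qed

lemma excursion11:
  assumes "D1 x = 0" "D1 z = 0" "x \<le> t" "t \<le> z" "z \<le> x + 2 * pi" "\<forall>s\<in>{x..z}. D2 s > 0" "D1 t \<noteq> 0"
  obtains a where "x \<le> a" "a + pi \<le> z" "D1 a = 0" "D1 (a + pi) = 0" "\<forall>s\<in>{a<..<a + pi}. D1 s > 0 \<and> D2 s > 0"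
    "\<And>t. t \<in> {a..a + pi} \<Longrightarrow> D1 t = m1 * (sin (t - a))\<^sup>2"
proof -
  obtain a where a: "x \<le> a" "a \<le> t" "D1 a = 0" "\<And>s. a < s \<Longrightarrow> s \<le> t \<Longrightarrow> D1 s \<noteq> 0"
    using last_zero[OF cont1 assms(1,3)] by metis
  obtain b where b: "t \<le> b" "b \<le> z" "D1 b = 0" "\<And>s. t \<le> s \<Longrightarrow> s < b \<Longrightarrow> D1 s \<noteq> 0"
    using first_zero[OF cont1 assms(2,4)] by metis
  have pos: "\<forall>s\<in>{a<..<b}. D1 s > 0 \<and> D2 s > 0"
  proof
    fix s assume "s \<in> {a<..<b}"
    then show "D1 s > 0 \<and> D2 s > 0"
      using a b assms(6) pos1[of s] by (cases "s \<le> t") auto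
  qed
  have lt: "a < b" using a b assms(7) by (cases "a = t") auto
  have l: "b \<le> a + 2 * pi" using a b assms by auto
  note 1 = arc11[OF lt l pos a(3) b(3)]
  show thesis using 1 a b pos by (intro that[of a]) auto
qed

section \<open>Possible profiles on the unit circle\<close>

definition poly_profile :: bool where
  "poly_profile \<longleftrightarrow> (\<exists>a. \<forall>t. D1 t = m1 * (sin (t - a))\<^sup>2)"

definition half_profile :: bool where
  "half_profile \<longleftrightarrow> (\<exists>a. (\<forall>t\<in>{a..a + pi}. D1 t = m1 * (sin (t - a))\<^sup>2) \<and> (\<forall>t\<in>{a + pi..a + 2 * pi}. D1 t = 0))"

lemma poly_profileI:
  assumes "\<And>t. t \<in> {a..a + 2 * pi} \<Longrightarrow> D1 t = m1 * (sin (t - a))\<^sup>2"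
  shows poly_profile
  unfolding poly_profile_def
proof (intro exI allI)
  fix t
  obtain k :: int where k: "a \<le> t + turns k" "t + turns k < a + 2 * pi"
    using reduce_angle by blast
  have "sin (t - a) = sin (t - a + turns k)"
    by (rule periodic_int[symmetric]) simp
  then show "D1 t = m1 * (sin (t - a))\<^sup>2"
    using periodic_int[of D1, OF per1, of t k] assms[of "t + turns k"] k by (simp add: algebra_simps)
qed

text \<open>It remains to settle the opposite half circle. A zero \<open>b\<close> of
  \<open>D2\<close> there would be repeated at \<open>b - pi\<close> inside the free arc, since both
  the gap and the profile of \<open>D1\<close> have period \<open>pi\<close>. Without such a zero,
  either \<open>D1\<close> vanishes there or another arc of length \<open>pi\<close> fills all of
  it.\<close>

lemma arc11_profile:
  assumes z: "D1 a = 0" "D1 (a + pi) = 0" and pos: "\<forall>s\<in>{a<..<a + pi}. D1 s > 0 \<and> D2 s > 0"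
  shows "poly_profile \<or> half_profile"
proof -
  have D1: "D1 t = m1 * (sin (t - a))\<^sup>2" if "t \<in> {a..a + pi}" for t
    using arc11(2)[OF _ _ pos z that] pi_gt_zero by auto
  have z2: "D1 (a + pi + pi) = 0" using z per1[of a] by (simp add: algebra_simps)
  show ?thesis
  proof (cases "\<exists>y\<in>{a + pi..a + pi + pi}. D2 y = 0")
    case True
    then obtain y where y: "y \<in> {a + pi..a + pi + pi}" "D2 y = 0" by auto
    obtain b where b: "a + pi < b" "b < a + pi + pi" "D2 b = 0"
      "\<And>t. t \<in> {a + pi..a + pi + pi} \<Longrightarrow> D1 t = m1 * (sin (t - (a + pi)))\<^sup>2"
      using half_circle_excursion[OF z(2) z2 y] by auto
    have "D1 (b - pi) = m1 * (sin (b - pi - a))\<^sup>2" using D1[of "b - pi"] b by auto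
    also have "\<dots> = D1 b" using b(4)[of b] b by (simp add: algebra_simps)
    finally have "D2 (b - pi) = D2 b"
      using gap[of b] gap[of "b - pi"] by (simp add: algebra_simps cos_diff)
    then show ?thesis using pos b by (auto dest!: bspec[of _ _ "b - pi"])
  next
    case False
    then have p2: "\<forall>s\<in>{a + pi..a + pi + pi}. D2 s > 0" using pos2 by blast
    show ?thesis
    proof (cases "\<forall>t\<in>{a + pi..a + 2 * pi}. D1 t = 0")
      case True
      then show ?thesis using D1 unfolding half_profile_def by blast
    next
      case False
      then obtain t where t: "a + pi \<le> t" "t \<le> a + pi + pi" "D1 t \<noteq> 0" by auto
      obtain a2 where a2: "a + pi \<le> a2" "a2 + pi \<le> a + pi + pi"
        "\<And>t. t \<in> {a2..a2 + pi} \<Longrightarrow> D1 t = m1 * (sin (t - a2))\<^sup>2"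
        by (rule excursion11[OF z(2) z2 t(1,2) _ p2 t(3)]) (use pi_gt_zero in auto)
      have e: "a2 = a + pi" using a2 by auto
      have "D1 t = m1 * (sin (t - a))\<^sup>2" if "t \<in> {a..a + 2 * pi}" for t
      proof (cases "t \<le> a + pi")
        case False
        then have "D1 t = m1 * (sin (t - a - pi))\<^sup>2"
          using a2(3)[of t] e that by (simp add: algebra_simps)
        then show ?thesis by (simp only: sin_shift_pi_sq)
      qed (use D1 that in auto)
      then show ?thesis using poly_profileI by blast
    qed
  qed
qed

definition cone_profile :: "real \<Rightarrow> real \<Rightarrow> real \<Rightarrow> real \<Rightarrow> bool" where
  "cone_profile a b b' a' \<longleftrightarrow> a < b \<and> b < b' \<and> b' < a' \<and> a' < a + 2 * pi \<and> b' - b < pi \<and> a + 2 * pi - a' < pi \<and>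
    (\<forall>t\<in>{a'..a + 2 * pi}. D1 t = 0) \<and> (\<forall>t\<in>{b..b'}. D2 t = 0) \<and>
    (\<forall>t\<in>{a<..<b} \<union> {b'<..<a'}. D1 t > 0 \<and> D2 t > 0)"

end

text \<open>A free arc with both edges on the same obstacle has length \<open>pi\<close> and is
  settled by \<open>arc11_profile\<close>. Without such arcs, contact with one obstacle fills every
  interval between two of its points on which the other obstacle is not touched; a single excursion
  over a full turn then decides the shape.\<close>

lemma (in circle) profile_cases:
  obtains "\<forall>t. D1 t > 0 \<and> D2 t > 0" | "\<forall>t. D1 t = 0" | "\<forall>t. D2 t = 0"
    | poly_profile | "circle.poly_profile D2 m2" | half_profile | "circle.half_profile D2 m2"
    | a b b' a' where "cone_profile a b b' a'"
proof -
  interpret sw: circle D2 D1 m2 m1 d by (rule swapped)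
  show thesis
  proof (cases "\<exists>a. (D1 a = 0 \<and> D1 (a + pi) = 0 \<or> D2 a = 0 \<and> D2 (a + pi) = 0) \<and> (\<forall>s\<in>{a<..<a + pi}. D1 s > 0 \<and> D2 s > 0)")
    case True
    then show thesis
      using arc11_profile sw.arc11_profile that(4-7) by (metis (no_types, lifting))
  next
    case False
    have L11: "D1 t = 0" if xz: "D1 x = 0" "D1 z = 0" "z \<le> x + 2 * pi" "\<forall>s\<in>{x..z}. D2 s > 0" "t \<in> {x..z}" for x z t
    proof (rule ccontr)
      assume nz: "D1 t \<noteq> 0"
      obtain a where "D1 a = 0" "D1 (a + pi) = 0" "\<forall>s\<in>{a<..<a + pi}. D1 s > 0 \<and> D2 s > 0"
      proof (rule excursion11[of x z t])
        show "x \<le> t" "t \<le> z" using xz(5) by auto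
      qed (use xz nz in blast)+
      then show False using False by blast
    qed
    have L22: "D2 t = 0" if xz: "D2 x = 0" "D2 z = 0" "z \<le> x + 2 * pi" "\<forall>s\<in>{x..z}. D1 s > 0" "t \<in> {x..z}" for x z t
    proof (rule ccontr)
      assume nz: "D2 t \<noteq> 0"
      obtain a where "D2 a = 0" "D2 (a + pi) = 0" "\<forall>s\<in>{a<..<a + pi}. D2 s > 0 \<and> D1 s > 0"
      proof (rule sw.excursion11[of x z t])
        show "x \<le> t" "t \<le> z" using xz(5) by auto
      qed (use xz nz in blast)+
      then show False using False by blast
    qed
    consider "\<forall>t. D1 t > 0 \<and> D2 t > 0" | x where "D1 x = 0" "\<forall>t. D2 t > 0" | x where "D2 x = 0" "\<forall>t. D1 t > 0"
      | x y where "D1 x = 0" "D2 y = 0"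
      using pos1 pos2 by blast
    then show thesis
    proof cases
      case 1 then show thesis by (rule that(1))
    next
      case (2 x)
      have "D1 t = 0" for t
      proof -
        obtain k :: int where k: "x \<le> t + turns k" "t + turns k < x + 2 * pi"
          using reduce_angle by blast
        then show ?thesis
          using L11[of x "x + 2 * pi" "t + turns k"] 2 per1[of x] periodic_int[of D1, OF per1, of t k] by auto
      qed
      then show thesis by (intro that(2)) auto
    next
      case (3 x)
      have "D2 t = 0" for t
      proof -
        obtain k :: int where k: "x \<le> t + turns k" "t + turns k < x + 2 * pi"
          using reduce_angle by blast
        then show ?thesis
          using L22[of x "x + 2 * pi" "t + turns k"] 3 per2[of x] periodic_int[of D2, OF per2, of t k] by auto
      qed
      then show thesis by (intro that(3)) auto
    next
      case (4 x y0)
      obtain k :: int where k: "x \<le> y0 + turns k" "y0 + turns k < x + 2 * pi"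
        using reduce_angle by blast
      define y where "y = y0 + turns k"
      have y: "x \<le> y" "y < x + 2 * pi" "D2 y = 0"
        using k 4 periodic_int[of D2, OF per2] by (auto simp: y_def)
      obtain a b b' a' where *: "x \<le> a" "a < b" "b \<le> y" "y \<le> b'" "b' < a'" "a' \<le> x + 2 * pi"
        "D1 a = 0" "D2 b = 0" "D2 b' = 0" "D1 a' = 0"
        "\<forall>s\<in>{a<..<b}. D1 s > 0 \<and> D2 s > 0" "\<forall>s\<in>{b'<..<a'}. D1 s > 0 \<and> D2 s > 0"
        "\<forall>s\<in>{a<..<a'}. D1 s > 0"
        and c: "(a' = a + pi \<and> b' = b) \<or> (pi < a' - a \<and> a' - a < 2 * pi \<and> a + a' = b + b' \<and> b < b' \<and> b' - b < pi)
          \<or> (a' = a + 2 * pi \<and> b' = b + pi)"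
      proof (rule excursion[of x "x + 2 * pi" y])
        show "D1 (x + 2 * pi) = 0" "y \<in> {x..x + 2 * pi}" using 4 y per1[of x] by auto
      qed (use 4 y in auto)
      have bb: "D2 t = 0" if "t \<in> {b..b'}" for t
        by (rule L22[OF *(8,9) _ _ that]) (use * in auto)
      have az: "D1 (a + 2 * pi) = 0" using * per1[of a] by simp
      have bnd: "b \<le> a + 2 * pi" "a' \<le> b' + 2 * pi" using * by auto
      note A12 = arc12[OF *(2) bnd(1) *(11) *(7,8)]
      note A21 = arc21[OF *(5) bnd(2) *(12) *(10,9)]
      \<comment> \<open>In (i) \<open>p2\<close> is touched at the single angle \<open>b\<close> of
        a half circle, in (iii) \<open>p1\<close> is touched at the single angle \<open>a\<close> of
        the whole circle; (ii) is the double cone.\<close>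
      from c consider (i) "a' = a + pi" "b' = b"
        | (ii) "pi < a' - a" "a' - a < 2 * pi" "b < b'" "b' - b < pi" | (iii) "a' = a + 2 * pi" "b' = b + pi"
        by blast
      then show thesis
      proof cases
        case i
        have D1: "D1 t = m1 * (sin (t - a))\<^sup>2" if "t \<in> {a..a + pi}" for t
        proof (cases "t \<le> b")
          case True then show ?thesis using A12(3)[of t] that by auto
        next
          case False
          then have "D1 t = m1 * (sin (t - a - pi))\<^sup>2"
            using A21(3)[of t] that i by (auto simp: algebra_simps)
          then show ?thesis by (simp only: sin_shift_pi_sq)
        qed
        have z: "D1 (a + pi) = 0" "D1 (a + pi + pi) = 0" using i * az by (auto simp: algebra_simps)
        show thesis
        proof (cases "\<exists>y\<in>{a + pi..a + pi + pi}. D2 y = 0")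
          case True
          then obtain y where "y \<in> {a + pi..a + pi + pi}" "D2 y = 0" by auto
          from half_circle_excursion[OF z this]
          have D1': "\<And>t. t \<in> {a + pi..a + pi + pi} \<Longrightarrow> D1 t = m1 * (sin (t - (a + pi)))\<^sup>2" by blast
          have "D1 t = m1 * (sin (t - a))\<^sup>2" if "t \<in> {a..a + 2 * pi}" for t
          proof (cases "t \<le> a + pi")
            case False
            then have "D1 t = m1 * (sin (t - a - pi))\<^sup>2"
              using D1'[of t] that by (simp add: algebra_simps)
            then show ?thesis by (simp only: sin_shift_pi_sq)
          qed (use D1 that in auto)
          then show thesis using poly_profileI that(4) by blast
        next
          case False
          then have "\<forall>s\<in>{a + pi..a + pi + pi}. D2 s > 0" using pos2 by blast
          then have "\<forall>t\<in>{a + pi..a + 2 * pi}. D1 t = 0"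
            using L11[OF z] pi_gt_zero by auto
          then show thesis using D1 that(6) unfolding half_profile_def by blast
        qed
      next
        case ii
        \<comment> \<open>Every excursion from \<open>p1\<close> that meets \<open>p2\<close> needs
          length at least \<open>pi\<close>, and the remaining interval is shorter.\<close>
        have "D2 s \<noteq> 0" if s: "s \<in> {a'..a + 2 * pi}" for s
        proof
          assume s0: "D2 s = 0"
          have l: "a' \<le> a + 2 * pi" "a + 2 * pi \<le> a' + 2 * pi" using ii * by auto
          show False
            by (rule excursion[OF *(10) az l s s0]) (use ii in auto)
        qed
        then have "\<forall>s\<in>{a'..a + 2 * pi}. D2 s > 0" using pos2 by blast
        then have "\<forall>t\<in>{a'..a + 2 * pi}. D1 t = 0"
          using L11[OF *(10) az] * by auto
        then have "cone_profile a b b' a'"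
          unfolding cone_profile_def using * ii bb by auto
        then show thesis by (rule that(8))
      next
        case iii
        \<comment> \<open>The two free arcs join at \<open>a'\<close>, which is \<open>a\<close> one
          turn later, and together form a half circle with both ends on \<open>p2\<close>.\<close>
        have "D2 t = m2 * (sin (t - b'))\<^sup>2" if "t \<in> {b'..b' + pi}" for t
        proof (cases "t \<le> a'")
          case True then show ?thesis using A21(4)[of t] that by auto
        next
          case False
          then have "D2 (t - 2 * pi) = m2 * (sin (t - 2 * pi - b))\<^sup>2"
            using A12(4)[of "t - 2 * pi"] that iii by auto
          also have "sin (t - 2 * pi - b) = sin (t - b' - pi)"
            using iii by (simp add: algebra_simps)
          finally show ?thesis using per2[of "t - 2 * pi"] by (simp only: sin_shift_pi_sq) simp
        qed
        moreover have "D2 t = 0" if "t \<in> {b' + pi..b' + 2 * pi}" for t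
          using bb[of "t - 2 * pi"] per2[of "t - 2 * pi"] that iii by auto
        ultimately have "sw.half_profile"
          unfolding sw.half_profile_def by blast
        then show thesis by (rule that(7))
      qed
    qed
  qed
qed

section \<open>Unique continuation from the edge of a sector\<close>

abbreviation "pol \<equiv> polar_point"

lemma polar_point_cv: "pol r t = cv (rcis r t)"
  by (simp add: polar_point_def cv_def)

lemma polar_point_nth [simp]: "pol r t $ 1 = r * cos t" "pol r t $ 2 = r * sin t"
  by (simp_all add: polar_point_def)

lemma polar_point_zero [simp]: "pol 0 t = 0"
  by (simp add: vec_eq_iff forall_2)

lemma scale_polar_point: "s *\<^sub>R pol r t = pol (s * r) t"
  by (simp add: vec_eq_iff forall_2)

lemma polar_point_Ex: "\<exists>r t. 0 \<le> r \<and> x = pol r t"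
proof -
  have "x = cv (Complex (x $ 1) (x $ 2))" by (simp add: cv_eq_iff)
  then show ?thesis
    unfolding polar_point_cv by (metis rcis_cmod_Arg norm_ge_zero)
qed

lemma norm_polar_point: "norm (pol r t) = \<bar>r\<bar>"
proof -
  have "(r * cos t)\<^sup>2 + (r * sin t)\<^sup>2 = r\<^sup>2 * ((sin t)\<^sup>2 + (cos t)\<^sup>2)"
    by (simp only: power_mult_distrib distrib_left add.commute)
  then show ?thesis by (simp add: norm_real2)
qed

lemma polar_point_2pi: "pol r (t + 2 * pi) = pol r t" "pol r (t - 2 * pi) = pol r t"
proof -
  show 1: "pol r (t + 2 * pi) = pol r t" for t
    by (simp add: vec_eq_iff forall_2)
  show "pol r (t - 2 * pi) = pol r t"
    using 1[of "t - 2 * pi"] by simp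
qed

lemma inner_polar_point_normal:
  "pol 1 (a + pi / 2) \<bullet> pol r t = r * sin (t - a)"
  "pol r t \<bullet> pol 1 (a + pi / 2) = r * sin (t - a)"
  by (simp_all add: inner_real2 sin_diff cos_add sin_add algebra_simps)

definition sector :: "real \<Rightarrow> real \<Rightarrow> complex set" where
  "sector \<alpha> \<beta> = {rcis r t | r t. 0 < r \<and> \<alpha> < t \<and> t < \<beta>}"

text \<open>As the image of a horizontal strip under \<open>exp\<close>, a sector is open by the
  open mapping theorem and connected because the strip is convex.\<close>

lemma sector_exp: "sector \<alpha> \<beta> = exp ` ({z. \<alpha> < Im z} \<inter> {z. Im z < \<beta>})"
proof (intro set_eqI iffI)
  fix z assume "z \<in> sector \<alpha> \<beta>"
  then obtain r t where *: "z = rcis r t" "0 < r" "\<alpha> < t" "t < \<beta>" by (auto simp: sector_def)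
  then have "z = exp (Complex (ln r) t)"
    by (simp add: exp_eq_polar rcis_def)
  then show "z \<in> exp ` ({z. \<alpha> < Im z} \<inter> {z. Im z < \<beta>})" using * by auto
next
  fix z assume "z \<in> exp ` ({z. \<alpha> < Im z} \<inter> {z. Im z < \<beta>})"
  then obtain w where w: "\<alpha> < Im w" "Im w < \<beta>" "z = exp w" by auto
  have "z = rcis (exp (Re w)) (Im w)"
    unfolding w(3) exp_eq_polar[of w] by (simp add: rcis_def)
  then show "z \<in> sector \<alpha> \<beta>"
    unfolding sector_def using w exp_gt_zero[of "Re w"] by blast
qed

lemma open_sector_sector: "open (sector \<alpha> \<beta>)"
  unfolding sector_exp
proof (rule open_mapping_thm[where S = UNIV])
  show "open ({z. \<alpha> < Im z} \<inter> {z. Im z < \<beta>})"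
    by (intro open_Int open_halfspace_Im_gt open_halfspace_Im_lt)
  have "exp 0 \<noteq> exp (\<i> * of_real pi)" by (simp only: exp_pi_i exp_zero) simp
  then show "\<not> (exp :: complex \<Rightarrow> complex) constant_on UNIV"
    unfolding constant_on_def by (metis UNIV_I)
qed (auto intro: holomorphic_intros)

lemma connected_sector: "connected (sector \<alpha> \<beta>)"
  unfolding sector_exp
  by (intro connected_continuous_image continuous_on_exp continuous_on_id convex_connected convex_Int
      convex_halfspace_Im_gt convex_halfspace_Im_lt)

text \<open>After rotation by \<open>- \<gamma>\<close> the edge point becomes 1, where
  \<open>Arg\<close> is continuous: nearby points have small argument, with the sign of their
  imaginary part. The sign \<open>\<sigma>\<close> tells on which side of the edge the sector
  lies.\<close>

lemma sector_near_edge: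
  fixes \<alpha> \<beta> \<gamma> \<sigma> :: real
  assumes "\<alpha> < \<beta>" and edge: "\<sigma> = 1 \<and> \<gamma> = \<alpha> \<or> \<sigma> = -1 \<and> \<gamma> = \<beta>"
  obtains \<delta> where "0 < \<delta>" "\<delta> \<le> 1"
    "\<And>z. z \<in> ball (cis \<gamma>) \<delta> \<Longrightarrow> \<sigma> * Im (z * cis (- \<gamma>)) > 0 \<Longrightarrow> z \<in> sector \<alpha> \<beta>"
proof -
  have "isCont Arg 1" by (rule continuous_at_Arg) simp
  then have "\<forall>e>0. \<exists>d>0. \<forall>w. dist w 1 < d \<longrightarrow> dist (Arg w) (Arg 1) < e"
    by (simp add: continuous_at_eps_delta dist_norm)
  then obtain d where d: "d > 0" "\<And>w. dist w 1 < d \<Longrightarrow> \<bar>Arg w\<bar> < \<beta> - \<alpha>"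
    using assms(1) by (metis Arg_1 diff_gt_0_iff_gt dist_real_def diff_zero)
  show thesis
  proof (rule that[of "min d 1"])
    fix z assume z: "z \<in> ball (cis \<gamma>) (min d 1)" "\<sigma> * Im (z * cis (- \<gamma>)) > 0"
    define w where "w = z * cis (- \<gamma>)"
    have zw: "z = w * cis \<gamma>" by (simp add: w_def mult.assoc cis_mult)
    have "dist w 1 = dist z (cis \<gamma>)"
    proof -
      have "z - cis \<gamma> = (w - 1) * cis \<gamma>" by (simp add: zw algebra_simps)
      then show ?thesis by (simp add: dist_norm norm_mult)
    qed
    then have A: "\<bar>Arg w\<bar> < \<beta> - \<alpha>" using d(2) z(1) by (simp add: dist_commute)
    have w0: "w \<noteq> 0" using z(2) by (auto simp: w_def)
    have z': "z = rcis (cmod w) (Arg w + \<gamma>)"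
      unfolding zw by (subst (1) rcis_cmod_Arg[of w, symmetric]) (simp add: rcis_def mult.assoc cis_mult)
    have "\<sigma> * Arg w > 0"
      using edge z(2) Arg_lt_pi[of w] Arg_neg_iff[of w] by (auto simp: w_def)
    then have "\<alpha> < Arg w + \<gamma>" "Arg w + \<gamma> < \<beta>" using edge A by auto
    then show "z \<in> sector \<alpha> \<beta>"
      unfolding sector_def mem_Collect_eq using z' w0 zero_less_norm_iff by blast
  qed (use d in auto)
qed

text \<open>Extending \<open>f - \<kappa> z\<close> by zero across the edge gives a function that is holomorphic
  near a point of the edge and vanishes on one side, so it vanishes on the whole sector.\<close>

lemma holomorphic_linear_on_sector:
  fixes \<alpha> \<beta> \<gamma> \<sigma> :: real
  assumes hol: "f holomorphic_on sector \<alpha> \<beta>" and cont: "continuous_on UNIV f" and "\<alpha> < \<beta>"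
    and edge: "\<sigma> = 1 \<and> \<gamma> = \<alpha> \<or> \<sigma> = -1 \<and> \<gamma> = \<beta>"
    and ray: "\<And>r. 0 < r \<Longrightarrow> f (rcis r \<gamma>) = \<kappa> * rcis r \<gamma>"
    and z: "z \<in> sector \<alpha> \<beta>"
  shows "f z = \<kappa> * z"
proof -
  obtain \<delta> where \<delta>: "0 < \<delta>" "\<delta> \<le> 1"
    and sub: "\<And>z. z \<in> ball (cis \<gamma>) \<delta> \<Longrightarrow> \<sigma> * Im (z * cis (- \<gamma>)) > 0 \<Longrightarrow> z \<in> sector \<alpha> \<beta>"
    using sector_near_edge[OF \<open>\<alpha> < \<beta>\<close> edge] by blast
  define B where "B = ball (cis \<gamma>) \<delta>"
  define h where "h z = \<sigma> * Im (z * cis (- \<gamma>))" for z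
  have hd: "h z = (of_real \<sigma> * \<i> * cis \<gamma>) \<bullet> z" for z
    by (simp add: h_def inner_complex_def algebra_simps)
  have conth: "continuous_on S h" for S
    unfolding h_def by (intro continuous_intros)
  have h_pt: "h (rcis r t) = \<sigma> * r * sin (t - \<gamma>)" for r t
    by (simp add: h_def sin_diff algebra_simps)
  have \<sigma>: "\<sigma> = 1 \<or> \<sigma> = -1" using edge by auto
  define F where "F z = (if h z \<le> 0 then 0 else f z - \<kappa> * z)" for z
  \<comment> \<open>Since \<open>\<delta> \<le> 1\<close>, the ball meets the line
    \<open>h z = 0\<close> only in the ray of angle \<open>\<gamma>\<close> and not in the opposite
    ray, where the values of \<open>f\<close> are unknown.\<close>
  have on_ray: "f z - \<kappa> * z = 0" if "z \<in> B" "h z = 0" for z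
  proof -
    define w where "w = z * cis (- \<gamma>)"
    have zw: "z = w * cis \<gamma>" by (simp add: w_def mult.assoc cis_mult)
    have "z - cis \<gamma> = (w - 1) * cis \<gamma>" by (simp add: zw algebra_simps)
    then have "cmod (w - 1) < 1"
      using that(1) \<delta> by (simp add: B_def dist_norm norm_mult norm_minus_commute)
    moreover have "\<bar>Re (w - 1)\<bar> \<le> cmod (w - 1)" by (rule abs_Re_le_cmod)
    ultimately have "Re w > 0" by auto
    moreover have "Im w = 0" using that(2) \<sigma> by (auto simp: h_def w_def)
    ultimately have "z = rcis (Re w) \<gamma>" by (simp add: zw complex_eq_iff)
    with ray[OF \<open>Re w > 0\<close>] show ?thesis by simp
  qed
  have contF: "continuous_on B F"
    unfolding F_def
    by (rule continuous_on_cases_le[OF _ _ conth])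
      (use on_ray in \<open>auto intro!: continuous_intros continuous_on_subset[OF cont]\<close>)
  have cis_B: "cis \<gamma> \<in> B" using \<delta> by (simp add: B_def)
  have "open B" "connected B" by (simp_all add: B_def)
  have holF: "F holomorphic_on B"
  proof (rule holomorphic_on_paste_across_line[OF \<open>open B\<close> _ _ _ contF])
    show "of_real \<sigma> * \<i> * cis \<gamma> \<noteq> 0" using \<sigma> by auto
    have "(\<lambda>_. 0) holomorphic_on B \<inter> {z. h z < 0}" by simp
    then show "F holomorphic_on B \<inter> {z. (of_real \<sigma> * \<i> * cis \<gamma>) \<bullet> z < 0}"
      unfolding hd[symmetric] by (rule holomorphic_transform) (auto simp: F_def)
    have "(\<lambda>z. f z - \<kappa> * z) holomorphic_on B \<inter> {z. 0 < h z}"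
      by (intro holomorphic_intros holomorphic_on_subset[OF hol]) (use sub in \<open>auto simp: B_def h_def\<close>)
    then show "F holomorphic_on B \<inter> {z. 0 < (of_real \<sigma> * \<i> * cis \<gamma>) \<bullet> z}"
      unfolding hd[symmetric] by (rule holomorphic_transform) (auto simp: F_def)
  qed
  \<comment> \<open>The identity theorem is applied twice, from one side of the line to the ball and
    from the other side to the sector; both applications need a nonempty open set to start
    from.\<close>
  have side: "\<exists>z. z \<in> B \<and> s * h z > 0" if "s = 1 \<or> s = -1" for s :: real
  proof -
    have "((\<lambda>t. cis (\<gamma> + t)) \<longlongrightarrow> cis (\<gamma> + 0)) (at 0)"
      by (intro tendsto_intros)
    then have "\<forall>\<^sub>F t in at 0. cis (\<gamma> + t) \<in> B"
      using \<open>open B\<close> cis_B by (auto dest: topological_tendstoD)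
    then obtain e where e: "e > 0" "\<And>t. t \<noteq> 0 \<Longrightarrow> \<bar>t\<bar> < e \<Longrightarrow> cis (\<gamma> + t) \<in> B"
      by (auto simp: eventually_at)
    define t where "t = min (e / 2) 1"
    have t: "0 < t" "t < e" "t < pi" using e pi_gt3 by (auto simp: t_def min_def)
    have "sin t > 0" using t by (intro sin_gt_zero) auto
    then have "s * h (cis (\<gamma> + s * \<sigma> * t)) > 0"
      using h_pt[of 1] \<sigma> that by (auto simp: cis_rcis_eq)
    moreover have "cis (\<gamma> + s * \<sigma> * t) \<in> B"
      using t \<sigma> that by (intro e) auto
    ultimately show ?thesis by blast
  qed
  have "F z = 0" if "z \<in> B" for z
  proof (rule analytic_continuation_open[where f = F and g = "\<lambda>_. 0" and s = "B \<inter> {z. h z < 0}" and s' = B])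
    show "open (B \<inter> {z. h z < 0})"
      by (intro open_Int \<open>open B\<close> open_Collect_less conth continuous_on_const)
    show "B \<inter> {z. h z < 0} \<noteq> {}" using side[of "-1"] by auto
  qed (use \<open>open B\<close> \<open>connected B\<close> holF that in \<open>auto simp: F_def\<close>)
  then have fB: "f z = \<kappa> * z" if "z \<in> B" "h z > 0" for z
    using that by (force simp: F_def)
  show ?thesis
  proof (rule analytic_continuation_open[where f = f and g = "\<lambda>z. \<kappa> * z" and s = "B \<inter> {z. 0 < h z}" and s' = "sector \<alpha> \<beta>"])
    show "open (B \<inter> {z. 0 < h z})"
      by (intro open_Int \<open>open B\<close> open_Collect_less conth continuous_on_const)
    show "B \<inter> {z. 0 < h z} \<noteq> {}" using side[of 1] by auto
    show "B \<inter> {z. 0 < h z} \<subseteq> sector \<alpha> \<beta>" using sub by (auto simp: B_def h_def)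
  qed (use hol z fB in \<open>auto simp: open_sector_sector connected_sector intro!: holomorphic_intros\<close>)
qed

section \<open>Contact with an obstacle\<close>

lemma quadratic_obstacle_gderiv:
  "GDERIV (quadratic_obstacle a c) y :> vector [2 * a * y $ 1, 2 * c * y $ 2]"
  unfolding gderiv_def quadratic_obstacle_def[abs_def]
  by (auto intro!: derivative_eq_intros bounded_linear.has_derivative[OF bounded_linear_vec_nth]
      simp: inner_real2 algebra_simps)

text \<open>At a contact point the difference \<open>u - p\<close> has a global extremum, so its
  derivative vanishes. This provides the boundary values of the complex gradient on an edge.\<close>

lemma GDERIV_contact:
  assumes u: "GDERIV u x :> g" and p: "GDERIV p x :> q" and eq: "u x = p x"
    and le: "(\<forall>y. p y \<le> u y) \<or> (\<forall>y. u y \<le> p y)"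
  shows "g = q"
proof -
  have "((\<lambda>y. u y - p y) has_derivative (\<lambda>h. h \<bullet> g - h \<bullet> q)) (at x)"
    using u p unfolding gderiv_def by (rule has_derivative_diff)
  then have "(\<lambda>h. h \<bullet> g - h \<bullet> q) = (\<lambda>v. 0)"
    by (rule differential_zero_maxmin[where S = UNIV, rotated 2]) (use le eq in auto)
  then have "h \<bullet> g = h \<bullet> q" for h
    by (metis eq_iff_diff_eq_0)
  then show ?thesis by (metis inner_commute vector_eq_rdot)
qed

text \<open>The function \<open>\<kappa> * z\<close> is the complex gradient of
  \<open>Re (\<kappa> * z^2) / 2\<close>, so the difference to \<open>u\<close> has derivative zero
  on a connected open set.\<close>

lemma gradient_determines_on_sector:
  assumes G: "\<And>x. GDERIV u x :> g x" and \<kappa>: "\<And>z. z \<in> S \<Longrightarrow> cgrad g z = \<kappa> * z"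
    and S: "open S" "connected S" and zw: "z \<in> S" "w \<in> S"
  shows "u (cv z) - Re (\<kappa> * z\<^sup>2) / 2 = u (cv w) - Re (\<kappa> * w\<^sup>2) / 2"
proof (rule has_derivative_zero_unique_connected[OF S _ zw])
  fix z assume z: "z \<in> S"
  have "((\<lambda>z. u (cv z)) has_derivative (\<lambda>h. cv h \<bullet> g (cv z))) (at z)"
    by (rule GDERIV_has_derivative_cv[OF G])
  moreover have "((\<lambda>z. Re (\<kappa> * z\<^sup>2) / 2) has_derivative (\<lambda>h. Re (\<kappa> * z * h))) (at z)"
    by (auto intro!: derivative_eq_intros simp: field_simps power2_eq_square)
  ultimately have "((\<lambda>z. u (cv z) - Re (\<kappa> * z\<^sup>2) / 2) has_derivative (\<lambda>h. cv h \<bullet> g (cv z) - Re (\<kappa> * z * h))) (at z)"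
    by (rule has_derivative_diff)
  moreover have "cv h \<bullet> g (cv z) - Re (\<kappa> * z * h) = 0" for h
    unfolding \<kappa>[OF z, symmetric] by (simp add: inner_real2 cgrad_def algebra_simps)
  ultimately show "((\<lambda>z. u (cv z) - Re (\<kappa> * z\<^sup>2) / 2) has_derivative (\<lambda>h. 0)) (at z)"
    by simp
qed

lemma quadratic_obstacle_polar:
  "quadratic_obstacle a c (pol r t) = r\<^sup>2 * ((a + c) + (a - c) * cos (2 * t)) / 2"
proof -
  have e: "(sin t)\<^sup>2 = (1 - cos (2 * t)) / 2" "(cos t)\<^sup>2 = (1 + cos (2 * t)) / 2"
    by (simp add: cos_double_sin, simp add: cos_double_cos)
  show ?thesis
    unfolding quadratic_obstacle_def polar_point_nth power_mult_distrib e by (simp add: field_simps)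
qed

lemma solution_on_sector:
  assumes G: "\<And>x. GDERIV u x :> g x" and contg: "continuous_on UNIV g"
    and hol: "cgrad g holomorphic_on sector \<alpha> \<beta>" and "\<alpha> < \<beta>" and edge: "\<gamma> \<in> {\<alpha>, \<beta>}"
    and u: "u (pol 1 \<gamma>) = quadratic_obstacle a c (pol 1 \<gamma>)"
    and g: "\<And>r. 0 < r \<Longrightarrow> g (pol r \<gamma>) = vector [2 * a * (r * cos \<gamma>), 2 * c * (r * sin \<gamma>)]"
    and rt: "0 < r" "\<alpha> < t" "t < \<beta>"
  shows "u (pol r t) = quadratic_obstacle a c (pol r t) - (a + c) * r\<^sup>2 * (sin (t - \<gamma>))\<^sup>2"
proof -
  \<comment> \<open>The complex gradient of the obstacle at \<open>z\<close> is
    \<open>(a - c) * z + (a + c) * cnj z\<close>; on the ray of angle \<open>\<gamma>\<close> one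
    has \<open>cnj z = cis (- 2 * \<gamma>) * z\<close>, which gives
    \<open>\<kappa>\<close>.\<close>
  define \<kappa> where "\<kappa> = of_real (a - c) + of_real (a + c) * cis (- 2 * \<gamma>)"
  define \<sigma> :: real where "\<sigma> = (if \<gamma> = \<alpha> then 1 else -1)"
  have edge': "\<sigma> = 1 \<and> \<gamma> = \<alpha> \<or> \<sigma> = -1 \<and> \<gamma> = \<beta>" using edge by (auto simp: \<sigma>_def)
  have ray: "cgrad g (rcis r \<gamma>) = \<kappa> * rcis r \<gamma>" if "0 < r" for r
  proof -
    have "\<kappa> * rcis r \<gamma> = of_real r * (of_real (a - c) * cis \<gamma> + of_real (a + c) * (cis (- 2 * \<gamma>) * cis \<gamma>))"
      unfolding \<kappa>_def rcis_def by (simp only: distrib_left distrib_right mult_ac)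
    also have "cis (- 2 * \<gamma>) * cis \<gamma> = cis (- \<gamma>)" by (simp add: cis_mult)
    finally have "\<kappa> * rcis r \<gamma> = of_real r * (of_real (a - c) * cis \<gamma> + of_real (a + c) * cis (- \<gamma>))" .
    then show ?thesis
      using g[OF that] by (simp add: cgrad_def polar_point_cv complex_eq_iff algebra_simps)
  qed
  have lin: "cgrad g z = \<kappa> * z" if "z \<in> sector \<alpha> \<beta>" for z
    by (rule holomorphic_linear_on_sector[OF hol continuous_on_cgrad[OF contg] \<open>\<alpha> < \<beta>\<close> edge' ray that])
  have W: "Re (\<kappa> * (rcis r t)\<^sup>2) / 2 = quadratic_obstacle a c (pol r t) - (a + c) * r\<^sup>2 * (sin (t - \<gamma>))\<^sup>2" for r t
  proof -
    have sq: "(rcis r t)\<^sup>2 = of_real (r\<^sup>2) * cis (2 * t)"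
      by (simp add: rcis_def power_mult_distrib power2_eq_square cis_mult)
    have "\<kappa> * (rcis r t)\<^sup>2 = of_real (r\<^sup>2) * (of_real (a - c) * cis (2 * t) + of_real (a + c) * (cis (- 2 * \<gamma>) * cis (2 * t)))"
      unfolding \<kappa>_def sq by (simp only: distrib_left distrib_right mult_ac)
    also have "cis (- 2 * \<gamma>) * cis (2 * t) = cis (2 * t - 2 * \<gamma>)" by (simp add: cis_mult)
    finally have R: "Re (\<kappa> * (rcis r t)\<^sup>2) = r\<^sup>2 * ((a - c) * cos (2 * t) + (a + c) * cos (2 * t - 2 * \<gamma>))"
      by simp
    have C: "cos (2 * t - 2 * \<gamma>) = 1 - 2 * (sin (t - \<gamma>))\<^sup>2"
      using cos_double_sin[of "t - \<gamma>"] by (simp add: algebra_simps)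
    show ?thesis
      unfolding R C quadratic_obstacle_polar by (simp add: field_simps)
  qed
  \<comment> \<open>\<open>E\<close> is constant on the open sector. Its value 0 is found on the
    edge, where \<open>u\<close> equals the obstacle, by continuity along the unit circle.\<close>
  define E where "E z = u (cv z) - Re (\<kappa> * z\<^sup>2) / 2" for z
  have E: "E z = E w" if "z \<in> sector \<alpha> \<beta>" "w \<in> sector \<alpha> \<beta>" for z w
    unfolding E_def by (rule gradient_determines_on_sector[OF G lin open_sector_sector connected_sector that])
  have "continuous_on UNIV (\<lambda>z. u (cv z))"
    by (rule continuous_on_compose_cv[OF GDERIV_continuous_on[OF G]])
  then have contE: "continuous_on UNIV E"
    unfolding E_def by (intro continuous_intros) auto
  have 1: "continuous_on (closure {\<alpha><..<\<beta>}) (\<lambda>s. E (cis s))"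
    by (rule continuous_on_compose2[OF contE]) (auto intro: continuous_intros)
  have 2: "\<gamma> \<in> closure {\<alpha><..<\<beta>}" using edge \<open>\<alpha> < \<beta>\<close> by auto
  have "E (cis \<gamma>) = E (rcis r t)"
  proof (rule continuous_constant_on_closure[OF 1 _ 2])
    fix s assume "s \<in> {\<alpha><..<\<beta>}"
    then have "cis s \<in> sector \<alpha> \<beta>" "rcis r t \<in> sector \<alpha> \<beta>"
      using rt unfolding sector_def cis_rcis_eq by force+
    then show "E (cis s) = E (rcis r t)" by (rule E)
  qed
  moreover have "E (cis \<gamma>) = 0"
    using W[of 1 \<gamma>] u by (simp add: E_def cis_rcis_eq polar_point_cv)
  ultimately show ?thesis
    using W[of r t] by (simp add: E_def polar_point_cv)
qed

section \<open>Homogeneous solutions\<close>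

locale obstacles =
  fixes a1 a2 c1 c2 :: real
  assumes a12: "a1 < a2" and c12: "c1 < c2" and neg1: "a1 + c1 < 0" and pos2: "a2 + c2 > 0"
begin

abbreviation "p1 \<equiv> quadratic_obstacle a1 c1"
abbreviation "p2 \<equiv> quadratic_obstacle a2 c2"
abbreviation "m1 \<equiv> - (a1 + c1)"
abbreviation "m2 \<equiv> a2 + c2"
abbreviation "d \<equiv> (a2 - c2) - (a1 - c1)"
abbreviation "double_cone u \<equiv> double_cone_solution (2 * (a1 + c1)) (2 * (a2 + c2)) p1 p2 u"
abbreviation "solution u \<equiv> global_solution (2 * (a1 + c1)) (2 * (a2 + c2)) p1 p2 u"

lemma obstacle_gap: "p2 (pol r t) - p1 (pol r t) = r\<^sup>2 * ((m1 + m2 + d * cos (2 * t)) / 2)"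
  unfolding quadratic_obstacle_polar by (simp add: field_simps)

lemma d_less: "\<bar>d\<bar> < m1 + m2"
  using a12 c12 by auto

lemma obstacle_less: "r \<noteq> 0 \<Longrightarrow> p1 (pol r t) < p2 (pol r t)"
proof -
  assume "r \<noteq> 0"
  have "\<bar>d * cos (2 * t)\<bar> \<le> \<bar>d\<bar> * 1"
    unfolding abs_mult by (intro mult_left_mono) auto
  then have "m1 + m2 + d * cos (2 * t) > 0" using d_less by auto
  then have "r\<^sup>2 * ((m1 + m2 + d * cos (2 * t)) / 2) > 0" using \<open>r \<noteq> 0\<close> by simp
  then show ?thesis using obstacle_gap[of r t] by linarith
qed

lemma solution_gradient:
  assumes "solution u"
  obtains g where "\<And>x. GDERIV u x :> g x" "continuous_on UNIV g"
    "cgrad g holomorphic_on (cv -` {x. p1 x < u x \<and> u x < p2 x})"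
proof -
  from assms obtain g where G: "\<And>x. GDERIV u x :> g x"
    and Lip: "\<And>K. compact K \<Longrightarrow> \<exists>L. L-lipschitz_on K g"
    unfolding global_solution_def C11_loc_def by blast
  have contg: "continuous_on UNIV g"
    by (rule lipschitz_on_compacts_continuous_on[OF Lip])
  define N where "N = {x. p1 x < u x \<and> u x < p2 x}"
  have "N = {x. p1 x < u x} \<inter> {x. u x < p2 x}" by (auto simp: N_def)
  then have "open N"
    using GDERIV_continuous_on[OF G] GDERIV_continuous_on[OF quadratic_obstacle_gderiv]
    by (auto intro!: open_Int open_Collect_less)
  have "AE x in lebesgue. has_laplacian u
      (2 * (a1 + c1) * indicat_real {y. u y = p1 y} x + 2 * (a2 + c2) * indicat_real {y. u y = p2 y} x) x"
    using assms by (simp add: global_solution_def)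
  then have "AE x in lebesgue. x \<in> N \<longrightarrow> has_laplacian u 0 x"
    by eventually_elim (auto simp: N_def)
  from harmonic_gradient_holomorphic[OF G Lip \<open>open N\<close> this] G contg
  show thesis unfolding N_def by (intro that[of g]) auto
qed

end

text \<open>Contact along whole rays follows both from homogeneity and from the coincidence sets
  being halfcones, so both kinds of solution are analysed together.\<close>

locale conic_solution = obstacles +
  fixes u :: "real^2 \<Rightarrow> real"
  assumes sol: "solution u"
    and conic1: "0 < r \<Longrightarrow> u (pol r t) = p1 (pol r t) \<longleftrightarrow> u (pol 1 t) = p1 (pol 1 t)"
    and conic2: "0 < r \<Longrightarrow> u (pol r t) = p2 (pol r t) \<longleftrightarrow> u (pol 1 t) = p2 (pol 1 t)"
begin

definition D1 where "D1 t = u (pol 1 t) - p1 (pol 1 t)"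
definition D2 where "D2 t = p2 (pol 1 t) - u (pol 1 t)"

lemma between: "p1 x \<le> u x" "u x \<le> p2 x"
  using sol by (auto simp: global_solution_def)

lemma pos_iff: "0 < r \<Longrightarrow> p1 (pol r t) < u (pol r t) \<longleftrightarrow> 0 < D1 t"
  "0 < r \<Longrightarrow> u (pol r t) < p2 (pol r t) \<longleftrightarrow> 0 < D2 t"
  using conic1[of r t] conic2[of r t] between[of "pol r t"] between[of "pol 1 t"]
  by (auto simp: D1_def D2_def less_le)

lemma sector_noncoincidence:
  assumes "\<forall>s\<in>{\<alpha><..<\<beta>}. D1 s > 0 \<and> D2 s > 0"
  shows "sector \<alpha> \<beta> \<subseteq> cv -` {x. p1 x < u x \<and> u x < p2 x}"
  using assms pos_iff by (auto simp: sector_def polar_point_cv[symmetric])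

text \<open>Contact at the unit vector of an edge spreads to the whole ray, along which the gradient
  of \<open>u\<close> is that of the obstacle; \<open>solution_on_sector\<close> continues this into
  the arc.\<close>

lemma arc_formula:
  assumes pos: "\<forall>s\<in>{\<alpha><..<\<beta>}. D1 s > 0 \<and> D2 s > 0" and edge: "\<gamma> \<in> {\<alpha>, \<beta>}"
    and rt: "0 < r" "\<alpha> < t" "t < \<beta>"
  shows "D1 \<gamma> = 0 \<Longrightarrow> u (pol r t) = p1 (pol r t) + m1 * r\<^sup>2 * (sin (t - \<gamma>))\<^sup>2"
    "D2 \<gamma> = 0 \<Longrightarrow> u (pol r t) = p2 (pol r t) - m2 * r\<^sup>2 * (sin (t - \<gamma>))\<^sup>2"
proof -
  obtain g where G: "\<And>x. GDERIV u x :> g x" and contg: "continuous_on UNIV g"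
    and hol: "cgrad g holomorphic_on (cv -` {x. p1 x < u x \<and> u x < p2 x})"
    using solution_gradient[OF sol] by metis
  have hol': "cgrad g holomorphic_on sector \<alpha> \<beta>"
    using hol sector_noncoincidence[OF pos] by (rule holomorphic_on_subset)
  have lt: "\<alpha> < \<beta>" using rt by simp
  have grad: "g (pol s \<gamma>) = vector [2 * a * (s * cos \<gamma>), 2 * c * (s * sin \<gamma>)]"
    if "u (pol s \<gamma>) = quadratic_obstacle a c (pol s \<gamma>)"
      "(\<forall>y. quadratic_obstacle a c y \<le> u y) \<or> (\<forall>y. u y \<le> quadratic_obstacle a c y)" for a c s
    using GDERIV_contact[OF G quadratic_obstacle_gderiv that] by simp
  show "u (pol r t) = p1 (pol r t) + m1 * r\<^sup>2 * (sin (t - \<gamma>))\<^sup>2" if "D1 \<gamma> = 0"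
  proof -
    have z: "u (pol 1 \<gamma>) = p1 (pol 1 \<gamma>)" using that by (simp add: D1_def)
    have zr: "u (pol r \<gamma>) = p1 (pol r \<gamma>)" if "0 < r" for r
      using conic1[OF that] z by blast
    have le: "\<forall>y. p1 y \<le> u y" using between by blast
    have "u (pol r t) = p1 (pol r t) - (a1 + c1) * r\<^sup>2 * (sin (t - \<gamma>))\<^sup>2"
      by (rule solution_on_sector[OF G contg hol' lt edge z grad[OF zr disjI1[OF le]] rt])
    then show ?thesis by (simp add: algebra_simps)
  qed
  show "u (pol r t) = p2 (pol r t) - m2 * r\<^sup>2 * (sin (t - \<gamma>))\<^sup>2" if "D2 \<gamma> = 0"
  proof -
    have z: "u (pol 1 \<gamma>) = p2 (pol 1 \<gamma>)" using that by (simp add: D2_def)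
    have zr: "u (pol r \<gamma>) = p2 (pol r \<gamma>)" if "0 < r" for r
      using conic2[OF that] z by blast
    have le: "\<forall>y. u y \<le> p2 y" using between by blast
    show ?thesis
      by (rule solution_on_sector[OF G contg hol' lt edge z grad[OF zr disjI2[OF le]] rt])
  qed
qed

lemma continuous_u: "continuous_on UNIV u"
proof -
  obtain g where "\<And>x. GDERIV u x :> g x" using solution_gradient[OF sol] by metis
  then show ?thesis by (rule GDERIV_continuous_on)
qed

lemma continuous_polar_point: "continuous_on UNIV (\<lambda>t. pol r t)"
  unfolding polar_point_cv rcis_def by (intro continuous_intros)

sublocale circ: circle D1 D2 m1 m2 d
proof (unfold_locales, goal_cases)
  case 4
  have "continuous_on UNIV (\<lambda>t. u (pol 1 t))"
    by (rule continuous_on_compose2[OF continuous_u continuous_polar_point]) auto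
  then show ?case
    unfolding D1_def[abs_def] quadratic_obstacle_def polar_point_nth by (intro continuous_intros)
next
  case 5
  have "continuous_on UNIV (\<lambda>t. u (pol 1 t))"
    by (rule continuous_on_compose2[OF continuous_u continuous_polar_point]) auto
  then show ?case
    unfolding D2_def[abs_def] quadratic_obstacle_def polar_point_nth by (intro continuous_intros)
next
  case (10 t)
  show ?case using obstacle_gap[of 1 t] by (simp add: D1_def D2_def)
next
  case (11 \<alpha> t \<beta>)
  show ?case using arc_formula(1)[OF 11(4), of \<alpha> 1 t] 11 by (simp add: D1_def)
next
  case (12 \<alpha> t \<beta>)
  show ?case using arc_formula(1)[OF 12(4), of \<beta> 1 t] 12 by (simp add: D1_def)
next
  case (13 \<alpha> t \<beta>)
  show ?case using arc_formula(2)[OF 13(4), of \<alpha> 1 t] 13 by (simp add: D2_def)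
next
  case (14 \<alpha> t \<beta>)
  show ?case using arc_formula(2)[OF 14(4), of \<beta> 1 t] 14 by (simp add: D2_def)
qed (use neg1 pos2 d_less between in \<open>simp_all add: D1_def D2_def polar_point_2pi\<close>)

end

section \<open>Polynomials and halfspace solutions\<close>

lemma real_polynomial_function_nth [intro]: "real_polynomial_function (\<lambda>x :: real^'n. x $ i)"
  by (rule real_polynomial_function.intros(1)) (rule bounded_linear_vec_nth)

lemma real_polynomial_quadratic_obstacle [intro]: "real_polynomial_function (quadratic_obstacle a c)"
  unfolding quadratic_obstacle_def[abs_def] power2_eq_square by (intro real_polynomial_function.intros real_polynomial_function_nth)

lemma real_polynomial_function_square_form:
  "real_polynomial_function (\<lambda>x :: real^2. m * (x $ 2 * p - x $ 1 * q)\<^sup>2)"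
  unfolding power2_eq_square
  by (intro real_polynomial_function.intros real_polynomial_function_nth real_polynomial_function_diff)

text \<open>The gradient of a 2-homogeneous harmonic function off the origin is holomorphic and
  1-homogeneous, hence \<open>\<kappa> z\<close>.\<close>

lemma holomorphic_homogeneous_linear:
  assumes hol: "f holomorphic_on UNIV" and hom: "\<And>r z. 0 < r \<Longrightarrow> f (of_real r * z) = of_real r * f z"
  shows "f z = deriv f 0 * z"
proof -
  have f0: "f 0 = 0" using hom[of 2 0] by simp
  have "(f has_field_derivative deriv f 0) (at 0)"
    by (rule holomorphic_derivI[OF hol]) auto
  then have "((\<lambda>w. f w / w) \<longlongrightarrow> deriv f 0) (at 0)"
    by (simp add: DERIV_def f0)
  show ?thesis
  proof (cases "z = 0")
    case False
    have seq: "filterlim (\<lambda>n. of_real (inverse (real (Suc n))) * z) (at 0) sequentially"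
    proof -
      have "(\<lambda>n. of_real (inverse (real (Suc n))) * z) \<longlonglongrightarrow> of_real 0 * z"
        by (intro tendsto_intros LIMSEQ_inverse_real_of_nat)
      then show ?thesis using False by (simp add: filterlim_at del: of_nat_Suc)
    qed
    have "(\<lambda>n. f (of_real (inverse (real (Suc n))) * z) / (of_real (inverse (real (Suc n))) * z)) \<longlonglongrightarrow> deriv f 0"
      by (rule filterlim_compose[OF \<open>((\<lambda>w. f w / w) \<longlongrightarrow> deriv f 0) (at 0)\<close> seq])
    moreover have "f (of_real (inverse (real (Suc n))) * z) / (of_real (inverse (real (Suc n))) * z) = f z / z" for n
      using hom[of "inverse (real (Suc n))" z] by (simp del: of_nat_Suc)
    ultimately have "(\<lambda>n :: nat. f z / z) \<longlonglongrightarrow> deriv f 0"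
      by (simp only:)
    then have "f z / z = deriv f 0" by (simp only: LIMSEQ_const_iff)
    then show ?thesis using False by (simp add: field_simps)
  qed (simp add: f0)
qed

locale homogeneous_solution = obstacles +
  fixes u :: "real^2 \<Rightarrow> real"
  assumes hsol: "solution u" and hom: "homogeneous_deg2 u"
begin

lemma hom_polar: "0 < r \<Longrightarrow> u (pol r t) = r\<^sup>2 * u (pol 1 t)"
  using hom[unfolded homogeneous_deg2_def, rule_format, of r "pol 1 t"]
  by (simp add: scale_polar_point)

lemma obstacle_hom: "quadratic_obstacle a c (pol r t) = r\<^sup>2 * quadratic_obstacle a c (pol 1 t)"
  by (simp add: quadratic_obstacle_def power_mult_distrib algebra_simps)

sublocale conic_solution
proof (unfold_locales, goal_cases)
  case 1
  show ?case by (rule hsol)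
next
  case (2 r t)
  then show ?case unfolding hom_polar[OF 2] obstacle_hom[of _ _ r] by simp
next
  case (3 r t)
  then show ?case unfolding hom_polar[OF 3] obstacle_hom[of _ _ r] by simp
qed

lemma u_zero: "u 0 = 0"
  using between[of 0] by (simp add: quadratic_obstacle_def)

lemma u_eqI:
  assumes "\<And>t. u (pol 1 t) = v (pol 1 t)" "\<And>r t. 0 < r \<Longrightarrow> v (pol r t) = r\<^sup>2 * v (pol 1 t)" "v 0 = 0"
  shows "u = v"
proof
  fix x
  obtain r t where rt: "0 \<le> r" "x = pol r t" using polar_point_Ex by blast
  show "u x = v x"
  proof (cases "r = 0")
    case False
    then have "0 < r" using rt by simp
    show ?thesis
      unfolding rt hom_polar[OF \<open>0 < r\<close>] assms(2)[OF \<open>0 < r\<close>] assms(1) by (rule refl)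
  qed (use rt u_zero assms(3) in simp)
qed

lemma harmonic_polynomial:
  assumes "\<forall>t. D1 t > 0 \<and> D2 t > 0"
  shows "real_polynomial_function u"
proof -
  obtain g where G: "\<And>x. GDERIV u x :> g x" and contg: "continuous_on UNIV g"
    and hol: "cgrad g holomorphic_on (cv -` {x. p1 x < u x \<and> u x < p2 x})"
    using solution_gradient[OF hsol] by metis
  have "UNIV - {0} \<subseteq> cv -` {x. p1 x < u x \<and> u x < p2 x}"
  proof
    fix z :: complex assume "z \<in> UNIV - {0}"
    then have "p1 (pol (cmod z) (Arg z)) < u (pol (cmod z) (Arg z))"
      "u (pol (cmod z) (Arg z)) < p2 (pol (cmod z) (Arg z))"
      using pos_iff[of "cmod z" "Arg z"] assms by auto
    then show "z \<in> cv -` {x. p1 x < u x \<and> u x < p2 x}"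
      by (simp add: polar_point_cv rcis_cmod_Arg)
  qed
  then have hol0: "cgrad g holomorphic_on (UNIV - {0})"
    using hol holomorphic_on_subset by blast
  \<comment> \<open>The gradient is continuous at the origin, so the isolated singularity is
    removable.\<close>
  have hol: "cgrad g holomorphic_on UNIV"
    by (rule no_isolated_singularity[OF continuous_on_cgrad[OF contg] hol0 open_UNIV]) simp
  \<comment> \<open>Differentiating the homogeneity relation of \<open>u\<close> makes the gradient
    homogeneous of degree one.\<close>
  have ghom: "g (r *\<^sub>R x) = r *\<^sub>R g x" if "0 < r" for r x
  proof -
    have "((\<lambda>x. u (r *\<^sub>R x)) has_derivative (\<lambda>h. (r *\<^sub>R h) \<bullet> g (r *\<^sub>R x))) (at x)"
      using G[of "r *\<^sub>R x"] unfolding gderiv_def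
      by (rule has_derivative_compose[rotated]) (auto intro!: derivative_eq_intros)
    moreover have "((\<lambda>x. r\<^sup>2 * u x) has_derivative (\<lambda>h. r\<^sup>2 * (h \<bullet> g x))) (at x)"
      using G[of x] unfolding gderiv_def by (intro has_derivative_mult_right)
    moreover have "(\<lambda>x. u (r *\<^sub>R x)) = (\<lambda>x. r\<^sup>2 * u x)"
      using hom that by (auto simp: homogeneous_deg2_def)
    ultimately have "(\<lambda>h. (r *\<^sub>R h) \<bullet> g (r *\<^sub>R x)) = (\<lambda>h. r\<^sup>2 * (h \<bullet> g x))"
      using has_derivative_unique by metis
    then have "r * (h \<bullet> g (r *\<^sub>R x)) = r * (h \<bullet> (r *\<^sub>R g x))" for h
      by (auto simp: fun_eq_iff power2_eq_square)
    then have "h \<bullet> g (r *\<^sub>R x) = h \<bullet> (r *\<^sub>R g x)" for h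
      using that by simp
    then show ?thesis by (metis inner_commute vector_eq_rdot)
  qed
  have "cgrad g (of_real r * z) = of_real r * cgrad g z" if "0 < r" for r z
  proof -
    have "cv (of_real r * z) = r *\<^sub>R cv z" by (simp add: vec_eq_iff forall_2)
    then show ?thesis using ghom[OF that, of "cv z"] by (simp add: cgrad_def complex_eq_iff)
  qed
  then obtain \<kappa> where \<kappa>: "\<And>z. cgrad g z = \<kappa> * z"
    using holomorphic_homogeneous_linear[OF hol] by blast
  have E: "u (cv z) = Re (\<kappa> * z\<^sup>2) / 2" for z
  proof -
    have "cv 0 = 0" by (simp add: vec_eq_iff forall_2)
    then show ?thesis
      using gradient_determines_on_sector[OF G \<kappa> open_UNIV connected_UNIV UNIV_I UNIV_I, of z 0] u_zero by simp
  qed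
  have "u x = (Re \<kappa> * (x $ 1 * x $ 1 - x $ 2 * x $ 2) - Im \<kappa> * (2 * (x $ 1 * x $ 2))) / 2" for x
  proof -
    have "x = cv (Complex (x $ 1) (x $ 2))" by (simp add: cv_eq_iff)
    from arg_cong[OF this, of u] show ?thesis
      unfolding E by (simp add: power2_eq_square algebra_simps)
  qed
  then have u: "u = (\<lambda>x. (Re \<kappa> * (x $ 1 * x $ 1 - x $ 2 * x $ 2) - Im \<kappa> * (2 * (x $ 1 * x $ 2))) / 2)"
    by (rule ext)
  show ?thesis
    unfolding u by (intro real_polynomial_function_divide real_polynomial_function_diff
        real_polynomial_function.intros(2-4) real_polynomial_function_nth)
qed

lemma sin_diff_form: "r * sin (t - a) = (pol r t) $ 2 * cos a - (pol r t) $ 1 * sin a"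
  by (simp add: sin_diff algebra_simps)

text \<open>In polar coordinates \<open>r * sin (t - b)\<close> is a linear form, so such a profile
  is the trace of a quadratic polynomial on the unit circle.\<close>

lemma polynomial_perturbation:
  assumes "\<And>t. u (pol 1 t) = quadratic_obstacle a c (pol 1 t) + m * (sin (t - b))\<^sup>2"
  shows "real_polynomial_function u"
proof -
  have "u = (\<lambda>x. quadratic_obstacle a c x + m * (x $ 2 * cos b - x $ 1 * sin b)\<^sup>2)"
  proof (rule u_eqI)
    fix t show "u (pol 1 t) = quadratic_obstacle a c (pol 1 t) + m * (pol 1 t $ 2 * cos b - pol 1 t $ 1 * sin b)\<^sup>2"
      using assms[of t] sin_diff_form[of 1 t b] by simp
  next
    fix r t :: real
    show "quadratic_obstacle a c (pol r t) + m * (pol r t $ 2 * cos b - pol r t $ 1 * sin b)\<^sup>2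
      = r\<^sup>2 * (quadratic_obstacle a c (pol 1 t) + m * (pol 1 t $ 2 * cos b - pol 1 t $ 1 * sin b)\<^sup>2)"
      unfolding sin_diff_form[symmetric] obstacle_hom[of _ _ r] by (simp add: power_mult_distrib algebra_simps)
  qed (simp add: quadratic_obstacle_def)
  then show ?thesis
    using real_polynomial_function.intros(3)[OF real_polynomial_quadratic_obstacle real_polynomial_function_square_form] by simp
qed

lemma polynomial1: "(\<And>t. D1 t = m * (sin (t - b))\<^sup>2) \<Longrightarrow> real_polynomial_function u"
  by (rule polynomial_perturbation[of a1 c1 m b]) (simp add: D1_def diff_eq_eq add.commute)

lemma polynomial2: "(\<And>t. D2 t = m * (sin (t - b))\<^sup>2) \<Longrightarrow> real_polynomial_function u"
  by (rule polynomial_perturbation[of a2 c2 "- m" b]) (simp add: D2_def algebra_simps)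

lemma half_profile_positive_part:
  assumes "\<And>t. D (t + 2 * pi) = (D t :: real)"
    and "\<forall>t\<in>{a..a + pi}. D t = m * (sin (t - a))\<^sup>2" and "\<forall>t\<in>{a + pi..a + 2 * pi}. D t = 0"
  shows "D t = m * (max 0 (sin (t - a)))\<^sup>2"
proof -
  obtain k :: int where k: "a \<le> t + turns k" "t + turns k < a + 2 * pi"
    using reduce_angle by blast
  define s where "s = t + turns k"
  have "sin (t - a) = sin (t - a + turns k)"
    by (rule periodic_int[symmetric]) simp
  then have 1: "sin (t - a) = sin (s - a)" by (simp add: s_def algebra_simps)
  have 2: "D t = D s" using periodic_int[of D, OF assms(1)] by (simp add: s_def)
  show ?thesis
  proof (cases "s \<le> a + pi")
    case True
    then have "sin (s - a) \<ge> 0" using k by (intro sin_ge_zero) (auto simp: s_def)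
    then show ?thesis using 1 2 assms(2) True k by (auto simp: s_def max_def)
  next
    case False
    then have "sin (s - a - pi) \<ge> 0" using k by (intro sin_ge_zero) (auto simp: s_def)
    then have "sin (s - a) \<le> 0" by (simp add: sin_diff)
    then show ?thesis using 1 2 assms(3) False k by (auto simp: s_def max_def)
  qed
qed

lemma norm_polar_point_1: "norm (pol 1 t) = 1"
  by (simp add: norm_polar_point)

lemma max_mult: "0 < r \<Longrightarrow> max 0 (r * s) = r * max 0 (s :: real)"
  using max_mult_distrib_left[of r 0 s] by simp

lemma positive_part_perturbation:
  assumes "\<And>t. u (pol 1 t) = quadratic_obstacle a c (pol 1 t) + m * (max 0 (sin (t - b)))\<^sup>2"
  shows "u x = quadratic_obstacle a c x + m * (max 0 (x \<bullet> pol 1 (b + pi / 2)))\<^sup>2"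
proof -
  let ?e = "pol 1 (b + pi / 2)"
  have "u = (\<lambda>x. quadratic_obstacle a c x + m * (max 0 (x \<bullet> ?e))\<^sup>2)"
  proof (rule u_eqI)
    fix t show "u (pol 1 t) = quadratic_obstacle a c (pol 1 t) + m * (max 0 (pol 1 t \<bullet> ?e))\<^sup>2"
      using assms[of t] unfolding inner_polar_point_normal by simp
  next
    fix r t :: real assume "0 < r"
    then show "quadratic_obstacle a c (pol r t) + m * (max 0 (pol r t \<bullet> ?e))\<^sup>2
      = r\<^sup>2 * (quadratic_obstacle a c (pol 1 t) + m * (max 0 (pol 1 t \<bullet> ?e))\<^sup>2)"
      unfolding inner_polar_point_normal obstacle_hom[of _ _ r] by (simp add: max_mult power_mult_distrib algebra_simps)
  qed (simp add: quadratic_obstacle_def)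
  then show ?thesis by (rule fun_cong)
qed

lemma halfspace1:
  assumes "circ.half_profile"
  shows "halfspace_solution1 (2 * (a1 + c1)) p1 p2 u"
proof -
  obtain a where a: "\<forall>t\<in>{a..a + pi}. D1 t = m1 * (sin (t - a))\<^sup>2" "\<forall>t\<in>{a + pi..a + 2 * pi}. D1 t = 0"
    using assms unfolding circ.half_profile_def by blast
  have "D1 t = m1 * (max 0 (sin (t - a)))\<^sup>2" for t
    by (rule half_profile_positive_part[OF circ.per1 a])
  then have "u x = p1 x + m1 * (max 0 (x \<bullet> pol 1 (a + pi / 2)))\<^sup>2" for x
    by (intro positive_part_perturbation) (simp add: D1_def diff_eq_eq add.commute)
  then have "u x - p1 x = - (2 * (a1 + c1) / 2) * (max 0 (x \<bullet> pol 1 (a + pi / 2)))\<^sup>2" for x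
    by (metis add_diff_cancel_left' nonzero_mult_div_cancel_left zero_neq_numeral)
  then show ?thesis
    unfolding halfspace_solution1_def using between norm_polar_point_1 by blast
qed

lemma halfspace2:
  assumes "circle.half_profile D2 m2"
  shows "halfspace_solution2 (2 * (a2 + c2)) p1 p2 u"
proof -
  interpret sw: circle D2 D1 m2 m1 d by (rule circ.swapped)
  obtain a where a: "\<forall>t\<in>{a..a + pi}. D2 t = m2 * (sin (t - a))\<^sup>2" "\<forall>t\<in>{a + pi..a + 2 * pi}. D2 t = 0"
    using assms unfolding sw.half_profile_def by blast
  have "D2 t = m2 * (max 0 (sin (t - a)))\<^sup>2" for t
    by (rule half_profile_positive_part[OF circ.per2 a])
  then have u: "u x = p2 x + - m2 * (max 0 (x \<bullet> pol 1 (a + pi / 2)))\<^sup>2" for x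
    by (intro positive_part_perturbation) (simp add: D2_def algebra_simps)
  have "p2 x - u x = (2 * (a2 + c2) / 2) * (max 0 (x \<bullet> pol 1 (a + pi / 2)))\<^sup>2" for x
    using u[of x] by (simp add: algebra_simps)
  then show ?thesis
    unfolding halfspace_solution2_def using between norm_polar_point_1 by blast
qed

lemma coincidence_halfcone:
  assumes "\<And>r t. 0 < r \<Longrightarrow> u (pol r t) = p (pol r t) \<longleftrightarrow> D t = 0" "u 0 = p 0"
    and per: "\<And>t. D (t + 2 * pi) = (D t :: real)"
    and lt: "a < b" "b - a < pi" and z: "\<forall>t\<in>{a..b}. D t = 0" and nz: "\<forall>t\<in>{b<..<a + 2 * pi}. D t \<noteq> 0"
  shows "halfcone {x. u x = p x}"
  unfolding halfcone_def
proof (intro exI conjI set_eqI iffI)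
  fix x assume x: "x \<in> {x. u x = p x}"
  obtain r t where rt: "0 \<le> r" "x = pol r t" using polar_point_Ex by blast
  show "x \<in> {pol r t | r t. 0 \<le> r \<and> a \<le> t \<and> t \<le> b}"
  proof (cases "r = 0")
    case True
    then have "x = pol 0 a" using rt by simp
    then show ?thesis using lt by (intro CollectI exI[of _ 0] exI[of _ a]) auto
  next
    case False
    obtain k :: int where k: "a \<le> t + turns k" "t + turns k < a + 2 * pi"
      using reduce_angle by blast
    have "D (t + turns k) = 0"
      using periodic_int[of D, OF per] assms(1)[of r t] x rt False by simp
    then have "t + turns k \<le> b" using nz k by force
    moreover have "pol r (t + turns k) = pol r t"
    proof -
      have "cos (t + turns k) = cos t" "sin (t + turns k) = sin t"
        by (rule periodic_int; simp)+
      then show ?thesis by (simp add: vec_eq_iff forall_2)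
    qed
    ultimately show ?thesis using rt k by (intro CollectI exI[of _ r] exI[of _ "t + turns k"]) auto
  qed
next
  fix x assume "x \<in> {pol r t | r t. 0 \<le> r \<and> a \<le> t \<and> t \<le> b}"
  then obtain r t where "0 \<le> r" "x = pol r t" "a \<le> t" "t \<le> b" by blast
  then show "x \<in> {x. u x = p x}"
    using assms(1)[of r t] assms(2) z by (cases "r = 0") auto
qed (use lt in auto)

text \<open>Every profile other than the cone is of an excluded type: no contact off the origin or a
  full squared sine gives a polynomial, permanent contact makes \<open>u\<close> an obstacle, and
  the half profiles are halfspace solutions.\<close>

lemma classification:
  assumes "\<not> real_polynomial_function u" "\<not> halfspace_solution1 (2 * (a1 + c1)) p1 p2 u"
    "\<not> halfspace_solution2 (2 * (a2 + c2)) p1 p2 u"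
  shows "double_cone u"
proof -
  interpret sw: circle D2 D1 m2 m1 d by (rule circ.swapped)
  have np: "\<not> circ.poly_profile" "\<not> sw.poly_profile"
    using polynomial1 polynomial2 assms(1) unfolding circ.poly_profile_def sw.poly_profile_def by blast+
  have nz: "\<not> (\<forall>t. D1 t = 0)" "\<not> (\<forall>t. D2 t = 0)"
    using polynomial1[of 0 0] polynomial2[of 0 0] assms(1) by auto
  obtain a b b' a' where "circ.cone_profile a b b' a'"
    using circ.profile_cases np nz harmonic_polynomial halfspace1 halfspace2 assms by metis
  then have *: "a < b" "b < b'" "b' < a'" "a' < a + 2 * pi" "b' - b < pi" "a + 2 * pi - a' < pi"
    and z: "\<forall>t\<in>{a'..a + 2 * pi}. D1 t = 0" "\<forall>t\<in>{b..b'}. D2 t = 0"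
    and pos: "\<forall>t\<in>{a<..<b} \<union> {b'<..<a'}. D1 t > 0 \<and> D2 t > 0"
    unfolding circ.cone_profile_def by blast+
  have D2pos: "D1 t \<noteq> 0" if "D2 t = 0" for t
    using that circ.gap_pos[of t] by auto
  have n1: "D1 t \<noteq> 0" if "t \<in> {a + 2 * pi<..<a' + 2 * pi}" for t
  proof -
    have "D1 (t - 2 * pi) \<noteq> 0"
    proof (cases "t - 2 * pi \<in> {b..b'}")
      case True then show ?thesis using z D2pos by blast
    next
      case False
      then have "t - 2 * pi \<in> {a<..<b} \<union> {b'<..<a'}" using that by auto
      then show ?thesis using pos by force
    qed
    then show ?thesis using circ.per1[of "t - 2 * pi"] by simp
  qed
  have n2: "D2 t \<noteq> 0" if tt: "t \<in> {b'<..<b + 2 * pi}" for t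
  proof -
    consider "t \<in> {b'<..<a'}" | "t \<in> {a'..a + 2 * pi}" | "t - 2 * pi \<in> {a<..<b}"
      using tt by force
    then show ?thesis
    proof cases
      case 1 then show ?thesis using pos by force
    next
      case 2 then show ?thesis using z D2pos by blast
    next
      case 3
      then have "D2 (t - 2 * pi) \<noteq> 0" using pos by force
      then show ?thesis using circ.per2[of "t - 2 * pi"] by simp
    qed
  qed
  have k1: "u (pol r t) = p1 (pol r t) \<longleftrightarrow> D1 t = 0" if "0 < r" for r t
    using conic1[OF that, of t] unfolding D1_def by auto
  have k2: "u (pol r t) = p2 (pol r t) \<longleftrightarrow> D2 t = 0" if "0 < r" for r t
    using conic2[OF that, of t] unfolding D2_def by auto
  have p0: "u 0 = p1 0" "u 0 = p2 0" by (simp_all add: u_zero quadratic_obstacle_def)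
  have "halfcone {x. u x = p1 x}"
    by (rule coincidence_halfcone[OF k1 p0(1) circ.per1 *(4,6) z(1)]) (assumption | intro ballI n1)+
  moreover have "halfcone {x. u x = p2 x}"
    by (rule coincidence_halfcone[OF k2 p0(2) circ.per2 *(2,5) z(2)]) (assumption | intro ballI n2)+
  ultimately show ?thesis
    unfolding double_cone_solution_def using hsol by blast
qed

end

section \<open>Construction of double cones\<close>

definition quad_form :: "real \<Rightarrow> real \<Rightarrow> real \<Rightarrow> real^2 \<Rightarrow> real" where
  "quad_form A B C x = A * (x $ 1)\<^sup>2 + 2 * B * (x $ 1 * x $ 2) + C * (x $ 2)\<^sup>2"

definition quad_grad :: "real \<Rightarrow> real \<Rightarrow> real \<Rightarrow> real^2 \<Rightarrow> real^2" where
  "quad_grad A B C x = vector [2 * (A * x $ 1 + B * x $ 2), 2 * (B * x $ 1 + C * x $ 2)]"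

lemma quad_grad_nth [simp]:
  "quad_grad A B C x $ 1 = 2 * (A * x $ 1 + B * x $ 2)" "quad_grad A B C x $ 2 = 2 * (B * x $ 1 + C * x $ 2)"
  by (simp_all add: quad_grad_def)

lemma GDERIV_quad_form: "GDERIV (quad_form A B C) y :> quad_grad A B C y"
  unfolding gderiv_def quad_form_def[abs_def]
  by (auto intro!: derivative_eq_intros bounded_linear.has_derivative[OF bounded_linear_vec_nth]
      simp: inner_real2 algebra_simps)

lemma bounded_linear_quad_grad: "bounded_linear (quad_grad A B C)"
  by (rule linear_conv_bounded_linear[THEN iffD1], rule linearI) (auto simp: vec_eq_iff forall_2 algebra_simps)

lemma has_laplacian_quad_form: "has_laplacian (quad_form A B C) (2 * (A + C)) x"
  unfolding has_laplacian_def trace_real2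
  by (intro exI[of _ "quad_grad A B C"] conjI always_eventually allI GDERIV_quad_form
      bounded_linear_imp_has_derivative bounded_linear_quad_grad) (simp add: axis_def algebra_simps)

lemma has_laplacian_transform:
  assumes "has_laplacian v L x" "open T" "x \<in> T" "\<And>y. y \<in> T \<Longrightarrow> u y = v y"
  shows "has_laplacian u L x"
proof -
  obtain g H where g: "\<forall>\<^sub>F y in nhds x. GDERIV v y :> g y" and H: "(g has_derivative H) (at x)" "(\<Sum>b\<in>Basis. H b \<bullet> b) = L"
    using assms(1) unfolding has_laplacian_def by blast
  have "\<forall>\<^sub>F y in nhds x. y \<in> T" using assms(2,3) by (rule eventually_nhds_in_open)
  with g have "\<forall>\<^sub>F y in nhds x. GDERIV u y :> g y"
  proof eventually_elim
    case (elim y)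
    then show ?case
      unfolding gderiv_def using has_derivative_transform_within_open[OF _ assms(2)] assms(4) by metis
  qed
  with H show ?thesis unfolding has_laplacian_def by blast
qed

text \<open>Differentiability is tested piece by piece. A piece that does not contain
  \<open>x\<close> contributes the trivial filter, because it is closed.\<close>

lemma has_derivative_closed_Union:
  assumes "finite I" "\<And>i. i \<in> I \<Longrightarrow> closed (A i)" "bounded_linear D"
    and "\<And>i. i \<in> I \<Longrightarrow> x \<in> A i \<Longrightarrow> (f has_derivative D) (at x within A i)"
  shows "(f has_derivative D) (at x within (\<Union>i\<in>I. A i))"
  using assms
proof (induction I rule: finite_induct)
  case empty
  then show ?case unfolding has_derivative_within by simp
next
  case (insert i I)
  have 1: "(f has_derivative D) (at x within A i)"
  proof (cases "x \<in> A i")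
    case True then show ?thesis using insert by simp
  next
    case False
    then have "at x within A i = bot"
      using insert.prems(1)[of i] not_in_closure_trivial_limitI[of x "A i"]
      by (simp add: closure_closed)
    then show ?thesis using insert.prems(2) unfolding has_derivative_within by simp
  qed
  have 2: "(f has_derivative D) (at x within (\<Union>i\<in>I. A i))"
    using insert by simp
  show ?case
    using 1 2 unfolding UN_insert has_derivative_within by (auto simp: at_within_union intro: filterlim_sup)
qed

text \<open>A common \<open>u\<close> and a common \<open>g\<close> encode that the values and
  gradients of the forms agree where pieces overlap. A Lipschitz constant shared by the finitely
  many linear gradients then works on the whole plane.\<close>

lemma glued_quadratic_forms_C11:
  fixes A :: "'i \<Rightarrow> (real^2) set" and xx xy yy :: "'i \<Rightarrow> real"
  assumes I: "finite I" "(\<Union>i\<in>I. A i) = UNIV" and cl: "\<And>i. i \<in> I \<Longrightarrow> closed (A i)"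
    and u: "\<And>i x. i \<in> I \<Longrightarrow> x \<in> A i \<Longrightarrow> u x = quad_form (xx i) (xy i) (yy i) x"
    and g: "\<And>i x. i \<in> I \<Longrightarrow> x \<in> A i \<Longrightarrow> g x = quad_grad (xx i) (xy i) (yy i) x"
  shows "C11_loc u"
proof -
  have G: "GDERIV u x :> g x" for x
  proof -
    have "(u has_derivative (\<lambda>h. h \<bullet> g x)) (at x within (\<Union>i\<in>I. A i))"
    proof (rule has_derivative_closed_Union[OF I(1) cl])
      fix i assume i: "i \<in> I" "x \<in> A i"
      have q: "(quad_form (xx i) (xy i) (yy i) has_derivative (\<lambda>h. h \<bullet> g x)) (at x within A i)"
        using GDERIV_quad_form unfolding gderiv_def g[OF i] by (rule has_derivative_at_withinI)
      show "(u has_derivative (\<lambda>h. h \<bullet> g x)) (at x within A i)"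
        by (rule has_derivative_transform[OF i(2) u[OF i(1)] q])
    qed (auto intro: bounded_linear_inner_left)
    then show ?thesis by (simp add: gderiv_def I(2))
  qed
  have "\<exists>K. \<forall>i\<in>I. K-lipschitz_on UNIV (quad_grad (xx i) (xy i) (yy i))"
    using I(1)
  proof (induction I rule: finite_induct)
    case (insert i I)
    then obtain K where K: "\<forall>i\<in>I. K-lipschitz_on UNIV (quad_grad (xx i) (xy i) (yy i))" by auto
    obtain K' where K': "K'-lipschitz_on UNIV (quad_grad (xx i) (xy i) (yy i))"
      using bounded_linear.lipschitz_boundE[OF bounded_linear_quad_grad] by metis
    show ?case
      using K K' by (intro exI[of _ "max K K'"]) (auto intro: lipschitz_on_mono)
  qed auto
  then obtain K where K: "\<And>i. i \<in> I \<Longrightarrow> K-lipschitz_on UNIV (quad_grad (xx i) (xy i) (yy i))" by blast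
  have "I \<noteq> {}" using I(2) by auto
  then have K0: "K \<ge> 0" using K lipschitz_on_nonneg by blast
  have L: "K-lipschitz_on UNIV g"
  proof (rule lipschitz_onI[OF _ K0])
    fix x y :: "real^2"
    \<comment> \<open>Along the segment from \<open>x\<close> to \<open>y\<close> the preimages of
      the pieces form a finite closed cover of the parameter interval, which lets the Lipschitz
      bounds of the pieces be chained.\<close>
    define pt where "pt s = x + s *\<^sub>R (y - x)" for s
    have cont: "continuous_on UNIV pt" unfolding pt_def by (intro continuous_intros)
    have dpt: "dist (pt s) (pt t) = dist x y * dist s t" for s t
    proof -
      have "pt s - pt t = (s - t) *\<^sub>R (y - x)" by (simp add: pt_def algebra_simps)
      then show ?thesis by (simp add: dist_norm norm_minus_commute)
    qed
    have "(K * dist x y)-lipschitz_on {0..1} (\<lambda>s. g (pt s))"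
    proof (rule lipschitz_on_closed_Union[OF _ _ I(1)])
      show "closed {s. pt s \<in> A i}" if "i \<in> I" for i
        using closed_vimage[OF cl[OF that] cont] by (simp add: vimage_def)
      show "(K * dist x y)-lipschitz_on {s. pt s \<in> A i} (\<lambda>s. g (pt s))" if i: "i \<in> I" for i
      proof (rule lipschitz_onI)
        fix s t assume "s \<in> {s. pt s \<in> A i}" "t \<in> {s. pt s \<in> A i}"
        then show "dist (g (pt s)) (g (pt t)) \<le> K * dist x y * dist s t"
          using lipschitz_onD[OF K[OF i], of "pt s" "pt t"] g[OF i] by (simp add: dpt mult.assoc)
      qed (use K0 in simp)
      show "{0..1} \<subseteq> (\<Union>i\<in>I. {s. pt s \<in> A i})" using I(2) by auto
    qed (use K0 in simp)
    from lipschitz_onD[OF this, of 0 1] show "dist (g x) (g y) \<le> K * dist x y"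
      by (simp add: pt_def)
  qed
  show ?thesis
    unfolding C11_loc_def using G lipschitz_on_subset[OF L] by blast
qed

text \<open>The complement of the other closed pieces is an open set on which \<open>u\<close> is a
  single quadratic form.\<close>

lemma glued_quadratic_forms_laplacian:
  fixes A :: "'i \<Rightarrow> (real^2) set" and xx xy yy :: "'i \<Rightarrow> real"
  assumes I: "finite I" "(\<Union>i\<in>I. A i) = UNIV" and cl: "\<And>i. i \<in> I \<Longrightarrow> closed (A i)"
    and u: "\<And>i x. i \<in> I \<Longrightarrow> x \<in> A i \<Longrightarrow> u x = quad_form (xx i) (xy i) (yy i) x"
    and i: "i \<in> I" and x: "\<And>j. j \<in> I \<Longrightarrow> j \<noteq> i \<Longrightarrow> x \<notin> A j"
  shows "has_laplacian u (2 * (xx i + yy i)) x"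
proof (rule has_laplacian_transform[OF has_laplacian_quad_form])
  show "open (- (\<Union>j\<in>I - {i}. A j))" using I(1) cl by (intro open_Compl closed_UN) auto
  show "x \<in> - (\<Union>j\<in>I - {i}. A j)" using x by auto
  show "u y = quad_form (xx i) (xy i) (yy i) y" if "y \<in> - (\<Union>j\<in>I - {i}. A j)" for y
  proof (rule u[OF i])
    have "y \<in> (\<Union>j\<in>I. A j)" using I(2) by simp
    then show "y \<in> A i" using that by auto
  qed
qed

section \<open>Closed sectors and polar windows\<close>

definition closed_sector :: "real \<Rightarrow> real \<Rightarrow> (real^2) set" where
  "closed_sector a b = {pol r t | r t. 0 \<le> r \<and> a \<le> t \<and> t \<le> b}"

text \<open>The sector is the projection of the closed relation \<open>x = pol (norm x) t\<close>
  along a compact parameter interval.\<close>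

lemma closed_closed_sector: "closed (closed_sector a b)"
proof -
  define T where "T = {(t, x). x = pol (norm x) t}"
  have "continuous_on UNIV (\<lambda>p :: real \<times> (real^2). pol (norm (snd p)) (fst p))"
    unfolding polar_point_cv rcis_def by (intro continuous_intros)
  then have "closed {p :: real \<times> (real^2). snd p = pol (norm (snd p)) (fst p)}"
    by (intro closed_Collect_eq continuous_intros)
  also have "{p :: real \<times> (real^2). snd p = pol (norm (snd p)) (fst p)} = T"
    by (auto simp: T_def)
  finally have "closed {x. \<exists>t. t \<in> {a..b} \<and> (t, x) \<in> T}"
    by (rule closed_compact_projection[OF compact_Icc])
  also have "{x. \<exists>t. t \<in> {a..b} \<and> (t, x) \<in> T} = closed_sector a b"
  proof (intro set_eqI iffI)
    fix x assume "x \<in> {x. \<exists>t. t \<in> {a..b} \<and> (t, x) \<in> T}"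
    then obtain t where "a \<le> t" "t \<le> b" "x = pol (norm x) t" by (auto simp: T_def)
    then show "x \<in> closed_sector a b" unfolding closed_sector_def using norm_ge_zero by blast
  next
    fix x assume "x \<in> closed_sector a b"
    then obtain r t where "0 \<le> r" "a \<le> t" "t \<le> b" "x = pol r t"
      unfolding closed_sector_def by blast
    then show "x \<in> {x. \<exists>t. t \<in> {a..b} \<and> (t, x) \<in> T}"
      by (auto simp: T_def norm_polar_point intro!: exI[of _ t])
  qed
  finally show ?thesis .
qed

lemma polar_point_eqD:
  assumes eq: "pol r (c + w) = pol r' (c + w')" and nn: "0 \<le> r" "0 \<le> r'"
    and w: "\<bar>w\<bar> \<le> pi" "\<bar>w'\<bar> \<le> pi"
  shows "r = r'" "r = 0 \<or> w = w' \<or> w = pi \<and> w' = - pi \<or> w = - pi \<and> w' = pi"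
proof -
  show r: "r = r'"
    using arg_cong[OF eq, of norm] nn by (simp add: norm_polar_point)
  show "r = 0 \<or> w = w' \<or> w = pi \<and> w' = - pi \<or> w = - pi \<and> w' = pi"
  proof (cases "r = 0")
    case False
    have "r * cos (c + w) = r * cos (c + w')" "r * sin (c + w) = r * sin (c + w')"
      using r polar_point_nth(1)[of r "c + w"] polar_point_nth(2)[of r "c + w"] unfolding eq by auto
    then have "cos (c + w) = cos (c + w')" "sin (c + w) = sin (c + w')" using False by auto
    then have "cos ((c + w) - (c + w')) = 1"
      by (simp only: cos_diff) (metis sin_cos_squared_add3)
    then obtain n :: int where n: "w - w' = of_int n * 2 * pi"
      unfolding cos_one_2pi_int by auto
    have "\<bar>of_int n * 2 * pi\<bar> \<le> 2 * pi" using n w by linarith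
    then have "\<bar>real_of_int n\<bar> \<le> 1" by (simp add: abs_mult)
    then have "n = 0 \<or> n = 1 \<or> n = -1" by linarith
    then show ?thesis using n w by auto
  qed simp
qed

lemma polar_point_window: "\<exists>r w. 0 \<le> r \<and> - pi \<le> w \<and> w \<le> pi \<and> x = pol r (c + w)"
proof -
  obtain r t where rt: "0 \<le> r" "x = pol r t" using polar_point_Ex by blast
  obtain k :: int where k: "- pi \<le> (t - c) + turns k" "(t - c) + turns k < - pi + 2 * pi"
    using reduce_angle by blast
  have "cos (t + turns k) = cos t" "sin (t + turns k) = sin t"
    by (rule periodic_int; simp)+
  then have "pol r (c + ((t - c) + turns k)) = x"
    using rt by (simp add: vec_eq_iff forall_2 add.commute add.left_commute)
  then show ?thesis using rt k by (intro exI[of _ r] exI[of _ "(t - c) + turns k"]) auto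
qed

section \<open>The explicit double cone\<close>

context obstacles
begin

text \<open>The double cone with axis direction \<open>c\<close>: \<open>{u = p2}\<close> consists of the angles at distance at most
  \<open>s\<close> from \<open>c\<close>, and \<open>{u = p1}\<close> of those at distance at least \<open>q\<close>.\<close>

definition admissible :: "real \<Rightarrow> real \<Rightarrow> real \<Rightarrow> bool" where
  "admissible c s q \<longleftrightarrow> 0 < s \<and> s < pi / 2 \<and> pi / 2 < q \<and> q < pi \<and>
     matching m1 m2 d (c - q) (c - s) \<and> matching m1 m2 d (c + q) (c + s)"

text \<open>In the wedges only the formula from the edge \<open>q\<close> is written down; the
  matching relations make it coincide with the one from the edge \<open>s\<close>. The absolute
  value treats both wedges at once.\<close>

definition cone_value :: "real \<Rightarrow> real \<Rightarrow> real \<Rightarrow> real \<Rightarrow> real \<Rightarrow> real" where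
  "cone_value c s q r w = (let x = pol r (c + w) in
     if \<bar>w\<bar> \<le> s then p2 x else if q \<le> \<bar>w\<bar> then p1 x else p1 x + m1 * r\<^sup>2 * (sin (\<bar>w\<bar> - q))\<^sup>2)"

definition is_cone :: "real \<Rightarrow> real \<Rightarrow> real \<Rightarrow> (real^2 \<Rightarrow> real) \<Rightarrow> bool" where
  "is_cone c s q u \<longleftrightarrow> (\<forall>r w. 0 \<le> r \<longrightarrow> \<bar>w\<bar> \<le> pi \<longrightarrow> u (pol r (c + w)) = cone_value c s q r w)"

text \<open>The converse of \<open>arc_match_aux\<close>: the matching relation makes the two
  squared sines add up to the gap between the obstacles, so the continuation from a
  \<open>p1\<close> edge and the one from a \<open>p2\<close> edge are the same function.\<close>

lemma match_gap:
  assumes "matching m1 m2 d a b"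
  shows "p1 (pol r t) + m1 * r\<^sup>2 * (sin (t - a))\<^sup>2 = p2 (pol r t) - m2 * r\<^sup>2 * (sin (t - b))\<^sup>2"
proof -
  have e: "(sin (t - x))\<^sup>2 = (1 - (cos (2 * t) * cos (2 * x) + sin (2 * t) * sin (2 * x))) / 2" for x
    using cos_double_sin[of "t - x"] by (simp add: cos_diff algebra_simps)
  have "m1 * cos (2 * a) + m2 * cos (2 * b) = - d" "m1 * sin (2 * a) + m2 * sin (2 * b) = 0"
    using assms by (auto simp: matching_def)
  then have "cos (2 * t) * (m1 * cos (2 * a) + m2 * cos (2 * b)) + sin (2 * t) * (m1 * sin (2 * a) + m2 * sin (2 * b))
      = cos (2 * t) * (- d)"
    by simp
  then have "m1 * (sin (t - a))\<^sup>2 + m2 * (sin (t - b))\<^sup>2 = (m1 + m2 + d * cos (2 * t)) / 2"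
    unfolding e by (simp add: field_simps)
  then have "r\<^sup>2 * (m1 * (sin (t - a))\<^sup>2 + m2 * (sin (t - b))\<^sup>2) = p2 (pol r t) - p1 (pol r t)"
    unfolding obstacle_gap by simp
  then show ?thesis by (simp add: algebra_simps)
qed

text \<open>Inside a wedge \<open>u\<close> exceeds \<open>p1\<close> by a positive multiple of one
  squared sine and falls short of \<open>p2\<close> by a positive multiple of another. Both angles
  are nonzero and below \<open>pi\<close> in modulus, so neither sine vanishes.\<close>

lemma is_cone_between:
  assumes adm: "admissible c s q" and u: "is_cone c s q u" and r: "0 < r" and w: "\<bar>w\<bar> \<le> pi"
  shows "p1 (pol r (c + w)) \<le> u (pol r (c + w))" "u (pol r (c + w)) \<le> p2 (pol r (c + w))"
    "u (pol r (c + w)) = p1 (pol r (c + w)) \<longleftrightarrow> q \<le> \<bar>w\<bar>"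
    "u (pol r (c + w)) = p2 (pol r (c + w)) \<longleftrightarrow> \<bar>w\<bar> \<le> s"
proof -
  let ?x = "pol r (c + w)"
  have A: "0 < s" "s < pi / 2" "pi / 2 < q" "q < pi"
    and M: "matching m1 m2 d (c - q) (c - s)" "matching m1 m2 d (c + q) (c + s)"
    using adm by (auto simp: admissible_def)
  have less: "p1 ?x < p2 ?x" using obstacle_less[of r] r by simp
  have m: "m1 > 0" "m2 > 0" using neg1 pos2 by auto
  have u': "u ?x = (if \<bar>w\<bar> \<le> s then p2 ?x else if q \<le> \<bar>w\<bar> then p1 ?x else p1 ?x + m1 * r\<^sup>2 * (sin (\<bar>w\<bar> - q))\<^sup>2)"
    using u r w unfolding is_cone_def by (simp add: cone_value_def)
  consider "\<bar>w\<bar> \<le> s" | "q \<le> \<bar>w\<bar>" | "s < \<bar>w\<bar>" "\<bar>w\<bar> < q" by linarith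
  then have "p1 ?x \<le> u ?x \<and> u ?x \<le> p2 ?x \<and> (u ?x = p1 ?x \<longleftrightarrow> q \<le> \<bar>w\<bar>) \<and> (u ?x = p2 ?x \<longleftrightarrow> \<bar>w\<bar> \<le> s)"
  proof cases
    case 1
    then show ?thesis using u' less A by auto
  next
    case 2
    then show ?thesis using u' less A by auto
  next
    case 3
    have "u ?x = p1 ?x + m1 * r\<^sup>2 * (sin (\<bar>w\<bar> - q))\<^sup>2" using u' 3 by simp
    moreover have "p1 ?x + m1 * r\<^sup>2 * (sin (\<bar>w\<bar> - q))\<^sup>2 = p2 ?x - m2 * r\<^sup>2 * (sin (\<bar>w\<bar> - s))\<^sup>2"
    proof (cases "0 \<le> w")
      case True
      then show ?thesis using match_gap[OF M(2), of r "c + w"] by (simp add: algebra_simps)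
    next
      case False
      have "(sin (\<bar>w\<bar> - x))\<^sup>2 = (sin (w + x))\<^sup>2" for x
        using False sin_minus[of "w + x"] by (simp add: algebra_simps)
      then show ?thesis using match_gap[OF M(1), of r "c + w"] by (simp add: algebra_simps)
    qed
    moreover have "sin (\<bar>w\<bar> - q) < 0"
      using sin_gt_zero[of "q - \<bar>w\<bar>"] 3 A sin_minus[of "q - \<bar>w\<bar>"] by auto
    moreover have "sin (\<bar>w\<bar> - s) > 0" using 3 A by (intro sin_gt_zero) auto
    moreover have "0 < m * r\<^sup>2 * s\<^sup>2" if "m > 0" "s \<noteq> 0" for m s :: real
      using r that by simp
    ultimately have "m1 * r\<^sup>2 * (sin (\<bar>w\<bar> - q))\<^sup>2 > 0" "m2 * r\<^sup>2 * (sin (\<bar>w\<bar> - s))\<^sup>2 > 0"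
      "u ?x = p1 ?x + m1 * r\<^sup>2 * (sin (\<bar>w\<bar> - q))\<^sup>2" "u ?x = p2 ?x - m2 * r\<^sup>2 * (sin (\<bar>w\<bar> - s))\<^sup>2"
      using m by (metis less_irrefl)+
    then have "u ?x > p1 ?x" "u ?x < p2 ?x"
      by linarith+
    then show ?thesis using 3 by auto
  qed
  then show "p1 ?x \<le> u ?x" "u ?x \<le> p2 ?x" "u ?x = p1 ?x \<longleftrightarrow> q \<le> \<bar>w\<bar>" "u ?x = p2 ?x \<longleftrightarrow> \<bar>w\<bar> \<le> s"
    by blast+
qed

lemma is_cone_zero:
  assumes "is_cone c s q u"
  shows "u 0 = 0"
  using assms[unfolded is_cone_def, rule_format, of 0 0] by (simp add: cone_value_def quadratic_obstacle_def)

lemma is_cone_coincidence: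
  assumes adm: "admissible c s q" and u: "is_cone c s q u"
  shows "{x. u x = p2 x} = closed_sector (c - s) (c + s)"
    "{x. u x = p1 x} = closed_sector (c + q) (c + 2 * pi - q)"
proof -
  have A: "0 < s" "s < pi / 2" "pi / 2 < q" "q < pi"
    using adm by (auto simp: admissible_def)
  note iff = is_cone_between(3,4)[OF adm u]
  have zero: "0 \<in> closed_sector a b" if "a \<le> b" for a b
  proof -
    have "0 = pol 0 a" by simp
    then show ?thesis unfolding closed_sector_def using that by blast
  qed
  have z: "u 0 = p1 0" "u 0 = p2 0" using is_cone_zero[OF u] by (simp_all add: quadratic_obstacle_def)
  show "{x. u x = p2 x} = closed_sector (c - s) (c + s)"
  proof (intro set_eqI iffI)
    fix x assume x: "x \<in> {x. u x = p2 x}"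
    obtain r w where rw: "0 \<le> r" "- pi \<le> w" "w \<le> pi" "x = pol r (c + w)"
      using polar_point_window[of x c] by blast
    show "x \<in> closed_sector (c - s) (c + s)"
    proof (cases "r = 0")
      case True then show ?thesis using rw zero A by simp
    next
      case False
      then have "\<bar>w\<bar> \<le> s" using iff(2)[of r w] x rw by auto
      then show ?thesis unfolding closed_sector_def using rw by force
    qed
  next
    fix x assume "x \<in> closed_sector (c - s) (c + s)"
    then obtain r t where rt: "0 \<le> r" "c - s \<le> t" "t \<le> c + s" "x = pol r t"
      unfolding closed_sector_def by blast
    show "x \<in> {x. u x = p2 x}"
      using iff(2)[of r "t - c"] rt z A by (cases "r = 0") auto
  qed
  show "{x. u x = p1 x} = closed_sector (c + q) (c + 2 * pi - q)"
  proof (intro set_eqI iffI)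
    fix x assume x: "x \<in> {x. u x = p1 x}"
    obtain r w where rw: "0 \<le> r" "- pi \<le> w" "w \<le> pi" "x = pol r (c + w)"
      using polar_point_window[of x c] by blast
    show "x \<in> closed_sector (c + q) (c + 2 * pi - q)"
    proof (cases "r = 0")
      case True then show ?thesis using rw zero A by simp
    next
      case False
      then have w: "q \<le> \<bar>w\<bar>" using iff(1)[of r w] x rw by auto
      show ?thesis
      proof (cases "0 \<le> w")
        case True
        then have "c + q \<le> c + w" "c + w \<le> c + 2 * pi - q" using w rw A by auto
        then show ?thesis unfolding closed_sector_def using rw by blast
      next
        case False
        have "x = pol r (c + w + 2 * pi)"
          using rw by (simp only: polar_point_2pi)
        moreover have "c + q \<le> c + w + 2 * pi" "c + w + 2 * pi \<le> c + 2 * pi - q" using False w rw A by auto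
        ultimately show ?thesis unfolding closed_sector_def using rw by blast
      qed
    qed
  next
    fix x assume "x \<in> closed_sector (c + q) (c + 2 * pi - q)"
    then obtain r t where rt: "0 \<le> r" "c + q \<le> t" "t \<le> c + 2 * pi - q" "x = pol r t"
      unfolding closed_sector_def by blast
    show "x \<in> {x. u x = p1 x}"
    proof (cases "r = 0")
      case True then show ?thesis using rt z by simp
    next
      case False
      show ?thesis
      proof (cases "t \<le> c + pi")
        case True
        then show ?thesis using iff(1)[of r "t - c"] rt A False by auto
      next
        case False
        have "c + (t - c - 2 * pi) = t - 2 * pi" by simp
        then have "x = pol r (c + (t - c - 2 * pi))"
          using rt by (simp only: polar_point_2pi)
        then show ?thesis using iff(1)[of r "t - c - 2 * pi"] rt A False \<open>r \<noteq> 0\<close> by auto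
      qed
    qed
  qed
qed

lemma is_cone_angles:
  assumes adm: "admissible c s q" and u: "is_cone c s q u"
  shows "noncoincidence_angles p1 p2 u (q - s) (q - s)"
proof -
  have A: "0 < s" "s < pi / 2" "pi / 2 < q" "q < pi"
    using adm by (auto simp: admissible_def)
  define S where "S a b = {pol r t | r t. 0 < r \<and> a < t \<and> t < b}" for a b
  have os: "open_sector (S a (a + (q - s))) (q - s)" for a
    unfolding open_sector_def S_def using A by auto
  have S: "x \<in> S (c + lo) (c + hi) \<longleftrightarrow> (\<exists>r w. 0 < r \<and> lo < w \<and> w < hi \<and> x = pol r (c + w))" for x lo hi
  proof
    assume "x \<in> S (c + lo) (c + hi)"
    then obtain r t where "0 < r" "c + lo < t" "t < c + hi" "x = pol r t" unfolding S_def by blast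
    then show "\<exists>r w. 0 < r \<and> lo < w \<and> w < hi \<and> x = pol r (c + w)"
      by (intro exI[of _ r] exI[of _ "t - c"]) auto
  qed (force simp: S_def)
  have disj: "S (c + s) (c + q) \<inter> S (c + - q) (c + - s) = {}"
  proof (rule ccontr)
    assume "\<not> ?thesis"
    then obtain x where "x \<in> S (c + s) (c + q)" "x \<in> S (c + - q) (c + - s)" by blast
    then obtain r w r' w' where *: "0 < r" "s < w" "w < q" "0 < r'" "- q < w'" "w' < - s"
      "pol r (c + w) = pol r' (c + w')" unfolding S by metis
    then show False using polar_point_eqD(2)[OF *(7)] A by auto
  qed
  have "{x. p1 x < u x \<and> u x < p2 x} = S (c + s) (c + q) \<union> S (c + - q) (c + - s)"
  proof (intro set_eqI iffI)
    fix x assume x: "x \<in> {x. p1 x < u x \<and> u x < p2 x}"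
    obtain r w where rw: "0 \<le> r" "- pi \<le> w" "w \<le> pi" "x = pol r (c + w)"
      using polar_point_window[of x c] by blast
    have "r \<noteq> 0" using x rw by (auto simp: quadratic_obstacle_def)
    then have "r > 0" using rw by simp
    have "\<bar>w\<bar> \<le> pi" using rw by auto
    then have "s < \<bar>w\<bar>" "\<bar>w\<bar> < q"
      using \<open>r > 0\<close> is_cone_between(3,4)[OF adm u, of r w] x rw by auto
    then consider "s < w" "w < q" | "- q < w" "w < - s" by linarith
    then show "x \<in> S (c + s) (c + q) \<union> S (c + - q) (c + - s)"
      unfolding Un_iff S using \<open>r > 0\<close> rw(4) by cases blast+
  next
    fix x assume "x \<in> S (c + s) (c + q) \<union> S (c + - q) (c + - s)"
    then obtain r w where *: "0 < r" "s < \<bar>w\<bar>" "\<bar>w\<bar> < q" "x = pol r (c + w)"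
    proof (unfold Un_iff S, elim disjE exE conjE, goal_cases)
      case (1 r w)
      then show thesis using A by (intro 1(1)[of r w]) auto
    next
      case (2 r w)
      then show thesis using A by (intro 2(1)[of r w]) auto
    qed
    have "\<bar>w\<bar> \<le> pi" using * A by auto
    then show "x \<in> {x. p1 x < u x \<and> u x < p2 x}"
      using is_cone_between[OF adm u \<open>0 < r\<close>, of w] * by auto
  qed
  moreover have "open_sector (S (c + s) (c + q)) (q - s)" "open_sector (S (c + - q) (c + - s)) (q - s)"
    using os[of "c + s"] os[of "c + - q"] by (simp_all add: algebra_simps)
  ultimately show ?thesis
    unfolding noncoincidence_angles_def using disj by blast
qed

lemma is_cone_unique:
  assumes "is_cone c s q u" "is_cone c s q v"
  shows "u = v"
proof
  fix x
  obtain r w where rw: "0 \<le> r" "- pi \<le> w" "w \<le> pi" "x = pol r (c + w)"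
    using polar_point_window[of x c] by blast
  then have w: "\<bar>w\<bar> \<le> pi" by auto
  show "u x = v x"
    unfolding rw(4) assms(1)[unfolded is_cone_def, rule_format, OF rw(1) w]
      assms(2)[unfolded is_cone_def, rule_format, OF rw(1) w] by (rule refl)
qed

end

text \<open>A function given in polar coordinates of the window around \<open>c\<close> is well
  defined once it respects the only ambiguities: the two ends of the window and the origin.\<close>

lemma polar_function_exists:
  assumes "\<And>r. V r pi = V r (- pi)" and "\<And>w. V 0 w = v0"
  shows "\<exists>f. \<forall>r w. 0 \<le> r \<longrightarrow> \<bar>w\<bar> \<le> pi \<longrightarrow> f (pol r (c + w)) = V r w"
proof -
  define f where "f x = (SOME v. \<exists>r w. 0 \<le> r \<and> \<bar>w\<bar> \<le> pi \<and> x = pol r (c + w) \<and> v = V r w)" for x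
  have "f (pol r (c + w)) = V r w" if rw: "0 \<le> r" "\<bar>w\<bar> \<le> pi" for r w
    unfolding f_def
  proof (rule some_equality)
    show "\<exists>r' w'. 0 \<le> r' \<and> \<bar>w'\<bar> \<le> pi \<and> pol r (c + w) = pol r' (c + w') \<and> V r w = V r' w'"
      using rw by blast
    fix v assume "\<exists>r' w'. 0 \<le> r' \<and> \<bar>w'\<bar> \<le> pi \<and> pol r (c + w) = pol r' (c + w') \<and> v = V r' w'"
    then obtain r' w' where *: "0 \<le> r'" "\<bar>w'\<bar> \<le> pi" "pol r (c + w) = pol r' (c + w')" "v = V r' w'"
      by blast
    note D = polar_point_eqD[OF *(3) rw(1) *(1) rw(2) *(2)]
    from D(2) show "v = V r w"
      unfolding *(4) D(1)[symmetric] using assms by auto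
  qed
  then show ?thesis by blast
qed

section \<open>The double cone as a solution\<close>

context obstacles
begin

text \<open>These are the coefficients of \<open>p1 + m1 (x \<bullet> n)^2\<close> and
  \<open>p2 - m2 (x \<bullet> k)^2\<close>, where \<open>n\<close> and \<open>k\<close> are normal
  to the edges at \<open>a\<close> and \<open>b\<close>; the double angle formulas turn the matching
  relation into their equality.\<close>

lemma match_coefficients:
  assumes "matching m1 m2 d a b"
  shows "a1 + m1 * (sin a)\<^sup>2 = a2 - m2 * (sin b)\<^sup>2" "- m1 * (sin a * cos a) = m2 * (sin b * cos b)"
    "c1 + m1 * (cos a)\<^sup>2 = c2 - m2 * (cos b)\<^sup>2"
proof -
  have M: "m1 * cos (2 * a) + m2 * cos (2 * b) = - d" "m1 * sin (2 * a) + m2 * sin (2 * b) = 0"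
    using assms by (auto simp: matching_def)
  have s: "(sin x)\<^sup>2 = (1 - cos (2 * x)) / 2" for x :: real
    by (simp add: cos_double_sin)
  have c: "(cos x)\<^sup>2 = (1 + cos (2 * x)) / 2" for x :: real
    by (simp add: cos_double_cos)
  have "m1 * (1 - cos (2 * a)) + m2 * (1 - cos (2 * b)) = 2 * (a2 - a1)"
    using M(1) by (simp add: algebra_simps)
  then show "a1 + m1 * (sin a)\<^sup>2 = a2 - m2 * (sin b)\<^sup>2"
    unfolding s by (simp add: field_simps)
  have "m1 * (1 + cos (2 * a)) + m2 * (1 + cos (2 * b)) = 2 * (c2 - c1)"
    using M(1) by (simp add: algebra_simps)
  then show "c1 + m1 * (cos a)\<^sup>2 = c2 - m2 * (cos b)\<^sup>2"
    unfolding c by (simp add: field_simps)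
  have "m1 * (2 * (sin a * cos a)) + m2 * (2 * (sin b * cos b)) = 0"
    using M(2) by (simp add: sin_double mult.assoc)
  then show "- m1 * (sin a * cos a) = m2 * (sin b * cos b)"
    by (simp add: algebra_simps)
qed

text \<open>The coefficients of the quadratic form \<open>p1 + m1 (x \<bullet> n)\<^sup>2\<close> with \<open>n = (- sin a, cos a)\<close>.\<close>

definition qA where "qA a = a1 + m1 * (sin a)\<^sup>2"
definition qB where "qB a = - m1 * (sin a * cos a)"
definition qC where "qC a = c1 + m1 * (cos a)\<^sup>2"

lemma quad_form_wedge:
  "quad_form (qA a) (qB a) (qC a) (pol r t) = p1 (pol r t) + m1 * r\<^sup>2 * (sin (t - a))\<^sup>2"
proof -
  have "m1 * r\<^sup>2 * (sin (t - a))\<^sup>2 = m1 * (r * sin t * cos a - r * cos t * sin a)\<^sup>2"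
    by (simp add: sin_diff power2_eq_square algebra_simps)
  then show ?thesis
    by (simp add: quad_form_def qA_def qB_def qC_def quadratic_obstacle_def power2_eq_square algebra_simps)
qed

lemma quad_form_obstacle: "quad_form a 0 c x = quadratic_obstacle a c x"
  by (simp add: quad_form_def quadratic_obstacle_def)

text \<open>The added square of a linear form vanishes to second order on its zero line, which is
  the line through the edge.\<close>

lemma quad_grad_wedge1: "quad_grad (qA a) (qB a) (qC a) (pol r a) = quad_grad a1 0 c1 (pol r a)"
  by (simp add: vec_eq_iff forall_2 qA_def qB_def qC_def power2_eq_square algebra_simps)

lemma quad_grad_wedge2:
  assumes "matching m1 m2 d a b"
  shows "quad_grad (qA a) (qB a) (qC a) (pol r b) = quad_grad a2 0 c2 (pol r b)"
  unfolding qA_def qB_def qC_def match_coefficients[OF assms]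
  by (simp add: vec_eq_iff forall_2 power2_eq_square algebra_simps)

lemma cone_exists:
  assumes adm: "admissible c s q"
  shows "\<exists>u. is_cone c s q u \<and> double_cone u"
proof -
  have A: "0 < s" "s < pi / 2" "pi / 2 < q" "q < pi"
    and M: "matching m1 m2 d (c - q) (c - s)" "matching m1 m2 d (c + q) (c + s)"
    using adm by (auto simp: admissible_def)
  define V where "V = cone_value c s q"
  \<comment> \<open>\<open>W\<close> is the intended gradient of \<open>u\<close> in polar
    coordinates, with the same branches as \<open>V\<close> except that the two wedges carry
    different forms.\<close>
  define W where "W r w = (if \<bar>w\<bar> \<le> s then quad_grad a2 0 c2 (pol r (c + w))
      else if q \<le> \<bar>w\<bar> then quad_grad a1 0 c1 (pol r (c + w))
      else if 0 < w then quad_grad (qA (c + q)) (qB (c + q)) (qC (c + q)) (pol r (c + w))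
      else quad_grad (qA (c - q)) (qB (c - q)) (qC (c - q)) (pol r (c + w)))" for r w
  have pp: "pol r (c + pi) = pol r (c + - pi)" for r
  proof -
    have "c + pi = (c + - pi) + 2 * pi" by simp
    then show ?thesis by (simp only: polar_point_2pi)
  qed
  have "V r pi = V r (- pi)" "W r pi = W r (- pi)" for r
    using A by (simp_all add: V_def cone_value_def Let_def W_def pp[unfolded diff_conv_add_uminus[symmetric]])
  moreover have "V 0 w = 0" "W 0 w = 0" for w
    by (simp_all add: V_def cone_value_def Let_def W_def quadratic_obstacle_def quad_grad_def vec_eq_iff forall_2)
  ultimately obtain u g where u: "\<And>r w. 0 \<le> r \<Longrightarrow> \<bar>w\<bar> \<le> pi \<Longrightarrow> u (pol r (c + w)) = V r w"
    and g: "\<And>r w. 0 \<le> r \<Longrightarrow> \<bar>w\<bar> \<le> pi \<Longrightarrow> g (pol r (c + w)) = W r w"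
    using polar_function_exists[of V 0 c] polar_function_exists[of W 0 c] by metis
  have cone: "is_cone c s q u"
    unfolding is_cone_def V_def[symmetric] using u by blast
  \<comment> \<open>Each tuple lists the angular range of a piece and the coefficients of its
    quadratic form. The window from \<open>- pi\<close> to \<open>pi\<close> cuts the sector of
    contact with \<open>p1\<close> into \<open>i1\<close> and \<open>i5\<close>, hence five
    pieces.\<close>
  define i1 i2 i3 i4 i5 where i_defs: "i1 = (- pi, - q, a1, 0 :: real, c1)"
    "i2 = (- q, - s, qA (c - q), qB (c - q), qC (c - q))" "i3 = (- s, s, a2, 0 :: real, c2)"
    "i4 = (s, q, qA (c + q), qB (c + q), qC (c + q))" "i5 = (q, pi, a1, 0 :: real, c1)"
  define I where "I = {i1, i2, i3, i4, i5}"
  define lo hi xx xy yy :: "real \<times> real \<times> real \<times> real \<times> real \<Rightarrow> real"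
    where "lo = (\<lambda>(l, h, x, y, z). l)" and "hi = (\<lambda>(l, h, x, y, z). h)"
    and "xx = (\<lambda>(l, h, x, y, z). x)" and "xy = (\<lambda>(l, h, x, y, z). y)" and "yy = (\<lambda>(l, h, x, y, z). z)"
  note defs = i_defs lo_def hi_def xx_def xy_def yy_def
  define P where "P i = closed_sector (c + lo i) (c + hi i)" for i :: "real \<times> real \<times> real \<times> real \<times> real"
  have inI: "i \<in> I \<Longrightarrow> lo i \<le> w \<Longrightarrow> w \<le> hi i \<Longrightarrow> \<bar>w\<bar> \<le> pi" for i w
    using A by (auto simp: I_def defs)
  have PD: "\<exists>r w. 0 \<le> r \<and> lo i \<le> w \<and> w \<le> hi i \<and> x = pol r (c + w)" if "x \<in> P i" for x i
  proof -
    obtain r t where "0 \<le> r" "c + lo i \<le> t" "t \<le> c + hi i" "x = pol r t"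
      using \<open>x \<in> P i\<close> unfolding P_def closed_sector_def by blast
    then show ?thesis by (intro exI[of _ r] exI[of _ "t - c"]) auto
  qed
  have PI: "pol r (c + w) \<in> P i" if "0 \<le> r" "lo i \<le> w" "w \<le> hi i" for r w i
    unfolding P_def closed_sector_def using that by force
  have pieces: "V r w = quad_form (xx i) (xy i) (yy i) (pol r (c + w))"
    "W r w = quad_grad (xx i) (xy i) (yy i) (pol r (c + w))"
    if i: "i \<in> I" "lo i \<le> w" "w \<le> hi i" for i r w
  proof -
    have "- w - q = - (w + q)" by simp
    then have s1: "(sin (- w - q))\<^sup>2 = (sin (w + q))\<^sup>2" by (simp only: sin_minus power2_minus)
    have e1: "p1 (pol r (c - s)) + m1 * r\<^sup>2 * (sin (q - s))\<^sup>2 = p2 (pol r (c - s))"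
      using match_gap[OF M(1), of r "c - s"] by (simp add: algebra_simps)
    have e2: "p1 (pol r (c + s)) + m1 * r\<^sup>2 * (sin (s - q))\<^sup>2 = p2 (pol r (c + s))"
      using match_gap[OF M(2), of r "c + s"] by (simp add: algebra_simps)
    note wedge = quad_form_wedge quad_grad_wedge1[of "c - q"] quad_grad_wedge1[of "c + q"]
      quad_grad_wedge2[OF M(1)] quad_grad_wedge2[OF M(2)]
    consider "i = i1" | "i = i2" | "i = i3" | "i = i4" | "i = i5"
      using i(1) by (auto simp: I_def)
    then have "V r w = quad_form (xx i) (xy i) (yy i) (pol r (c + w)) \<and>
      W r w = quad_grad (xx i) (xy i) (yy i) (pol r (c + w))"
    proof cases
      case 1
      then have "q \<le> \<bar>w\<bar>" "\<not> \<bar>w\<bar> \<le> s" using i(2,3) A by (auto simp: defs)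
      then show ?thesis using 1 by (simp add: defs V_def cone_value_def Let_def W_def quad_form_obstacle)
    next
      case 2
      then have "- q \<le> w" "w \<le> - s" using i(2,3) by (auto simp: defs)
      then consider "w = - s" | "w = - q" | "- q < w" "w < - s" by linarith
      then show ?thesis
        by cases (use A 2 e1 s1 wedge in \<open>simp_all add: defs V_def cone_value_def Let_def W_def\<close>)
    next
      case 3
      then have "\<bar>w\<bar> \<le> s" using i(2,3) by (auto simp: defs)
      then show ?thesis using 3 by (simp add: defs V_def cone_value_def Let_def W_def quad_form_obstacle)
    next
      case 4
      then have "s \<le> w" "w \<le> q" using i(2,3) by (auto simp: defs)
      then consider "w = s" | "w = q" | "s < w" "w < q" by linarith
      then show ?thesis
        by cases (use A 4 e2 wedge in \<open>simp_all add: defs V_def cone_value_def Let_def W_def\<close>)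
    next
      case 5
      then have "q \<le> \<bar>w\<bar>" "\<not> \<bar>w\<bar> \<le> s" using i(2,3) A by (auto simp: defs)
      then show ?thesis using 5 by (simp add: defs V_def cone_value_def Let_def W_def quad_form_obstacle)
    qed
    then show "V r w = quad_form (xx i) (xy i) (yy i) (pol r (c + w))"
      "W r w = quad_grad (xx i) (xy i) (yy i) (pol r (c + w))" by blast+
  qed
  have fin: "finite I" by (simp add: I_def)
  have cover_w: "\<exists>i\<in>I. lo i \<le> w \<and> w \<le> hi i" if "- pi \<le> w" "w \<le> pi" for w
  proof -
    consider "w \<le> - q" | "- q \<le> w" "w \<le> - s" | "- s \<le> w" "w \<le> s" | "s \<le> w" "w \<le> q" | "q \<le> w" by linarith
    then show ?thesis
      by cases (use that in \<open>auto simp: I_def defs\<close>)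
  qed
  have cover: "(\<Union>i\<in>I. P i) = UNIV"
  proof -
    have "x \<in> (\<Union>i\<in>I. P i)" for x
    proof -
      obtain r w where rw: "0 \<le> r" "- pi \<le> w" "w \<le> pi" "x = pol r (c + w)"
        using polar_point_window[of x c] by blast
      then show ?thesis using cover_w[of w] PI by blast
    qed
    then show ?thesis by auto
  qed
  have cl: "closed (P i)" for i unfolding P_def by (rule closed_closed_sector)
  have uP: "u x = quad_form (xx i) (xy i) (yy i) x" and gP: "g x = quad_grad (xx i) (xy i) (yy i) x"
    if "i \<in> I" "x \<in> P i" for i x
  proof -
    obtain r w where rw: "0 \<le> r" "lo i \<le> w" "w \<le> hi i" "x = pol r (c + w)"
      using PD[OF \<open>x \<in> P i\<close>] by blast
    have w: "\<bar>w\<bar> \<le> pi" by (rule inI[OF \<open>i \<in> I\<close> rw(2,3)])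
    show "u x = quad_form (xx i) (xy i) (yy i) x"
      unfolding rw(4) u[OF rw(1) w] by (rule pieces(1)[OF \<open>i \<in> I\<close> rw(2,3)])
    show "g x = quad_grad (xx i) (xy i) (yy i) x"
      unfolding rw(4) g[OF rw(1) w] by (rule pieces(2)[OF \<open>i \<in> I\<close> rw(2,3)])
  qed
  have C11: "C11_loc u"
    by (rule glued_quadratic_forms_C11[OF fin cover cl uP gP])
  note bt = is_cone_between[OF adm cone]
  have between: "p1 x \<le> u x \<and> u x \<le> p2 x" for x
  proof -
    obtain r w where rw: "0 \<le> r" "- pi \<le> w" "w \<le> pi" "x = pol r (c + w)"
      using polar_point_window[of x c] by blast
    show ?thesis
    proof (cases "r = 0")
      case True
      then show ?thesis using rw is_cone_zero[OF cone] by (simp add: quadratic_obstacle_def)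
    next
      case False
      then show ?thesis using rw bt(1,2)[of r w] by auto
    qed
  qed
  \<comment> \<open>\<open>Z\<close> is a finite union of lines through the origin that contains all
    edges and the artificial cut at the ends of the window; off \<open>Z\<close> every point lies in
    exactly one piece.\<close>
  define Z where "Z = (\<Union>b\<in>{- q, - s, s, q, pi}. {x. pol 1 (c + b + pi / 2) \<bullet> x = 0})"
  have "negligible Z"
    unfolding Z_def
  proof (rule negligible_Union)
    have "pol 1 t \<noteq> 0" for t using norm_polar_point[of 1 t] by auto
    then show "negligible S" if "S \<in> (\<lambda>b. {x. pol 1 (c + b + pi / 2) \<bullet> x = 0}) ` {- q, - s, s, q, pi}" for S
      using that by (auto intro!: negligible_hyperplane simp del: inner_commute)
  qed simp
  moreover have "has_laplacian u
      (2 * (a1 + c1) * indicat_real {y. u y = p1 y} x + 2 * (a2 + c2) * indicat_real {y. u y = p2 y} x) x"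
    if "x \<notin> Z" for x
  proof -
    obtain r w where rw: "0 \<le> r" "- pi \<le> w" "w \<le> pi" "x = pol r (c + w)"
      using polar_point_window[of x c] by blast
    have nz: "r * sin (w - b) \<noteq> 0" if "b \<in> {- q, - s, s, q, pi}" for b
      using \<open>x \<notin> Z\<close> that inner_polar_point_normal(1)[of "c + b" r "c + w"] unfolding Z_def rw(4) by (auto simp: add.commute)
    have r: "r > 0" using nz[of pi] rw by (cases "r = 0") auto
    have ne: "w \<noteq> - q" "w \<noteq> - s" "w \<noteq> s" "w \<noteq> q" "w \<noteq> pi" "w \<noteq> - pi"
      using nz[of "- q"] nz[of "- s"] nz[of s] nz[of q] nz[of pi] by auto
    have abs: "\<bar>w\<bar> \<le> pi" using rw by auto
    have lap: "has_laplacian u (2 * (xx i + yy i)) x" if i: "i \<in> I" "lo i < w" "w < hi i" for i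
    proof (rule glued_quadratic_forms_laplacian[OF fin cover cl uP i(1)])
      fix j assume j: "j \<in> I" "j \<noteq> i"
      show "x \<notin> P j"
      proof
        assume "x \<in> P j"
        then obtain r' w' where *: "0 \<le> r'" "lo j \<le> w'" "w' \<le> hi j" "x = pol r' (c + w')"
          using PD by blast
        have "pol r (c + w) = pol r' (c + w')" using * rw by simp
        from polar_point_eqD(2)[OF this rw(1) *(1) abs inI[OF j(1) *(2,3)]] r ne
        have "w = w'" by auto
        then show False
          using i j *(2,3) A by (auto simp: I_def defs)
      qed
    qed
    have ind: "indicat_real {y. u y = p1 y} x = (if q \<le> \<bar>w\<bar> then 1 else 0)"
      "indicat_real {y. u y = p2 y} x = (if \<bar>w\<bar> \<le> s then 1 else 0)"
      using bt(3,4)[OF r abs] by (auto simp: rw(4))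
    \<comment> \<open>The wedge form has trace zero because \<open>m1\<close> cancels
      \<open>a1 + c1\<close>, so the wedges carry Laplacian 0.\<close>
    have tr: "qA a + qC a = 0" for a
    proof -
      have "qA a + qC a = (a1 + c1) + m1 * ((sin a)\<^sup>2 + (cos a)\<^sup>2)"
        by (simp only: qA_def qC_def distrib_left add_ac)
      then show ?thesis by simp
    qed
    consider "- pi < w" "w < - q" | "- q < w" "w < - s" | "- s < w" "w < s" | "s < w" "w < q" | "q < w" "w < pi"
      using ne rw by linarith
    then show ?thesis
    proof cases
      case 1
      then show ?thesis
        using lap[of i1] A unfolding ind by (simp add: I_def defs)
    next
      case 2
      then show ?thesis
        using lap[of i2] A unfolding ind by (simp add: I_def defs tr)
    next
      case 3
      then have "\<bar>w\<bar> \<le> s" by auto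
      then show ?thesis
        using 3 lap[of i3] A unfolding ind by (simp add: I_def defs)
    next
      case 4
      then show ?thesis
        using lap[of i4] A unfolding ind by (simp add: I_def defs tr)
    next
      case 5
      then show ?thesis
        using lap[of i5] A unfolding ind by (simp add: I_def defs)
    qed
  qed
  ultimately have AE: "AE x in lebesgue. has_laplacian u
      (2 * (a1 + c1) * indicat_real {y. u y = p1 y} x + 2 * (a2 + c2) * indicat_real {y. u y = p2 y} x) x"
    unfolding eventually_ae_filter_negligible by blast
  have "halfcone {x. u x = p1 x}"
    unfolding is_cone_coincidence(2)[OF adm cone] closed_sector_def halfcone_def using A
    by (intro exI[of _ "c + q"] exI[of _ "c + 2 * pi - q"]) auto
  moreover have "halfcone {x. u x = p2 x}"
    unfolding is_cone_coincidence(1)[OF adm cone] closed_sector_def halfcone_def using A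
    by (intro exI[of _ "c - s"] exI[of _ "c + s"]) auto
  ultimately show ?thesis
    using cone C11 between AE unfolding double_cone_solution_def global_solution_def by blast
qed

end

section \<open>Structure and number of double cones\<close>

lemma halfcone_scale:
  assumes "halfcone C" "x \<in> C" "0 \<le> s"
  shows "s *\<^sub>R x \<in> C"
proof -
  obtain a b where C: "C = {pol r t | r t. 0 \<le> r \<and> a \<le> t \<and> t \<le> b}"
    using assms(1) unfolding halfcone_def by blast
  then obtain r t where rt: "0 \<le> r" "a \<le> t" "t \<le> b" "x = pol r t" using assms(2) by blast
  then have "s *\<^sub>R x = pol (s * r) t" "0 \<le> s * r" using assms(3) by (auto simp: scale_polar_point)
  then show ?thesis unfolding C using rt by blast
qed

lemma halfcone_scale_iff:
  assumes "halfcone C" "0 < r"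
  shows "pol r t \<in> C \<longleftrightarrow> pol 1 t \<in> C"
  using halfcone_scale[OF assms(1), of "pol 1 t" r] halfcone_scale[OF assms(1), of "pol r t" "1 / r"] assms(2)
  by (auto simp: scale_polar_point)

lemma polar_point_1_eq_iff: "pol 1 s = pol 1 t \<longleftrightarrow> (\<exists>k :: int. s = t + turns k)"
proof
  assume eq: "pol 1 s = pol 1 t"
  have "cos s = cos t" "sin s = sin t"
    using polar_point_nth[of 1 s] polar_point_nth[of 1 t] unfolding eq by auto
  then have "cos (s - t) = 1"
    by (simp only: cos_diff) (metis sin_cos_squared_add3)
  then obtain n :: int where "s - t = of_int n * 2 * pi" unfolding cos_one_2pi_int by auto
  then show "\<exists>k :: int. s = t + turns k" by (intro exI[of _ n]) (simp add: algebra_simps)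
next
  assume "\<exists>k :: int. s = t + turns k"
  then obtain k :: int where k: "s = t + turns k" by blast
  have "cos (t + turns k) = cos t" "sin (t + turns k) = sin t"
    by (rule periodic_int; simp)+
  then show "pol 1 s = pol 1 t" by (simp add: k vec_eq_iff forall_2)
qed

lemma halfcone_angles:
  assumes "halfcone C"
  obtains a b where "a < b" "b < a + pi"
    "\<forall>t. pol 1 t \<in> C \<longleftrightarrow> (\<exists>k :: int. a \<le> t + turns k \<and> t + turns k \<le> b)"
proof -
  obtain a b where ab: "0 < b - a" "b - a < pi" and C: "C = closed_sector a b"
    using assms unfolding halfcone_def closed_sector_def by blast
  have "pol 1 t \<in> C \<longleftrightarrow> (\<exists>k :: int. a \<le> t + turns k \<and> t + turns k \<le> b)" for t
  proof
    assume "pol 1 t \<in> C"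
    then obtain r s where rs: "0 \<le> r" "a \<le> s" "s \<le> b" "pol 1 t = pol r s"
      unfolding C closed_sector_def by blast
    have "r = 1" using arg_cong[OF rs(4), of norm] rs(1) by (simp add: norm_polar_point)
    then obtain k :: int where "s = t + turns k" using rs(4) polar_point_1_eq_iff[of s t] by auto
    then show "\<exists>k :: int. a \<le> t + turns k \<and> t + turns k \<le> b" using rs by blast
  next
    assume "\<exists>k :: int. a \<le> t + turns k \<and> t + turns k \<le> b"
    then obtain k :: int where k: "a \<le> t + turns k" "t + turns k \<le> b" by blast
    moreover have "pol 1 t = pol 1 (t + turns k)"
      using polar_point_1_eq_iff[of "t + turns k" t] by auto
    ultimately show "pol 1 t \<in> C" unfolding C closed_sector_def using zero_le_one by blast
  qed
  then show thesis using ab C by (intro that[of a b]) auto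
qed

lemma no_int_shift:
  fixes k :: int
  assumes "b < t" "t < a + 2 * pi" "a \<le> b"
  shows "\<not> (a \<le> t + turns k \<and> t + turns k \<le> b)"
proof (cases "k \<ge> 0")
  case True
  then have "turns k \<ge> 0" by simp
  then show ?thesis using assms by linarith
next
  case False
  then have "real_of_int k \<le> -1" by linarith
  then have "turns k \<le> 2 * pi * (-1)" by (intro mult_left_mono) auto
  then show ?thesis using assms by linarith
qed

text \<open>With \<open>C\<close> and \<open>S\<close> the cosine and sine of twice the axis angle,
  the sums and differences of the paired equations give \<open>C * P = - e\<close> and
  \<open>S * R = S * P = C * R = 0\<close>. Rotating back separates the axis direction from the
  shape of the triangle.\<close>

lemma rotation_system_iff:
  fixes C S P R e :: real
  assumes CS: "C * C + S * S = 1"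
  shows "(C * P + S * R = - e \<and> S * P - C * R = 0) \<and> (C * P - S * R = - e \<and> S * P + C * R = 0)
      \<longleftrightarrow> e * S = 0 \<and> R = 0 \<and> P = - e * C"
proof
  assume "(C * P + S * R = - e \<and> S * P - C * R = 0) \<and> (C * P - S * R = - e \<and> S * P + C * R = 0)"
  then have 1: "C * P = - e" "S * R = 0" "S * P = 0" "C * R = 0" by linarith+
  have "R = C * (C * R) + S * (S * R)" using CS by (metis distrib_right mult.assoc mult_1)
  then have "R = 0" using 1 by simp
  moreover have "P = C * (C * P) + S * (S * P)" using CS by (metis distrib_right mult.assoc mult_1)
  then have "P = C * (- e) + S * 0" unfolding 1 .
  then have "P = - e * C" by simp
  moreover have "e * S = - (C * (S * P))" using 1(1) by (metis minus_mult_left mult.assoc mult.commute minus_minus)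
  then have "e * S = - (C * 0)" unfolding 1 .
  then have "e * S = 0" by simp
  ultimately show "e * S = 0 \<and> R = 0 \<and> P = - e * C" by blast
next
  assume 1: "e * S = 0 \<and> R = 0 \<and> P = - e * C"
  have "S * P = - (e * S) * C" using 1 by (simp add: algebra_simps)
  moreover have "C * P = - e * (C * C + S * S) + (e * S) * S" using 1 by (simp add: algebra_simps)
  ultimately show "(C * P + S * R = - e \<and> S * P - C * R = 0) \<and> (C * P - S * R = - e \<and> S * P + C * R = 0)"
    using 1 CS by simp
qed

lemma mult_sin_cos_zero:
  fixes e x :: real
  assumes "e * sin x = 0" "e * cos x = 0"
  shows "e = 0"
  using assms sin_zero_abs_cos_one[of x] by (cases "sin x = 0") auto

text \<open>The squared modulus of the triangle relation.\<close>

lemma match_law_of_cosines: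
  assumes "matching m1 m2 d a b"
  shows "d\<^sup>2 = m1\<^sup>2 + m2\<^sup>2 + 2 * m1 * m2 * cos (2 * a - 2 * b)"
proof -
  have M: "m1 * cos (2 * a) + m2 * cos (2 * b) = - d" "m1 * sin (2 * a) + m2 * sin (2 * b) = 0"
    using assms by (auto simp: matching_def)
  have "(m1 * cos x + m2 * cos y)\<^sup>2 + (m1 * sin x + m2 * sin y)\<^sup>2 =
      m1\<^sup>2 * ((sin x)\<^sup>2 + (cos x)\<^sup>2) + m2\<^sup>2 * ((sin y)\<^sup>2 + (cos y)\<^sup>2) + 2 * m1 * m2 * (cos x * cos y + sin x * sin y)" for x y
    by (simp only: power2_eq_square) (simp only: algebra_simps)
  from this[of "2 * a" "2 * b", unfolded M] show ?thesis
    by (simp add: cos_diff)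
qed

section \<open>Double cones and triangles\<close>

context obstacles
begin

text \<open>Halfcones give a \<open>conic_solution\<close>, and both gaps between them are free arcs
  with edges of different kind. Of the alternatives for such a pair, those with a single contact
  angle are excluded because halfcones have positive opening; the remaining one yields the common
  bisector \<open>c\<close>.\<close>

lemma double_cone_is_cone:
  assumes dc: "double_cone u"
  shows "\<exists>c s q. admissible c s q \<and> is_cone c s q u"
proof -
  have sol: "solution u" and h1: "halfcone {x. u x = p1 x}" and h2: "halfcone {x. u x = p2 x}"
    using dc by (auto simp: double_cone_solution_def)
  interpret conic_solution a1 a2 c1 c2 u
  proof (unfold_locales, goal_cases)
    case 1 show ?case by (rule sol)
  next
    case (2 r t) show ?case using halfcone_scale_iff[OF h1 2, of t] by simp
  next
    case (3 r t) show ?case using halfcone_scale_iff[OF h2 3, of t] by simp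
  qed
  obtain x1 y1 where ab1: "x1 < y1" "y1 < x1 + pi"
    and z1': "\<forall>t. pol 1 t \<in> {x. u x = p1 x} \<longleftrightarrow> (\<exists>k :: int. x1 \<le> t + turns k \<and> t + turns k \<le> y1)"
    by (rule halfcone_angles[OF h1])
  obtain x2 y2 where ab2: "x2 < y2" "y2 < x2 + pi"
    and z2': "\<forall>t. pol 1 t \<in> {x. u x = p2 x} \<longleftrightarrow> (\<exists>k :: int. x2 \<le> t + turns k \<and> t + turns k \<le> y2)"
    by (rule halfcone_angles[OF h2])
  have z1: "D1 t = 0 \<longleftrightarrow> (\<exists>k :: int. x1 \<le> t + turns k \<and> t + turns k \<le> y1)" for t
    using z1'[rule_format, of t] by (simp add: D1_def)
  \<comment> \<open>The \<open>p2\<close> cone is shifted by full turns so that it begins within one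
    turn after the end \<open>y1\<close> of the \<open>p1\<close> cone.\<close>
  obtain m :: int where m: "y1 \<le> x2 + turns m" "x2 + turns m < y1 + 2 * pi"
    using reduce_angle by blast
  define a b b' a' where "a = y1" and "b = x2 + turns m" and "b' = y2 + turns m" and "a' = x1 + 2 * pi"
  have z2: "D2 t = 0 \<longleftrightarrow> (\<exists>k :: int. b \<le> t + turns k \<and> t + turns k \<le> b')" for t
  proof -
    have "D2 t = 0 \<longleftrightarrow> (\<exists>k :: int. x2 \<le> t + turns k \<and> t + turns k \<le> y2)"
      using z2'[rule_format, of t] by (auto simp add: D2_def)
    also have "\<dots> \<longleftrightarrow> (\<exists>k :: int. b \<le> t + turns k \<and> t + turns k \<le> b')"
    proof
      assume "\<exists>k :: int. x2 \<le> t + turns k \<and> t + turns k \<le> y2"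
      then obtain k :: int where "x2 \<le> t + turns k" "t + turns k \<le> y2" by blast
      then show "\<exists>k :: int. b \<le> t + turns k \<and> t + turns k \<le> b'"
        by (intro exI[of _ "k + m"]) (simp add: b_def b'_def algebra_simps)
    next
      assume "\<exists>k :: int. b \<le> t + turns k \<and> t + turns k \<le> b'"
      then obtain k :: int where "b \<le> t + turns k" "t + turns k \<le> b'" by blast
      then show "\<exists>k :: int. x2 \<le> t + turns k \<and> t + turns k \<le> y2"
        by (intro exI[of _ "k - m"]) (simp add: b_def b'_def algebra_simps)
    qed
    finally show ?thesis .
  qed
  have D1z: "D1 t = 0" if "x1 \<le> t" "t \<le> y1" for t
    unfolding z1 using that by (intro exI[of _ 0]) simp
  have D1z': "D1 t = 0" if "a' \<le> t" "t \<le> a + 2 * pi" for t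
    unfolding z1 using that by (intro exI[of _ "-1"]) (simp add: a_def a'_def)
  have D2z: "D2 t = 0" if "b \<le> t" "t \<le> b'" for t
    unfolding z2 using that by (intro exI[of _ 0]) simp
  have disj: "D1 t \<noteq> 0" if "D2 t = 0" for t using circ.gap_pos[of t] that by auto
  have bb': "b < b'" "b' < b + pi" using ab2 by (auto simp: b_def b'_def)
  have D2b: "D2 b = 0" "D2 b' = 0" using D2z[of b] D2z[of b'] bb' by auto
  have D1a: "D1 a = 0" "D1 a' = 0" using D1z[of a] D1z'[of a'] ab1 by (auto simp: a_def a'_def)
  have "a \<noteq> b" using disj[OF D2b(1)] D1a by auto
  then have ab: "a < b" "b < a + 2 * pi" using m by (auto simp: a_def b_def)
  have ba': "b' < a'"
  proof (rule ccontr)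
    assume n: "\<not> b' < a'"
    show False
    proof (cases "b \<le> a'")
      case True
      then show False using D2z[of a'] n disj D1a by auto
    next
      case False
      then show False using D1z'[of b] ab disj D2b by auto
    qed
  qed
  have pos: "D1 t > 0 \<and> D2 t > 0" if "a < t \<and> t < b \<or> b' < t \<and> t < a'" for t
  proof -
    have "D1 t \<noteq> 0"
      unfolding z1 using no_int_shift[of y1 t x1] that ab ab1 bb' ba' by (auto simp: a_def a'_def)
    moreover have "D2 t \<noteq> 0"
    proof (cases "a < t \<and> t < b")
      case True
      have "\<not> (\<exists>k :: int. b \<le> (t + 2 * pi) + turns k \<and> (t + 2 * pi) + turns k \<le> b')"
        using no_int_shift[of b' "t + 2 * pi" b] True ab ab1 bb' ba' by (auto simp: a_def a'_def)
      then have "D2 (t + 2 * pi) \<noteq> 0" unfolding z2 by blast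
      then show ?thesis using circ.per2[of t] by simp
    next
      case False
      then show ?thesis
        unfolding z2 using no_int_shift[of b' t b] that ab ab1 bb' ba' by (auto simp: a_def a'_def)
    qed
    ultimately show ?thesis using circ.pos1 circ.pos2 by blast
  qed
  have arc1: "\<forall>s\<in>{a<..<b}. D1 s > 0 \<and> D2 s > 0" and arc2: "\<forall>s\<in>{b'<..<a'}. D1 s > 0 \<and> D2 s > 0"
    using pos by auto
  have bnd: "b \<le> a + 2 * pi" "a' \<le> b' + 2 * pi" "b \<le> b'" "a' - a \<le> 2 * pi"
    using ab ab1 bb' by (auto simp: a_def a'_def)
  note A12 = circ.arc12[OF ab(1) bnd(1) arc1 D1a(1) D2b(1)]
  note A21 = circ.arc21[OF ba' bnd(2) arc2 D1a(2) D2b(2)]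
  have mid: "a + a' = b + b'"
    by (rule match_pair_cases[OF circ.m1 circ.m2 A12(2) A21(2) ab(1) bnd(3) ba' A12(1) A21(1) bnd(4)])
      (use ab1 bb' in \<open>auto simp: a_def a'_def\<close>)
  define c s q where "c = (b + b') / 2" and "s = (b' - b) / 2" and "q = (a' - a) / 2"
  have e: "b = c - s" "b' = c + s" "a = c - q" "a' = c + q"
    using mid by (simp_all add: c_def s_def q_def field_simps)
  have "0 < s" "s < pi / 2" using bb' by (auto simp: s_def)
  moreover have "pi / 2 < q" "q < pi" using ab1 by (auto simp: q_def a_def a'_def)
  ultimately have adm: "admissible c s q" and rng: "0 < s" "s < pi / 2" "pi / 2 < q" "q < pi"
    unfolding admissible_def using A12(2) A21(2) by (simp_all add: e)
  have "is_cone c s q u"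
    unfolding is_cone_def
  proof (intro allI impI)
    fix r w :: real assume "0 \<le> r" and w: "\<bar>w\<bar> \<le> pi"
    show "u (pol r (c + w)) = cone_value c s q r w"
    proof (cases "r = 0")
      case True
      have "u 0 = 0" using between[of 0] by (simp add: quadratic_obstacle_def)
      then show ?thesis using True by (simp add: cone_value_def quadratic_obstacle_def)
    next
      case False
      then have r: "0 < r" using \<open>0 \<le> r\<close> by simp
      consider "\<bar>w\<bar> \<le> s" | "q \<le> \<bar>w\<bar>" "0 \<le> w" | "q \<le> \<bar>w\<bar>" "w < 0" | "s < w" "w < q" | "- q < w" "w < - s"
        by linarith
      then show ?thesis
      proof cases
        case 1
        then have "D2 (c + w) = 0" by (intro D2z) (auto simp: e)
        then have "u (pol r (c + w)) = p2 (pol r (c + w))"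
          using conic2[OF r, of "c + w"] unfolding D2_def by linarith
        then show ?thesis using 1 by (simp add: cone_value_def)
      next
        case 2
        then have "D1 (c + w) = 0" using w rng by (intro D1z') (auto simp: e)
        then have "u (pol r (c + w)) = p1 (pol r (c + w))"
          using conic1[OF r, of "c + w"] unfolding D1_def by linarith
        then show ?thesis using 2 rng by (simp add: cone_value_def)
      next
        case 3
        have "c + q - 2 * pi = x1" "y1 = c - q" using e by (auto simp: a'_def a_def)
        then have "D1 (c + w) = 0" using w rng 3 by (intro D1z) auto
        then have "u (pol r (c + w)) = p1 (pol r (c + w))"
          using conic1[OF r, of "c + w"] unfolding D1_def by linarith
        then show ?thesis using 3 rng by (simp add: cone_value_def)
      next
        case 4
        then have "u (pol r (c + w)) = p1 (pol r (c + w)) + m1 * r\<^sup>2 * (sin (c + w - a'))\<^sup>2"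
          using r D1a by (intro arc_formula(1)[OF arc2]) (auto simp: e)
        moreover have "c + w - a' = \<bar>w\<bar> - q" using 4 rng by (simp add: e)
        ultimately show ?thesis using 4 rng by (auto simp: cone_value_def)
      next
        case 5
        then have "u (pol r (c + w)) = p1 (pol r (c + w)) + m1 * r\<^sup>2 * (sin (c + w - a))\<^sup>2"
          using r D1a by (intro arc_formula(1)[OF arc1]) (auto simp: e)
        moreover have "c + w - a = - (\<bar>w\<bar> - q)" using 5 rng by (simp add: e)
        ultimately show ?thesis using 5 rng by (auto simp only: cone_value_def Let_def sin_minus power2_minus split: if_splits)
      qed
    qed
  qed
  with adm show ?thesis by blast
qed

text \<open>The equation \<open>d * sin (2 * c) = 0\<close> concerns only the axis: for
  \<open>d \<noteq> 0\<close> it has to be a coordinate axis. The other two equations describe a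
  triangle with sides \<open>m1\<close>, \<open>m2\<close> and signed base
  \<open>- d * cos (2 * c)\<close>.\<close>

lemma admissible_iff:
  "admissible c s q \<longleftrightarrow> 0 < s \<and> s < pi / 2 \<and> pi / 2 < q \<and> q < pi \<and> d * sin (2 * c) = 0 \<and>
     m1 * sin (2 * q) + m2 * sin (2 * s) = 0 \<and> m1 * cos (2 * q) + m2 * cos (2 * s) = - d * cos (2 * c)"
proof -
  define P where "P = m1 * cos (2 * q) + m2 * cos (2 * s)"
  define R where "R = m1 * sin (2 * q) + m2 * sin (2 * s)"
  define C where "C = cos (2 * c)"
  define S where "S = sin (2 * c)"
  have CS: "C * C + S * S = 1" using sin_cos_squared_add3[of "2 * c"] by (simp add: C_def S_def)
  have "matching m1 m2 d (c - q) (c - s) \<longleftrightarrow> C * P + S * R = - d \<and> S * P - C * R = 0"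
    by (simp add: matching_def cos_diff sin_diff right_diff_distrib P_def R_def C_def S_def algebra_simps)
  moreover have "matching m1 m2 d (c + q) (c + s) \<longleftrightarrow> C * P - S * R = - d \<and> S * P + C * R = 0"
    by (simp add: matching_def cos_add sin_add distrib_left P_def R_def C_def S_def algebra_simps)
  moreover note rotation_system_iff[OF CS, of P R d]
  ultimately show ?thesis unfolding admissible_def P_def R_def C_def S_def by blast
qed

text \<open>The law of cosines for the angle \<open>2 * (q - s)\<close>, combined with
  \<open>d^2 - (m1 - m2)^2 = - 4 * (a1 + c2) * (a2 + c1)\<close>.\<close>

lemma admissible_cos_sq:
  assumes "admissible c s q"
  shows "(cos (q - s))\<^sup>2 * ((a1 + c1) * (a2 + c2)) = (a1 + c2) * (a2 + c1)"
proof -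
  have "matching m1 m2 d (c + q) (c + s)" using assms by (simp add: admissible_def)
  then have "d\<^sup>2 = m1\<^sup>2 + m2\<^sup>2 + 2 * m1 * m2 * cos (2 * (c + q) - 2 * (c + s))"
    by (rule match_law_of_cosines)
  also have "cos (2 * (c + q) - 2 * (c + s)) = 2 * (cos (q - s))\<^sup>2 - 1"
    using cos_double_cos[of "q - s"] by (simp add: algebra_simps)
  finally have "4 * ((cos (q - s))\<^sup>2 * (m1 * m2)) = d\<^sup>2 - (m1 - m2)\<^sup>2"
    by (simp add: power2_eq_square algebra_simps)
  also have "\<dots> = - (4 * ((a1 + c2) * (a2 + c1)))"
    by (simp add: power2_eq_square algebra_simps)
  finally show ?thesis by (simp add: algebra_simps)
qed

lemma double_cone_iff:
  "double_cone u \<longleftrightarrow> (\<exists>c s q. admissible c s q \<and> is_cone c s q u)"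
  using double_cone_is_cone cone_exists is_cone_unique by metis

lemma cone_gap_zero:
  assumes "admissible c s q" and "(a1 + c2) * (a2 + c1) = 0"
  shows "q - s = pi / 2"
proof -
  have A: "0 < s" "s < pi / 2" "pi / 2 < q" "q < pi" using assms by (auto simp: admissible_def)
  have "(cos (q - s))\<^sup>2 = 0" using admissible_cos_sq[OF assms(1)] assms(2) neg1 pos2 by auto
  then have "cos (q - s) = cos (pi / 2)" by simp
  then show ?thesis by (rule cos_inj_pi[rotated 4]) (use A in auto)
qed

text \<open>In \<open>admissible_cos_sq\<close> the left side is at most 0 and the right side at
  least 0, so both vanish and \<open>q - s = pi / 2\<close>. The triangle then degenerates to
  \<open>m1 = m2\<close> and \<open>d = 0\<close>, which means that \<open>a1 + c2\<close> and
  \<open>a2 + c1\<close> are both zero.\<close>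

lemma no_double_cone:
  assumes "(a1 + c2) * (c1 + a2) \<ge> 0" "a1 + c2 \<noteq> 0 \<or> a2 + c1 \<noteq> 0"
  shows "\<not> double_cone u"
proof
  assume "double_cone u"
  then obtain c s q where adm: "admissible c s q" unfolding double_cone_iff by blast
  have st: "(a1 + c1) * (a2 + c2) < 0" using neg1 pos2 by (rule mult_neg_pos)
  have "(cos (q - s))\<^sup>2 * ((a1 + c1) * (a2 + c2)) \<le> 0"
    by (rule mult_nonneg_nonpos[OF zero_le_power2 less_imp_le[OF st]])
  then have X: "(a1 + c2) * (a2 + c1) = 0"
    using admissible_cos_sq[OF adm] assms(1) by (simp add: add.commute)
  have q: "2 * q = 2 * s + pi" using cone_gap_zero[OF adm X] by simp
  have *: "0 < s" "s < pi / 2" "d * sin (2 * c) = 0" "m1 * sin (2 * q) + m2 * sin (2 * s) = 0"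
    "m1 * cos (2 * q) + m2 * cos (2 * s) = - d * cos (2 * c)"
    using adm unfolding admissible_iff by blast+
  have "sin (2 * s) > 0" using * by (intro sin_gt_zero) auto
  moreover have "(m2 - m1) * sin (2 * s) = 0" using *(4) unfolding q by (simp add: algebra_simps)
  ultimately have m: "m1 = m2" by (metis eq_iff_diff_eq_0 less_irrefl mult_eq_0_iff)
  have "d * cos (2 * c) = 0" using *(5) unfolding q m by auto
  with *(3) have "d = 0" by (rule mult_sin_cos_zero)
  then have "a1 + c2 = 0" "a2 + c1 = 0" using m by auto
  then show False using assms(2) by simp
qed

text \<open>The axis direction of one cone lies in its contact set with \<open>p2\<close>, which in
  terms of the other cone stays less than a quarter turn from the other axis. This tells cones with
  different axes apart.\<close>

lemma cone_center_contact:
  assumes u: "admissible c s q" "is_cone c s q u" and u': "admissible c' s' q'" "is_cone c' s' q' u"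
    and w: "pi / 2 \<le> \<bar>w\<bar>" "\<bar>w\<bar> \<le> pi" "pol 1 (c' + w) = pol 1 c"
  shows False
proof -
  have s: "0 < s" "s' < pi / 2" using u(1) u'(1) by (auto simp: admissible_def)
  have "u (pol 1 c) = p2 (pol 1 c)"
    using is_cone_between(4)[OF u, of 1 0] s by simp
  then have "\<bar>w\<bar> \<le> s'"
    using is_cone_between(4)[OF u', of 1 w] w(2) unfolding w(3) by simp
  then show False using s w by simp
qed

lemma is_cone_shift:
  assumes "is_cone c s q u"
  shows "is_cone (c + turns k) s q u"
proof -
  have e: "pol r (c + turns k + w) = pol r (c + w)" for r w
  proof -
    have "pol 1 (c + w + turns k) = pol 1 (c + w)"
      using polar_point_1_eq_iff by blast
    then have "r *\<^sub>R pol 1 (c + w + turns k) = r *\<^sub>R pol 1 (c + w)" by simp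
    moreover have "c + turns k + w = c + w + turns k" by simp
    ultimately show ?thesis by (simp only: scale_polar_point mult_1_right)
  qed
  show ?thesis using assms unfolding is_cone_def cone_value_def e .
qed

lemma infinite_double_cones:
  assumes "a2 + c1 = 0" "c2 + a1 = 0"
  shows "infinite {u. double_cone u}"
proof -
  have eq: "m1 = m2" "d = 0" using assms by auto
  \<comment> \<open>With \<open>m1 = m2\<close> and \<open>d = 0\<close> every \<open>s\<close> is
    allowed as soon as \<open>q = s + pi / 2\<close>. The axis is kept at angle 0, and the opening
    of the \<open>p2\<close> cone distinguishes the solutions.\<close>
  have adm: "admissible 0 s (s + pi / 2)" if "s \<in> {0<..<pi / 2}" for s
  proof -
    have "2 * (s + pi / 2) = 2 * s + pi" by simp
    then show ?thesis unfolding admissible_iff eq using that by simp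
  qed
  have "\<forall>s\<in>{0<..<pi / 2}. \<exists>u. is_cone 0 s (s + pi / 2) u
      \<and> double_cone u"
    using cone_exists[OF adm] by blast
  then obtain U where U: "\<And>s. s \<in> {0<..<pi / 2} \<Longrightarrow> is_cone 0 s (s + pi / 2) (U s)"
    "\<And>s. s \<in> {0<..<pi / 2} \<Longrightarrow> double_cone (U s)"
    by metis
  have "inj_on U {0<..<pi / 2}"
  proof (rule linorder_inj_onI')
    fix s t assume st: "s \<in> {0<..<pi / 2}" "t \<in> {0<..<pi / 2}" "s < t"
    show "U s \<noteq> U t"
    proof
      assume e: "U s = U t"
      have "U t (pol 1 (0 + t)) = p2 (pol 1 (0 + t))"
        using is_cone_between(4)[OF adm[OF st(2)] U(1)[OF st(2)], of 1 t] st by auto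
      then show False
        using is_cone_between(4)[OF adm[OF st(1)] U(1)[OF st(1)], of 1 t] st unfolding e by auto
    qed
  qed
  moreover have "infinite {0<..<pi / 2}" by (rule infinite_Ioo) simp
  ultimately have "infinite (U ` {0<..<pi / 2})" using finite_imageD by blast
  moreover have "U ` {0<..<pi / 2} \<subseteq> {u. double_cone u}"
    using U(2) by blast
  ultimately show ?thesis using infinite_super by blast
qed

end

text \<open>\<open>D\<close> is a signed base, since the axis direction contributes a sign. The law
  of cosines gives \<open>cos (2 * s) = x\<close> and \<open>cos (2 * q) = y\<close>, and the strict
  triangle inequalities keep both strictly between -1 and 1. As \<open>2 * s\<close> lies below
  \<open>pi\<close> and \<open>2 * q\<close> between \<open>pi\<close> and \<open>2 * pi\<close>,
  the cosines determine the angles.\<close>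

lemma triangle_angles:
  fixes m1 m2 D :: real
  assumes m: "m1 > 0" "m2 > 0" and D: "\<bar>m1 - m2\<bar> < \<bar>D\<bar>" "\<bar>D\<bar> < m1 + m2"
  shows "\<exists>s q. 0 < s \<and> s < pi / 2 \<and> pi / 2 < q \<and> q < pi \<and>
    m1 * sin (2 * q) + m2 * sin (2 * s) = 0 \<and> m1 * cos (2 * q) + m2 * cos (2 * s) = D"
    and "\<lbrakk>0 < s; s < pi / 2; pi / 2 < q; q < pi;
      m1 * sin (2 * q) + m2 * sin (2 * s) = 0; m1 * cos (2 * q) + m2 * cos (2 * s) = D;
      0 < s'; s' < pi / 2; pi / 2 < q'; q' < pi;
      m1 * sin (2 * q') + m2 * sin (2 * s') = 0; m1 * cos (2 * q') + m2 * cos (2 * s') = D\<rbrakk>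
      \<Longrightarrow> s = s' \<and> q = q'"
proof -
  have D0: "D \<noteq> 0" using D by auto
  define x where "x = (D\<^sup>2 + m2\<^sup>2 - m1\<^sup>2) / (2 * D * m2)"
  define y where "y = (D\<^sup>2 + m1\<^sup>2 - m2\<^sup>2) / (2 * D * m1)"
  have mx: "2 * D * (m2 * x) = D\<^sup>2 + m2\<^sup>2 - m1\<^sup>2" and my: "2 * D * (m1 * y) = D\<^sup>2 + m1\<^sup>2 - m2\<^sup>2"
    using D0 m by (simp_all add: x_def y_def)
  have bound: "\<bar>(D\<^sup>2 + q\<^sup>2 - p\<^sup>2) / (2 * D * q)\<bar> < 1" if "p > 0" "q > 0" "\<bar>p - q\<bar> < \<bar>D\<bar>" "\<bar>D\<bar> < p + q" for p q
  proof -
    have 1: "(\<bar>D\<bar> - q)\<^sup>2 < p\<^sup>2" using that by (intro power2_strict_mono) auto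
    have 2: "p\<^sup>2 < (\<bar>D\<bar> + q)\<^sup>2" using that by (intro power2_strict_mono) auto
    have "\<bar>D\<^sup>2 + q\<^sup>2 - p\<^sup>2\<bar> < 2 * \<bar>D\<bar> * q"
      using 1 2 by (simp add: power2_eq_square algebra_simps abs_less_iff)
    then show ?thesis using D0 that by (simp add: abs_divide abs_mult)
  qed
  have x: "\<bar>x\<bar> < 1" unfolding x_def by (rule bound) (use m D in auto)
  have y: "\<bar>y\<bar> < 1" unfolding y_def by (rule bound) (use m D in auto)
  show "\<exists>s q. 0 < s \<and> s < pi / 2 \<and> pi / 2 < q \<and> q < pi \<and>
    m1 * sin (2 * q) + m2 * sin (2 * s) = 0 \<and> m1 * cos (2 * q) + m2 * cos (2 * s) = D"
  proof (intro exI conjI)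
    define s where "s = arccos x / 2"
    define q where "q = pi - arccos y / 2"
    have ax: "0 < arccos x" "arccos x < pi" and ay: "0 < arccos y" "arccos y < pi"
      using arccos_lt_bounded[of x] arccos_lt_bounded[of y] x y by auto
    show "0 < s" "s < pi / 2" "pi / 2 < q" "q < pi" using ax ay by (auto simp: s_def q_def)
    have t: "2 * q = 2 * pi - arccos y" "2 * s = arccos x" by (simp_all add: q_def s_def)
    have c: "cos (2 * q) = y" "cos (2 * s) = x" using x y unfolding t by (simp_all add: cos_diff)
    have s: "sin (2 * q) = - sin (arccos y)" unfolding t by (simp add: sin_diff)
    have "2 * D * (m1 * y + m2 * x) = 2 * D * D"
      using mx my by (simp add: distrib_left power2_eq_square)
    then show "m1 * cos (2 * q) + m2 * cos (2 * s) = D" using D0 unfolding c by simp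
    \<comment> \<open>Both sides are the squared height of the triangle over its base.\<close>
    have sq: "(m1 * sin (arccos y))\<^sup>2 = (m2 * sin (arccos x))\<^sup>2"
    proof -
      have "(m1 * sin (arccos y))\<^sup>2 = m1\<^sup>2 - (m1 * y)\<^sup>2" "(m2 * sin (arccos x))\<^sup>2 = m2\<^sup>2 - (m2 * x)\<^sup>2"
        using x y by (simp_all add: power_mult_distrib sin_squared_eq algebra_simps)
      moreover have "(2 * D)\<^sup>2 * (m1\<^sup>2 - (m1 * y)\<^sup>2) = (2 * D)\<^sup>2 * (m2\<^sup>2 - (m2 * x)\<^sup>2)"
      proof -
        have "(2 * D)\<^sup>2 * (m1\<^sup>2 - (m1 * y)\<^sup>2) = (2 * D)\<^sup>2 * m1\<^sup>2 - (2 * D * (m1 * y))\<^sup>2"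
          "(2 * D)\<^sup>2 * (m2\<^sup>2 - (m2 * x)\<^sup>2) = (2 * D)\<^sup>2 * m2\<^sup>2 - (2 * D * (m2 * x))\<^sup>2"
          by (simp_all add: power_mult_distrib right_diff_distrib)
        then show ?thesis unfolding mx my by (simp add: power2_eq_square algebra_simps)
      qed
      ultimately show ?thesis using D0 by simp
    qed
    have "m1 * sin (arccos y) = m2 * sin (arccos x)"
      using sq by (rule power2_eq_imp_eq) (use m ax ay in \<open>auto intro!: mult_nonneg_nonneg sin_ge_zero\<close>)
    then show "m1 * sin (2 * q) + m2 * sin (2 * s) = 0" unfolding s unfolding t by simp
  qed
  have det: "cos (2 * s) = x \<and> cos (2 * q) = y"
    if "m1 * sin (2 * q) + m2 * sin (2 * s) = 0" "m1 * cos (2 * q) + m2 * cos (2 * s) = D" for s q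
  proof -
    have "m1\<^sup>2 * ((sin (2 * q))\<^sup>2 + (cos (2 * q))\<^sup>2) = (m1 * sin (2 * q))\<^sup>2 + (m1 * cos (2 * q))\<^sup>2"
      by (simp only: power_mult_distrib distrib_left)
    also have "\<dots> = (m2 * sin (2 * s))\<^sup>2 + (D - m2 * cos (2 * s))\<^sup>2"
    proof -
      have "m1 * sin (2 * q) = - (m2 * sin (2 * s))" "m1 * cos (2 * q) = D - m2 * cos (2 * s)"
        using that by linarith+
      then show ?thesis by (simp only: power2_minus)
    qed
    also have "\<dots> = m2\<^sup>2 * ((sin (2 * s))\<^sup>2 + (cos (2 * s))\<^sup>2) + D\<^sup>2 - 2 * D * m2 * cos (2 * s)"
    proof -
      have "(m2 * p)\<^sup>2 + (D - m2 * q)\<^sup>2 = m2\<^sup>2 * (p\<^sup>2 + q\<^sup>2) + D\<^sup>2 - 2 * D * m2 * q" for p q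
        by (simp add: power2_eq_square algebra_simps)
      then show ?thesis .
    qed
    finally have "2 * D * m2 * cos (2 * s) = D\<^sup>2 + m2\<^sup>2 - m1\<^sup>2" by (simp only: sin_cos_squared_add mult_1_right)
    then have s: "cos (2 * s) = x" using D0 m by (simp add: x_def field_simps)
    have "2 * D * (m1 * cos (2 * q)) = 2 * D * D - 2 * D * (m2 * x)"
    proof -
      have "m1 * cos (2 * q) = D - m2 * x" using that(2) unfolding s by linarith
      then show ?thesis by (simp only: right_diff_distrib)
    qed
    also have "\<dots> = 2 * D * (m1 * y)" unfolding mx my by (simp add: power2_eq_square)
    finally have "cos (2 * q) = y" using D0 m by simp
    with s show ?thesis by simp
  qed
  show "s = s' \<and> q = q'"
    if *: "0 < s" "s < pi / 2" "pi / 2 < q" "q < pi"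
      "m1 * sin (2 * q) + m2 * sin (2 * s) = 0" "m1 * cos (2 * q) + m2 * cos (2 * s) = D"
      "0 < s'" "s' < pi / 2" "pi / 2 < q'" "q' < pi"
      "m1 * sin (2 * q') + m2 * sin (2 * s') = 0" "m1 * cos (2 * q') + m2 * cos (2 * s') = D"
  proof -
    have c: "cos (2 * s) = cos (2 * s')" "cos (2 * q) = cos (2 * q')"
      using det[OF *(5,6)] det[OF *(11,12)] by auto
    have "2 * s = 2 * s'" by (rule cos_inj_pi[OF _ _ _ _ c(1)]) (use * in auto)
    moreover have "cos (2 * pi - 2 * q) = cos (2 * pi - 2 * q')" using c(2) by (simp add: cos_diff)
    then have "2 * pi - 2 * q = 2 * pi - 2 * q'" by (rule cos_inj_pi[rotated 4]) (use * in auto)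
    ultimately show ?thesis by simp
  qed
qed

context obstacles
begin

text \<open>The product equals \<open>((m1 - m2)^2 - d^2) / 4\<close>, so its sign makes the
  triangle nondegenerate and \<open>d\<close> nonzero. The axis angle is then
  \<open>k * pi / 2\<close>, with four values modulo a full turn, and each of them carries exactly
  one triangle.\<close>

lemma four_double_cones:
  assumes X: "(a1 + c2) * (c1 + a2) < 0"
  shows "card {u. double_cone u} = 4"
proof -
  have m: "m1 > 0" "m2 > 0" using neg1 pos2 by auto
  have "(m1 - m2)\<^sup>2 - d\<^sup>2 = 4 * ((a1 + c2) * (c1 + a2))"
    by (simp add: power2_eq_square algebra_simps)
  then have "(m1 - m2)\<^sup>2 < d\<^sup>2" using X by linarith
  then have d1: "\<bar>m1 - m2\<bar> < \<bar>d\<bar>" by (rule power2_less_imp_less[of "\<bar>m1 - m2\<bar>" "\<bar>d\<bar>", unfolded power2_abs]) simp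
  have d0: "d \<noteq> 0" using d1 by auto
  have cosk: "\<bar>cos (2 * (of_int k * pi / 2))\<bar> = 1" "sin (2 * (of_int k * pi / 2)) = 0" for k :: int
  proof -
    have e: "2 * (of_int k * pi / 2) = pi * of_int k" by simp
    show "sin (2 * (of_int k * pi / 2)) = 0" unfolding e by simp
    then show "\<bar>cos (2 * (of_int k * pi / 2))\<bar> = 1" by (rule sin_zero_abs_cos_one)
  qed
  have tri: "\<bar>m1 - m2\<bar> < \<bar>- d * cos (2 * (of_int k * pi / 2))\<bar>" "\<bar>- d * cos (2 * (of_int k * pi / 2))\<bar> < m1 + m2" for k :: int
    unfolding abs_mult cosk using d1 d_less by simp_all
  have "\<exists>s q. admissible (of_int k * pi / 2) s q" for k :: int
    using triangle_angles(1)[OF m tri[of k]] cosk(2)[of k] unfolding admissible_iff by simp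
  then obtain s q where adm: "\<And>k :: int. admissible (of_int k * pi / 2) (s k) (q k)" by metis
  obtain U where U: "\<And>k :: int. is_cone (of_int k * pi / 2) (s k) (q k) (U k)"
    "\<And>k :: int. double_cone (U k)"
    using cone_exists[OF adm] by metis
  have "{u. double_cone u} = U ` {0..<4}"
  proof (intro set_eqI iffI)
    fix u assume "u \<in> {u. double_cone u}"
    then obtain c x y where a: "admissible c x y" and u: "is_cone c x y u" unfolding mem_Collect_eq double_cone_iff by blast
    have "sin (2 * c) = 0" using a d0 unfolding admissible_iff by simp
    then obtain n :: int where n: "2 * c = of_int n * pi" unfolding sin_zero_iff_int2 by blast
    define k where "k = n mod 4"
    have "n = k + 4 * (n div 4)" by (simp add: k_def)
    then have "real_of_int n = real_of_int k + 4 * real_of_int (n div 4)" by (metis of_int_add of_int_mult of_int_numeral)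
    then have c: "of_int k * pi / 2 = c + turns (- (n div 4))" using n by (simp add: field_simps)
    have u': "is_cone (of_int k * pi / 2) x y u" unfolding c by (rule is_cone_shift[OF u])
    have "cos (c + turns (- (n div 4)) + c + turns (- (n div 4))) = cos (2 * c)"
    proof -
      have "cos (2 * c + turns (- (n div 4) + - (n div 4))) = cos (2 * c)" by (rule periodic_int) simp
      then show ?thesis by (simp add: algebra_simps)
    qed
    then have cc: "cos (2 * (of_int k * pi / 2)) = cos (2 * c)" unfolding c by (simp add: algebra_simps)
    have a': "admissible (of_int k * pi / 2) x y"
      using a cosk(2)[of k] unfolding admissible_iff cc by simp
    have "x = s k \<and> y = q k"
      using a' adm[of k] unfolding admissible_iff
      by (intro triangle_angles(2)[OF m tri[of k]]) simp_all
    then have "u = U k" using is_cone_unique[OF u' ] U(1)[of k] by simp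
    moreover have "k \<in> {0..<4}" by (simp add: k_def)
    ultimately show "u \<in> U ` {0..<4}" by blast
  qed (use U(2) in auto)
  moreover have "inj_on U {0..<4}"
  proof (rule linorder_inj_onI')
    fix k l :: int assume kl: "k \<in> {0..<4}" "l \<in> {0..<4}" "k < l"
    \<comment> \<open>A difference of three quarter turns is replaced by one quarter turn backwards,
      to stay within the window \<open>\<bar>w\<bar> \<le> pi\<close>.\<close>
    define w where "w = (if l - k = 3 then - pi / 2 else of_int (l - k) * pi / 2)"
    have cases: "l - k = 1 \<or> l - k = 2 \<or> l - k = 3" using kl by auto
    have w: "pi / 2 \<le> \<bar>w\<bar>" "\<bar>w\<bar> \<le> pi" using cases by (auto simp: w_def)
    have "of_int k * pi / 2 + w = of_int l * pi / 2 + turns (if l - k = 3 then -1 else 0)"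
    proof -
      have "real_of_int l = real_of_int k + real_of_int (l - k)" by simp
      then show ?thesis using cases by (auto simp: w_def field_simps)
    qed
    then have p: "pol 1 (of_int k * pi / 2 + w) = pol 1 (of_int l * pi / 2)"
      unfolding polar_point_1_eq_iff by blast
    show "U k \<noteq> U l"
    proof
      assume e: "U k = U l"
      show False
        by (rule cone_center_contact[OF adm[of l] U(1)[of l] adm[of k] U(1)[of k, unfolded e] w p])
    qed
  qed
  ultimately show ?thesis by (simp add: card_image)
qed

end

theorem theorem3p8:
  fixes a1 a2 c1 c2 l1 l2 :: real and p1 p2 :: "real^2 \<Rightarrow> real"
  assumes "a1 < a2" and "c1 < c2" and "a1 + c1 < 0" and "a2 + c2 > 0"
    and "p1 = quadratic_obstacle a1 c1" and "p2 = quadratic_obstacle a2 c2"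
    and "l1 = 2 * (a1 + c1)" and "l2 = 2 * (a2 + c2)"
  shows "(\<forall>u0. global_solution l1 l2 p1 p2 u0 \<and> homogeneous_deg2 u0 \<and>
            \<not> real_polynomial_function u0 \<and>
            \<not> halfspace_solution1 l1 p1 p2 u0 \<and> \<not> halfspace_solution2 l2 p1 p2 u0 \<longrightarrow>
            double_cone_solution l1 l2 p1 p2 u0) \<and>
         (a2 + c1 = 0 \<and> c2 + a1 = 0 \<longrightarrow>
            infinite {u. double_cone_solution l1 l2 p1 p2 u} \<and>
            (\<forall>u. double_cone_solution l1 l2 p1 p2 u \<longrightarrow>
               noncoincidence_angles p1 p2 u (pi / 2) (pi / 2))) \<and>
         ((a1 + c2) * (c1 + a2) < 0 \<longrightarrow>
            card {u. double_cone_solution l1 l2 p1 p2 u} = 4 \<and>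
            (\<forall>u. double_cone_solution l1 l2 p1 p2 u \<longrightarrow>
               (\<exists>\<theta>. noncoincidence_angles p1 p2 u \<theta> \<theta> \<and>
                  (cos \<theta>)\<^sup>2 = ((a1 + c2) * (a2 + c1)) / ((a1 + c1) * (a2 + c2)))) \<and>
            ((a1 + c2) * (a2 + c1)) / ((a1 + c1) * (a2 + c2)) \<in> {0<..<1}) \<and>
         ((a1 + c2) * (c1 + a2) \<ge> 0 \<and> (a1 + c2 \<noteq> 0 \<or> a2 + c1 \<noteq> 0) \<longrightarrow>
            (\<nexists>u. double_cone_solution l1 l2 p1 p2 u))"
proof -
  interpret obstacles a1 a2 c1 c2 by unfold_locales (use assms in auto)
  have st: "(a1 + c1) * (a2 + c2) < 0" using assms(3,4) by (rule mult_neg_pos)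
  have part0: "double_cone_solution l1 l2 p1 p2 u0"
    if "global_solution l1 l2 p1 p2 u0" "homogeneous_deg2 u0" "\<not> real_polynomial_function u0"
      "\<not> halfspace_solution1 l1 p1 p2 u0" "\<not> halfspace_solution2 l2 p1 p2 u0" for u0
  proof -
    interpret homogeneous_solution a1 a2 c1 c2 u0
      by unfold_locales (use that assms in auto)
    show ?thesis using classification that assms by simp
  qed
  have angles: "\<exists>\<theta>. noncoincidence_angles p1 p2 u \<theta> \<theta> \<and>
      (cos \<theta>)\<^sup>2 = ((a1 + c2) * (a2 + c1)) / ((a1 + c1) * (a2 + c2))"
    if dc: "double_cone_solution l1 l2 p1 p2 u" for u
  proof -
    obtain c s q where adm: "admissible c s q" and u: "is_cone c s q u"
      using dc unfolding assms(5-8) double_cone_iff by blast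
    have "(cos (q - s))\<^sup>2 = ((a1 + c2) * (a2 + c1)) / ((a1 + c1) * (a2 + c2))"
      using st by (intro eq_divide_imp admissible_cos_sq[OF adm]) (rule less_imp_neq)
    then show ?thesis
      using is_cone_angles[OF adm u] assms(5,6) by blast
  qed
  have right_angles: "noncoincidence_angles p1 p2 u (pi / 2) (pi / 2)"
    if dc: "double_cone_solution l1 l2 p1 p2 u" and X: "a2 + c1 = 0" for u
  proof -
    obtain c s q where adm: "admissible c s q" and u: "is_cone c s q u"
      using dc unfolding assms(5-8) double_cone_iff by blast
    have "q - s = pi / 2" by (rule cone_gap_zero[OF adm]) (simp add: X)
    from is_cone_angles[OF adm u, unfolded this] show ?thesis
      unfolding assms(5,6) .
  qed
  have range: "((a1 + c2) * (a2 + c1)) / ((a1 + c1) * (a2 + c2)) \<in> {0<..<1}" if X: "(a1 + c2) * (c1 + a2) < 0"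
  proof -
    \<comment> \<open>This product is the numerator minus the denominator of the quotient; both are
      negative, which places the quotient below 1.\<close>
    have "(a2 - a1) * (c2 - c1) > 0" using assms by simp
    then have "(a1 + c1) * (a2 + c2) < (a1 + c2) * (a2 + c1)" by (simp add: algebra_simps)
    moreover have "(a1 + c2) * (a2 + c1) < 0" using X by (simp add: add.commute)
    ultimately show ?thesis using st by (simp add: divide_neg_neg neg_divide_less_eq)
  qed
  have infinite: "infinite {u. double_cone_solution l1 l2 p1 p2 u}" if "a2 + c1 = 0" "c2 + a1 = 0"
    unfolding assms(5-8) by (rule infinite_double_cones[OF that])
  have four: "card {u. double_cone_solution l1 l2 p1 p2 u} = 4" if "(a1 + c2) * (c1 + a2) < 0"
    unfolding assms(5-8) by (rule four_double_cones[OF that])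
  have none: "\<not> double_cone_solution l1 l2 p1 p2 u"
    if "(a1 + c2) * (c1 + a2) \<ge> 0" "a1 + c2 \<noteq> 0 \<or> a2 + c1 \<noteq> 0" for u
    unfolding assms(5-8) by (rule no_double_cone[OF that])
  show ?thesis
    by (intro conjI impI allI notI; (elim conjE exE)?)
      (use part0 angles right_angles range infinite four none in \<open>blast+\<close>)
qed

end
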